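(* Let $N>2$ be an integer. Let $V$ be a locally Lipschitz continuous function on $\mathbb{R}^N\setminus\{0\}$ such that for some $a_0<N$, $a_\infty>a_0$, $c_1>0$, $$V(x)\le V_0(x):=\frac{c_1}{|x|^{a_0}(1+|x|^{a_\infty-a_0})},\qquad x\in\mathbb{R}^N\setminus\{0\},$$ and let $p>0$ satisfy $p\in\left(\frac{N-a_\infty}{N-2},\frac{N-a_0}{N-2}\right)$. Then: (i) There exists $k^*=k^*(p,V)\in(0,+\infty]$ such that for $k\in(0,k^* )$ there exists a minimal positive solution $u_{k,V}$ of $(P_k)$, and for $p>1$ and $k>k^*$ there is no solution of $(P_k)$. Moreover, $k^*<\infty$ if $p>1$; and $k^*=+\infty$ if $0<p<1$, or if $p=1$ and $c_1>0$ is small. (ii) For $p$ fixed, the mapping $V\mapsto k^*$ is decreasing and the mapping $V\mapsto u_{k,V}$ is increasing. (iii) If $V$ is radially symmetric, then the minimal solution $u_{k,V}$ is also radially symmetric.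
   Context: For $k>0$, $(P_k)$ denotes the problem $$-\Delta u=Vu^p+k\delta_0\ \text{ in }\mathbb{R}^N,\qquad \lim_{|x|\to+\infty}u(x)=0,$$ where $\delta_0$ is the Dirac mass at the origin. A (weak) solution of $(P_k)$ is a nonnegative function $u\in L^1_{loc}(\mathbb{R}^N)$ such that $Vu^p\in L^1(\mathbb{R}^N)$, $\lim_{r\to+\infty}\sup_{x\in\mathbb{R}^N\setminus B_r(0)}u(x)=0$, and $$\int_{\mathbb{R}^N}u(-\Delta)\xi\,dx=\int_{\mathbb{R}^N}Vu^p\xi\,dx+k\xi(0)\qquad\forall\,\xi\in C^{1,1}_c(\mathbb{R}^N).$$ A minimal positive solution of $(P_k)$ is a positive solution $u_{k,V}$ such that $u_{k,V}\le u$ for every positive solution $u$ of $(P_k)$. The number $k^*$ is $\sup\{k>0:\ (P_k)\text{ has a minimal solution for }k\}$. Monotonicity in (ii) is with respect to the pointwise order and in the non-strict sense: if $V_1\ge V_2$, then $k^*(p,V_1)\le k^*(p,V_2)$ and $u_{k,V_2}\le u_{k,V_1}$ for $k\in(0,k^*(p,V_1))$.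
   Formalization: V is assumed nonnegative (0 ≤ V ≤ V_0); k* < ∞ for p > 1 is claimed only when V is not identically zero off the origin; k* > 0 is claimed for p = 1 only when c_1 is small. Without these the statement fails (e.g. V = 0, or p = 1 with V = V_0 and c_1 large). *)

theory Defs
  imports "HOL-Analysis.Analysis" "HOL-Probability.Essential_Supremum"
begin

text \<open>
  Elements of \<open>L\<^sup>1\<^sub>l\<^sub>o\<^sub>c\<close> are identified when they agree Lebesgue-almost everywhere. Accordingly all pointwise
  conditions on solutions below hold almost everywhere and suprema of solutions are essential
  suprema. Potentials live on the punctured space: their value at the origin is
  unconstrained and plays no role.
\<close>

definition V0_bound :: "real \<Rightarrow> real \<Rightarrow> real \<Rightarrow> real^'n \<Rightarrow> real" where
  "V0_bound a0 a_inf c1 x = c1 / (norm x powr a0 * (1 + norm x powr (a_inf - a0)))"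

definition admissible_potential ::
    "real \<Rightarrow> real \<Rightarrow> real \<Rightarrow> (real^'n \<Rightarrow> real) \<Rightarrow> bool" where
  "admissible_potential a0 a_inf c1 V \<longleftrightarrow>
     local_lipschitz (UNIV :: real set) (- {0}) (\<lambda>_. V) \<and>
     (\<forall>x. x \<noteq> 0 \<longrightarrow> 0 \<le> V x \<and> V x \<le> V0_bound a0 a_inf c1 x)"

definition partial_deriv :: "'n \<Rightarrow> (real^'n \<Rightarrow> real) \<Rightarrow> real^'n \<Rightarrow> real" where
  "partial_deriv i f x = deriv (\<lambda>t. f (x + t *\<^sub>R axis i 1)) 0"

text \<open>
  For a function of class \<open>C\<^sup>1\<^sup>,\<^sup>1\<close> the second partial derivatives exist only almost everywhere;
  the arbitrary value of \<^const>\<open>deriv\<close> on the remaining null set does not affect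
  integrals with respect to the complete measure \<^const>\<open>lebesgue\<close>.
\<close>

definition laplacian :: "(real^'n \<Rightarrow> real) \<Rightarrow> real^'n \<Rightarrow> real" where
  "laplacian f x = (\<Sum>i\<in>UNIV. partial_deriv i (partial_deriv i f) x)"

text \<open>With compact support, a locally Lipschitz gradient is globally Lipschitz.\<close>

definition C11_c :: "(real^'n \<Rightarrow> real) set" where
  "C11_c = {\<xi>. compact (closure {x. \<xi> x \<noteq> 0}) \<and>
     (\<exists>g L. (\<forall>x. (\<xi> has_derivative (\<lambda>h. g x \<bullet> h)) (at x)) \<and> L-lipschitz_on UNIV g)}"

definition L1_loc :: "(real^'n \<Rightarrow> real) set" where
  "L1_loc = {u. \<forall>K. compact K \<longrightarrow> set_integrable lebesgue K u}"

definition is_solution ::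
    "real \<Rightarrow> (real^'n \<Rightarrow> real) \<Rightarrow> real \<Rightarrow> (real^'n \<Rightarrow> real) \<Rightarrow> bool" where
  "is_solution p V k u \<longleftrightarrow>
     u \<in> L1_loc \<and>
     (AE x in lebesgue. 0 \<le> u x) \<and>
     integrable lebesgue (\<lambda>x. V x * u x powr p) \<and>
     ((\<lambda>r. esssup (restrict_space lebesgue (- ball 0 r)) (\<lambda>x. ereal (u x))) \<longlongrightarrow> 0) at_top \<and>
     (\<forall>\<xi>\<in>C11_c. (LINT x|lebesgue. u x * (- laplacian \<xi> x)) =
                   (LINT x|lebesgue. V x * u x powr p * \<xi> x) + k * \<xi> 0)"

definition is_positive_solution ::
    "real \<Rightarrow> (real^'n \<Rightarrow> real) \<Rightarrow> real \<Rightarrow> (real^'n \<Rightarrow> real) \<Rightarrow> bool" where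
  "is_positive_solution p V k u \<longleftrightarrow> is_solution p V k u \<and> (AE x in lebesgue. 0 < u x)"

definition is_minimal_solution ::
    "real \<Rightarrow> (real^'n \<Rightarrow> real) \<Rightarrow> real \<Rightarrow> (real^'n \<Rightarrow> real) \<Rightarrow> bool" where
  "is_minimal_solution p V k u \<longleftrightarrow>
     is_positive_solution p V k u \<and>
     (\<forall>w. is_positive_solution p V k w \<longrightarrow> (AE x in lebesgue. u x \<le> w x))"

text \<open>Taken in \<open>[0, \<infinity>]\<close>, so that the supremum of the empty set is \<open>0\<close>.\<close>

definition k_star :: "real \<Rightarrow> (real^'n \<Rightarrow> real) \<Rightarrow> ennreal" where
  "k_star p V = Sup {ennreal k | k. 0 < k \<and> (\<exists>u. is_minimal_solution p V k u)}"

definition radially_symmetric :: "(real^'n \<Rightarrow> real) \<Rightarrow> bool" where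
  "radially_symmetric f \<longleftrightarrow> (\<forall>x y. norm x = norm y \<longrightarrow> f x = f y)"

definition radially_symmetric_AE :: "(real^'n \<Rightarrow> real) \<Rightarrow> bool" where
  "radially_symmetric_AE f \<longleftrightarrow> (\<exists>\<phi>. AE x in lebesgue. f x = \<phi> (norm x))"

end

theory Submission
  imports Defs
begin

text \<open>
  A solution \<open>u\<close> of \<open>(P\<^sub>k)\<close> satisfies \<open>u = k \<Gamma> + \<Gamma> * (V u\<^sup>p)\<close> almost everywhere, with \<open>\<Gamma>\<close> the
  Newtonian kernel: the difference of the two sides is weakly harmonic, and its averages over
  balls of radius \<open>R\<close> tend to zero as \<open>R\<close> grows, because \<open>u\<close> decays and potentials of integrable
  functions have ball integrals of order \<open>R\<^sup>2\<close>. Conversely every decaying integrable fixed point is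
  a solution. Hence monotone iteration from \<open>0\<close> below any supersolution produces the minimal
  solution, and a solution for \<open>(k, V)\<close> is a supersolution for every smaller \<open>(k', V')\<close>; this gives
  the threshold and monotonicity, and radial symmetry since the iteration commutes with rotations.
  Existence follows from the bound \<open>\<Gamma> * (V\<^sub>0 \<Gamma>\<^sup>p) \<le> C \<Gamma>\<close>, which makes \<open>t \<Gamma>\<close> a supersolution as soon
  as \<open>k + c\<^sub>1 C t\<^sup>p \<le> t\<close>. Finiteness of the threshold for \<open>p > 1\<close> comes from restricting the equation
  to a ball where \<open>V\<close> is bounded below.
\<close>

section \<open>Almost everywhere differentiability of Lipschitz functions along lines\<close>

text \<open>The test functions are only of class C^{1,1}, while \<open>laplacian\<close> is built
  from pointwise \<open>deriv\<close>. Before any integration by parts it must be known that second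
  partial derivatives exist almost everywhere; hence the Lebesgue differentiation argument for
  Lipschitz functions. The same low regularity pays off in uniqueness: it admits a test function
  whose Laplacian is a combination of indicators of two concentric balls, so the mean value property
  is read off the weak formulation, without mollification. Green's formula comes from the
  regularised kernel (|z|^2+e^2)^((2-N)/2), whose Laplacian is an explicit multiple of an
  approximate identity; the mass of that profile is the normalising constant, and neither polar
  coordinates nor surface area enters. The range of p says exactly that V_0 Gamma^p is integrable: p
  < (N-a_0)/(N-2) at the origin and p > (N-a_inf)/(N-2) at infinity. The iteration takes values in
  [0,\<infinity>] and acts on Borel functions, so Tonelli and monotone convergence apply without
  integrability side conditions.\<close>

text \<open>On the line a closed interval is a closed ball about its midpoint, so the covering
  theorem for balls applies. In the uses below \<open>P\<close> bounds a difference quotient and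
  confines the interval to a prescribed open set.\<close>

lemma Vitali_intervals:
  fixes E :: "real set" and P :: "real \<Rightarrow> real \<Rightarrow> bool"
  assumes "\<forall>t\<in>E. \<forall>d>0. \<exists>u v. u < v \<and> u \<le> t \<and> t \<le> v \<and> v - u < d \<and> P u v"
  shows "\<exists>C. countable C \<and> (\<forall>(u, v)\<in>C. u < v \<and> P u v) \<and>
    disjoint_family_on (\<lambda>(u, v). {u..v}) C \<and> negligible (E - (\<Union>(u, v)\<in>C. {u..v}))"
proof -
  define K where "K = {(u, v). u < v \<and> P u v}"
  define c where "c = (\<lambda>(u::real, v::real). (u + v) / 2)"
  define r where "r = (\<lambda>(u::real, v::real). (v - u) / 2)"
  have cb: "cball (c (u, v)) (r (u, v)) = {u..v}" for u v
    by (auto simp: c_def r_def cball_eq_atLeastAtMost field_simps)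
  have rK: "0 < r i" if "i \<in> K" for i
    using that by (auto simp: r_def K_def)
  have S: "\<exists>i. i \<in> K \<and> x \<in> cball (c i) (r i) \<and> r i < d" if x: "x \<in> E" and d: "0 < d" for x d
  proof -
    obtain u v where "u < v" "u \<le> x" "x \<le> v" "v - u < d" "P u v"
      using assms x d by blast
    then have "(u, v) \<in> K" "x \<in> cball (c (u, v)) (r (u, v))" "r (u, v) < d"
      unfolding cb by (auto simp: K_def r_def)
    then show ?thesis by blast
  qed
  obtain C where C: "countable C" "C \<subseteq> K"
     "pairwise (\<lambda>i j. disjnt (cball (c i) (r i)) (cball (c j) (r j))) C"
     "negligible (E - (\<Union>i \<in> C. cball (c i) (r i)))"
    using Vitali_covering_theorem_cballs[of K r E c] rK S by blast
  have cbi: "cball (c i) (r i) = (\<lambda>(u, v). {u..v}) i" for i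
    using cb by (cases i) auto
  show ?thesis
  proof (intro exI conjI)
    show "\<forall>(u, v)\<in>C. u < v \<and> P u v" using C(2) by (auto simp: K_def)
    show "disjoint_family_on (\<lambda>(u, v). {u..v}) C"
      using C(3) unfolding cbi by (auto simp: pairwise_def disjoint_family_on_def disjnt_def)
    show "negligible (E - (\<Union>(u, v)\<in>C. {u..v}))" using C(4) unfolding cbi .
  qed (rule C(1))
qed

text \<open>Two nested Vitali covers are compared through the Stieltjes measure of \<open>F\<close>:
  intervals of slope at most \<open>a\<close> inside an open U containing \<open>E\<close>, then
  intervals of slope at least \<open>b\<close> inside those. Their total increments give b |E| \<le>
  a |U|, and shrinking U to \<open>E\<close> gives b |E| \<le> a |E|, which forces |E| = 0.\<close>

lemma slope_gap_null_mono:
  fixes F :: "real \<Rightarrow> real"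
  assumes mono: "mono F" and cont: "\<And>x. isCont F x" and a: "0 \<le> a" "a < b"
    and E: "E \<in> sets borel" "emeasure lborel E < \<infinity>"
    and lo: "\<And>t d. t \<in> E \<Longrightarrow> 0 < d \<Longrightarrow>
       \<exists>u v. u < v \<and> u \<le> t \<and> t \<le> v \<and> v - u < d \<and> F v - F u \<le> a * (v - u)"
    and hi: "\<And>t d. t \<in> E \<Longrightarrow> 0 < d \<Longrightarrow>
       \<exists>u v. u < v \<and> u \<le> t \<and> t \<le> v \<and> v - u < d \<and> F v - F u \<ge> b * (v - u)"
  shows "E \<in> null_sets lborel"
proof -
  let ?M = "interval_measure F"
  have M: "emeasure ?M {u..v} = ennreal (F v - F u)" if "u \<le> v" for u v
    using that mono cont
    by (intro emeasure_interval_measure_Icc) (auto simp: mono_def intro: continuous_at_imp_continuous_on)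
  have le: "ennreal b * emeasure lborel E \<le> ennreal a * emeasure lborel U"
    if U: "open U" "E \<subseteq> U" for U
  proof -
    have "\<exists>u v. u < v \<and> u \<le> t \<and> t \<le> v \<and> v - u < d \<and> {u..v} \<subseteq> U \<and> F v - F u \<le> a * (v - u)"
      if t: "t \<in> E" and d: "0 < d" for t d
    proof -
      obtain e where e: "0 < e" "ball t e \<subseteq> U"
        using U t by (meson openE subsetD)
      obtain u v where uv: "u < v" "u \<le> t" "t \<le> v" "v - u < min d e" "F v - F u \<le> a * (v - u)"
        using lo[OF t, of "min d e"] d e by auto
      have "{u..v} \<subseteq> ball t e"
        using uv by (auto simp: dist_real_def)
      with uv e show ?thesis by (intro exI[of _ u] exI[of _ v]) auto
    qed
    then have "\<forall>t\<in>E. \<forall>d>0. \<exists>u v. u < v \<and> u \<le> t \<and> t \<le> v \<and> v - u < d \<and> {u..v} \<subseteq> U \<and> F v - F u \<le> a * (v - u)"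
      by blast
    from Vitali_intervals[OF this] obtain C where C: "countable C"
      "\<And>u v. (u, v) \<in> C \<Longrightarrow> u < v \<and> {u..v} \<subseteq> U \<and> F v - F u \<le> a * (v - u)"
      "disjoint_family_on (\<lambda>(u, v). {u..v}) C" "negligible (E - (\<Union>(u, v)\<in>C. {u..v}))"
      by fast
    \<comment> \<open>Open interiors leave room for a second Vitali cover inside the first; the
      endpoints given up form a countable set.\<close>
    define W where "W = (\<Union>(u, v)\<in>C. {u<..<v})"
    have "open W" by (auto simp: W_def)
    have EW: "\<exists>u v. u < v \<and> u \<le> t \<and> t \<le> v \<and> v - u < d \<and> {u..v} \<subseteq> W \<and> F v - F u \<ge> b * (v - u)"
      if t: "t \<in> E \<inter> W" and d: "0 < d" for t d
    proof -
      obtain e where e: "0 < e" "ball t e \<subseteq> W"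
        using \<open>open W\<close> t by (meson openE IntD2)
      obtain u v where uv: "u < v" "u \<le> t" "t \<le> v" "v - u < min d e" "F v - F u \<ge> b * (v - u)"
        using hi[of t "min d e"] t d e by auto
      have "{u..v} \<subseteq> ball t e"
        using uv by (auto simp: dist_real_def)
      with uv e show ?thesis by (intro exI[of _ u] exI[of _ v]) auto
    qed
    then have "\<forall>t\<in>E \<inter> W. \<forall>d>0. \<exists>u v. u < v \<and> u \<le> t \<and> t \<le> v \<and> v - u < d \<and> {u..v} \<subseteq> W \<and> F v - F u \<ge> b * (v - u)"
      by blast
    from Vitali_intervals[OF this] obtain D where D: "countable D"
      "\<And>u v. (u, v) \<in> D \<Longrightarrow> u < v \<and> {u..v} \<subseteq> W \<and> F v - F u \<ge> b * (v - u)"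
      "disjoint_family_on (\<lambda>(u, v). {u..v}) D" "negligible (E \<inter> W - (\<Union>(u, v)\<in>D. {u..v}))"
      by fast
    let ?I = "\<lambda>(u, v). {u..v::real}"
    have I[measurable]: "?I i \<in> sets borel" for i by (cases i) auto
    have sumI: "emeasure L (\<Union>(?I ` J)) = (\<integral>\<^sup>+i. emeasure L (?I i) \<partial>count_space J)"
      if "countable J" "disjoint_family_on ?I J" "sets L = sets borel" for J and L :: "real measure"
      using that I by (intro emeasure_UN_countable) auto
    have "negligible (\<Union>(u, v)\<in>C. {u, v})"
      using C(1) by (intro countable_imp_null_set_lborel[THEN null_sets_completionI, folded negligible_iff_null_sets]) auto
    then have neg: "negligible ((E - (\<Union>(?I ` C))) \<union> (\<Union>(u, v)\<in>C. {u, v}) \<union> (E \<inter> W - (\<Union>(?I ` D))))"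
      using C(4) D(4) by (intro negligible_Un) auto
    define Z where "Z = (E - (\<Union>(?I ` C))) \<union> (\<Union>(u, v)\<in>C. {u, v}) \<union> (E \<inter> W - (\<Union>(?I ` D)))"
    have sub: "E \<subseteq> Z \<union> \<Union>(?I ` D)"
    proof
      fix t assume t: "t \<in> E"
      show "t \<in> Z \<union> \<Union>(?I ` D)"
      proof (cases "t \<in> W \<or> t \<notin> \<Union>(?I ` C)")
        case True
        then show ?thesis using t by (auto simp only: Z_def)
      next
        case False
        then obtain u v where uv: "(u, v) \<in> C" "t \<in> {u..v}" by blast
        have "t \<notin> {u<..<v}" using False uv(1) unfolding W_def by blast
        then have "t \<in> {u, v}" using uv(2) by auto
        then show ?thesis using uv(1) unfolding Z_def by blast
      qed
    qed
    have Z: "Z \<in> null_sets lebesgue"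
      using neg by (simp add: negligible_iff_null_sets Z_def)
    have Dm: "\<Union>(?I ` D) \<in> sets borel" using D(1) I by (intro sets.countable_UN') auto
    have Cm: "\<Union>(?I ` C) \<in> sets borel" using C(1) I by (intro sets.countable_UN') auto
    have "emeasure lborel E = emeasure lebesgue E" using E by simp
    also have "\<dots> \<le> emeasure lebesgue (Z \<union> \<Union>(?I ` D))"
      using sub Z Dm by (intro emeasure_mono) auto
    also have "\<dots> \<le> emeasure lebesgue Z + emeasure lebesgue (\<Union>(?I ` D))"
      using Z Dm by (intro emeasure_subadditive) auto
    also have "emeasure lebesgue Z = 0"
      using Z by auto
    finally have 1: "emeasure lborel E \<le> emeasure lborel (\<Union>(?I ` D))"
      using Dm by simp
    have "ennreal b * emeasure lborel E \<le> ennreal b * emeasure lborel (\<Union>(?I ` D))"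
      by (intro mult_left_mono 1) auto
    also have "\<dots> = (\<integral>\<^sup>+i. ennreal b * emeasure lborel (?I i) \<partial>count_space D)"
      using D by (subst sumI) (auto simp: nn_integral_cmult)
    also have "\<dots> \<le> (\<integral>\<^sup>+i. emeasure ?M (?I i) \<partial>count_space D)"
    proof (intro nn_integral_mono, clarsimp)
      fix u v assume "(u, v) \<in> D"
      then have "u < v" "F v - F u \<ge> b * (v - u)" using D(2) by auto
      then show "ennreal b * emeasure lborel {u..v} \<le> emeasure ?M {u..v}"
        using a by (simp add: M ennreal_mult'[symmetric] ennreal_leI)
    qed
    also have "\<dots> = emeasure ?M (\<Union>(?I ` D))" using D by (subst sumI) auto
    also have "\<dots> \<le> emeasure ?M (\<Union>(?I ` C))"
    proof (rule emeasure_mono)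
      have "W \<subseteq> \<Union>(?I ` C)" unfolding W_def by (intro UN_mono) auto
      moreover have "\<Union>(?I ` D) \<subseteq> W" using D(2) by blast
      ultimately show "\<Union>(?I ` D) \<subseteq> \<Union>(?I ` C)" by blast
    qed (use Cm in auto)
    also have "\<dots> = (\<integral>\<^sup>+i. emeasure ?M (?I i) \<partial>count_space C)" using C by (subst sumI) auto
    also have "\<dots> \<le> (\<integral>\<^sup>+i. ennreal a * emeasure lborel (?I i) \<partial>count_space C)"
    proof (intro nn_integral_mono, clarsimp)
      fix u v assume "(u, v) \<in> C"
      then have "u < v" "F v - F u \<le> a * (v - u)" using C(2) by auto
      then show "emeasure ?M {u..v} \<le> ennreal a * emeasure lborel {u..v}"
        using a by (simp add: M ennreal_mult'[symmetric] ennreal_leI)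
    qed
    also have "\<dots> = ennreal a * emeasure lborel (\<Union>(?I ` C))"
      using C by (subst sumI) (auto simp: nn_integral_cmult)
    also have "\<dots> \<le> ennreal a * emeasure lborel U"
    proof (intro mult_left_mono emeasure_mono)
      show "\<Union>(?I ` C) \<subseteq> U" using C(2) by blast
    qed (use U in auto)
    finally show ?thesis .
  qed
  obtain m where m: "emeasure lborel E = ennreal m" "0 \<le> m"
    using E(2) by (cases "emeasure lborel E") auto
  have H: "b * m \<le> a * (m + e)" if "0 < e" for e
  proof -
    obtain U where U: "open U" "E \<subseteq> U" "emeasure lborel (U - E) < e"
      using outer_regular_lborel[OF E(1) \<open>0 < e\<close>] by blast
    have "emeasure lborel U = emeasure lborel (U - E) + emeasure lborel E"
      using E U by (subst plus_emeasure) (auto intro: arg_cong[where f="emeasure lborel"])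
    also have "\<dots> \<le> ennreal e + ennreal m"
      using U m by (intro add_mono) auto
    finally have "ennreal a * emeasure lborel U \<le> ennreal a * ennreal (m + e)"
      using m that by (intro mult_left_mono) (auto simp: ennreal_plus[symmetric] add.commute simp del: ennreal_plus)
    then have "ennreal b * ennreal m \<le> ennreal a * ennreal (m + e)"
      using le[OF U(1,2)] m by (metis order_trans)
    then have "ennreal (b * m) \<le> ennreal (a * (m + e))"
      using m a by (metis ennreal_mult' less_imp_le order_trans)
    moreover have "0 \<le> a * (m + e)" using a m that by simp
    ultimately show ?thesis by (simp only: ennreal_le_iff)
  qed
  \<comment> \<open>\<open>H\<close> is used with \<open>e / (a + 1)\<close> because
    \<open>a\<close> may be 0, and a e / (a + 1) \<le> e holds in every case.\<close>
  have "b * m \<le> a * m + e" if "0 < e" for e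
  proof -
    have "b * m \<le> a * (m + e / (a + 1))"
      using a that by (intro H divide_pos_pos) auto
    also have "\<dots> = a * m + a / (a + 1) * e"
      by (simp add: distrib_left)
    also have "a / (a + 1) * e \<le> 1 * e"
      using a that by (intro mult_right_mono) auto
    finally show ?thesis by simp
  qed
  then have "b * m \<le> a * m" by (rule field_le_epsilon)
  then have "m = 0" using a m by (auto simp: mult_le_cancel_right)
  then show ?thesis using m E by (auto simp: null_sets_def)
qed

text \<open>It contains every point where the upper derivate of \<open>g\<close> along
  \<open>e\<close> exceeds \<open>b\<close> and the lower one is below \<open>a\<close>. Asking for
  quotients at every scale 1/(n+1), instead of a limsup and a liminf, exhibits it as a countable
  intersection of open sets when \<open>g\<close> is continuous.\<close>

definition slope_gap :: "('a::euclidean_space \<Rightarrow> real) \<Rightarrow> 'a \<Rightarrow> real \<Rightarrow> real \<Rightarrow> 'a set" where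
  "slope_gap g e a b = {x. \<forall>n::nat.
     (\<exists>h. h \<noteq> 0 \<and> \<bar>h\<bar> < inverse (Suc n) \<and> b < (g (x + h *\<^sub>R e) - g x) / h) \<and>
     (\<exists>h. h \<noteq> 0 \<and> \<bar>h\<bar> < inverse (Suc n) \<and> (g (x + h *\<^sub>R e) - g x) / h < a)}"

lemma slope_gap_borel:
  assumes "continuous_on UNIV g"
  shows "slope_gap g e a b \<in> sets borel"
proof -
  let ?q = "\<lambda>h x. (g (x + h *\<^sub>R e) - g x) / h"
  have c: "continuous_on UNIV (?q h)" if "h \<noteq> 0" for h
    using that by (intro continuous_intros continuous_on_compose2[OF assms]) auto
  have op: "open {x. \<exists>h. h \<noteq> 0 \<and> \<bar>h\<bar> < inverse (Suc n) \<and> b < ?q h x}" 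
           "open {x. \<exists>h. h \<noteq> 0 \<and> \<bar>h\<bar> < inverse (Suc n) \<and> ?q h x < a}" for n
  proof -
    have "open (\<Union>h\<in>{h. h \<noteq> 0 \<and> \<bar>h\<bar> < inverse (Suc n)}. {x. b < ?q h x})"
         "open (\<Union>h\<in>{h. h \<noteq> 0 \<and> \<bar>h\<bar> < inverse (Suc n)}. {x. ?q h x < a})"
      using c by (auto intro!: open_UN open_Collect_less continuous_on_const)
    moreover have "(\<Union>h\<in>{h. h \<noteq> 0 \<and> \<bar>h\<bar> < inverse (Suc n)}. {x. b < ?q h x})
        = {x. \<exists>h. h \<noteq> 0 \<and> \<bar>h\<bar> < inverse (Suc n) \<and> b < ?q h x}"
      "(\<Union>h\<in>{h. h \<noteq> 0 \<and> \<bar>h\<bar> < inverse (Suc n)}. {x. ?q h x < a})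
        = {x. \<exists>h. h \<noteq> 0 \<and> \<bar>h\<bar> < inverse (Suc n) \<and> ?q h x < a}" by auto
    ultimately show "open {x. \<exists>h. h \<noteq> 0 \<and> \<bar>h\<bar> < inverse (Suc n) \<and> b < ?q h x}" 
           "open {x. \<exists>h. h \<noteq> 0 \<and> \<bar>h\<bar> < inverse (Suc n) \<and> ?q h x < a}" by simp_all
  qed
  have "slope_gap g e a b = (\<Inter>n::nat.
     {x. \<exists>h. h \<noteq> 0 \<and> \<bar>h\<bar> < inverse (Suc n) \<and> b < ?q h x} \<inter>
     {x. \<exists>h. h \<noteq> 0 \<and> \<bar>h\<bar> < inverse (Suc n) \<and> ?q h x < a})"
    by (auto simp: slope_gap_def)
  also have "\<dots> \<in> sets borel"
    using op by (intro sets.countable_INT' sets.Int borel_open) auto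
  finally show ?thesis .
qed

text \<open>Adding \<open>L * t\<close> makes an \<open>L\<close>-Lipschitz function nondecreasing
  and shifts both slopes by \<open>L\<close>, so the monotone case applies.\<close>

lemma slope_gap_null_real:
  fixes f :: "real \<Rightarrow> real"
  assumes lip: "L-lipschitz_on UNIV f" and ab: "a < b"
  shows "slope_gap f 1 a b \<in> null_sets lborel"
proof -
  define F where "F t = f t + L * t" for t
  have L: "\<bar>f u - f v\<bar> \<le> L * \<bar>u - v\<bar>" for u v
    using lipschitz_onD[OF lip, of u v] by (simp add: dist_real_def)
  have mono: "mono F"
  proof (rule monoI)
    fix u v :: real assume "u \<le> v"
    then show "F u \<le> F v" using L[of u v] by (simp add: F_def algebra_simps abs_if split: if_splits)
  qed
  have contf: "continuous_on UNIV f" using lip lipschitz_on_continuous_on by blast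
  then have cont: "isCont F x" for x
    unfolding F_def by (intro continuous_intros) (simp add: continuous_on_eq_continuous_at)
  let ?E = "slope_gap f 1 a b"
  have E: "?E \<in> sets borel" by (intro slope_gap_borel contf)
  have pt: "(\<exists>u v. u < v \<and> u \<le> t \<and> t \<le> v \<and> v - u < d \<and> F v - F u \<le> (a + L) * (v - u)) \<and>
       (\<exists>u v. u < v \<and> u \<le> t \<and> t \<le> v \<and> v - u < d \<and> F v - F u \<ge> (b + L) * (v - u))"
    if t: "t \<in> ?E" and d: "0 < d" for t d
  proof -
    obtain n where n: "inverse (real (Suc n)) < d" using reals_Archimedean[OF d] by blast
    obtain h1 where h1: "h1 \<noteq> 0" "\<bar>h1\<bar> < inverse (Suc n)" "b < (f (t + h1) - f t) / h1"
      using t by (auto simp: slope_gap_def)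
    obtain h2 where h2: "h2 \<noteq> 0" "\<bar>h2\<bar> < inverse (Suc n)" "(f (t + h2) - f t) / h2 < a"
      using t by (auto simp: slope_gap_def)
    note h1 = h1(1) less_trans[OF h1(2) n] h1(3)
    note h2 = h2(1) less_trans[OF h2(2) n] h2(3)
    have "\<exists>u v. u < v \<and> u \<le> t \<and> t \<le> v \<and> v - u < d \<and> F v - F u \<le> (a + L) * (v - u)"
    proof (cases "0 < h2")
      case True
      then show ?thesis using h2
        by (intro exI[of _ t] exI[of _ "t + h2"]) (auto simp: F_def field_simps)
    next
      case False
      then show ?thesis using h2
        by (intro exI[of _ "t + h2"] exI[of _ t]) (auto simp: F_def field_simps)
    qed
    moreover have "\<exists>u v. u < v \<and> u \<le> t \<and> t \<le> v \<and> v - u < d \<and> F v - F u \<ge> (b + L) * (v - u)"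
    proof (cases "0 < h1")
      case True
      then show ?thesis using h1
        by (intro exI[of _ t] exI[of _ "t + h1"]) (auto simp: F_def field_simps)
    next
      case False
      then show ?thesis using h1
        by (intro exI[of _ "t + h1"] exI[of _ t]) (auto simp: F_def field_simps)
    qed
    ultimately show ?thesis by blast
  qed
  \<comment> \<open>Cutting to bounded intervals supplies the finite measure that the covering
    argument asks for.\<close>
  have "?E \<inter> {-real m..real m} \<in> null_sets lborel" for m
  proof (cases "0 \<le> a + L")
    case True
    show ?thesis
    proof (rule slope_gap_null_mono[OF mono cont True])
      show "a + L < b + L" using ab by simp
      have "emeasure lborel (?E \<inter> {-real m..real m}) \<le> emeasure lborel {-real m..real m}"
        by (intro emeasure_mono) auto
      also have "\<dots> < \<infinity>" by simp
      finally show "emeasure lborel (?E \<inter> {-real m..real m}) < \<infinity>" .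
    qed (use E pt in auto)
  next
    case False
    \<comment> \<open>A nondecreasing function has no chord of negative slope.\<close>
    have "?E = {}"
    proof (rule ccontr)
      assume "?E \<noteq> {}"
      then obtain t where "t \<in> ?E" by blast
      from pt[OF this, of 1] obtain u v where uv: "u < v" "F v - F u \<le> (a + L) * (v - u)" by auto
      have "(a + L) * (v - u) < 0" using False uv by (simp add: mult_less_0_iff)
      moreover have "F u \<le> F v" using mono uv by (simp add: monoD)
      ultimately show False using uv by linarith
    qed
    then show ?thesis by simp
  qed
  then have "(\<Union>m. ?E \<inter> {-real m..real m}) \<in> null_sets lborel" by blast
  moreover have "(\<Union>m. ?E \<inter> {-real m..real m}) = ?E"
  proof -
    have "\<exists>m. t \<in> {-real m..real m}" for t :: real
    proof -
      obtain m where "\<bar>t\<bar> \<le> real m" using real_arch_simple by blast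
      then show ?thesis by (intro exI[of _ m]) auto
    qed
    then show ?thesis by blast
  qed
  ultimately show ?thesis by simp
qed

text \<open>Averaging over translates along \<open>e\<close> reduces the claim to almost every line by Tonelli.\<close>

lemma slope_gap_null:
  fixes g :: "'a::euclidean_space \<Rightarrow> real"
  assumes lip: "L-lipschitz_on UNIV g" and ab: "a < b"
  shows "slope_gap g e a b \<in> null_sets lborel"
proof -
  let ?E = "slope_gap g e a b"
  have contg: "continuous_on UNIV g" using lip lipschitz_on_continuous_on by blast
  then have E[measurable]: "?E \<in> sets borel" by (rule slope_gap_borel)
  have line: "{t. x + t *\<^sub>R e \<in> ?E} \<in> null_sets lborel" for x
  proof -
    have "(L * norm e)-lipschitz_on UNIV (\<lambda>t. g (x + t *\<^sub>R e))"
    proof (rule lipschitz_onI)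
      fix s t :: real
      have "dist (g (x + s *\<^sub>R e)) (g (x + t *\<^sub>R e)) \<le> L * dist (x + s *\<^sub>R e) (x + t *\<^sub>R e)"
        using lip by (rule lipschitz_onD) auto
      also have "dist (x + s *\<^sub>R e) (x + t *\<^sub>R e) = norm e * dist s t"
        by (simp add: dist_norm scaleR_diff_left[symmetric])
      finally show "dist (g (x + s *\<^sub>R e)) (g (x + t *\<^sub>R e)) \<le> L * norm e * dist s t" by simp
    next
      show "0 \<le> L * norm e" using lipschitz_on_nonneg[OF lip] by simp
    qed
    from slope_gap_null_real[OF this ab]
    show ?thesis by (simp add: slope_gap_def algebra_simps)
  qed
  have tr: "(\<integral>\<^sup>+x. indicator ?E (x + t *\<^sub>R e) \<partial>lborel) = emeasure lborel ?E" for t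
  proof -
    have "emeasure lborel ?E = emeasure (distr lborel borel ((+) (t *\<^sub>R e))) ?E"
      by (metis lborel_distr_plus)
    also have "\<dots> = (\<integral>\<^sup>+x. indicator ?E (t *\<^sub>R e + x) \<partial>lborel)"
      by (subst nn_integral_indicator[symmetric], simp, subst nn_integral_distr) auto
    finally show ?thesis by (simp add: add.commute)
  qed
  have "emeasure lborel ?E = (\<integral>\<^sup>+t. emeasure lborel ?E * indicator {0..1} t \<partial>(lborel::real measure))"
    by (simp add: nn_integral_cmult)
  also have "\<dots> = (\<integral>\<^sup>+t. (\<integral>\<^sup>+x. indicator ?E (x + t *\<^sub>R e) * indicator {0..1} t \<partial>lborel) \<partial>(lborel::real measure))"
    by (subst nn_integral_multc) (auto simp: tr)
  also have "\<dots> = (\<integral>\<^sup>+x. (\<integral>\<^sup>+t. indicator ?E (x + t *\<^sub>R e) * indicator {0..1} t \<partial>(lborel::real measure)) \<partial>lborel)"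
    by (rule lborel_pair.Fubini') measurable
  also have "\<dots> = (\<integral>\<^sup>+x. 0 \<partial>(lborel :: 'a measure))"
  proof (rule nn_integral_cong)
    fix x :: 'a
    have "AE t in lborel. t \<notin> {t. x + t *\<^sub>R e \<in> ?E}" using line by (rule AE_not_in)
    then have "(\<integral>\<^sup>+t. indicator ?E (x + t *\<^sub>R e) * indicator {0..1} t \<partial>(lborel::real measure)) = (\<integral>\<^sup>+t. 0 \<partial>(lborel::real measure))"
      by (intro nn_integral_cong_AE) (auto simp: indicator_def)
    then show "(\<integral>\<^sup>+t. indicator ?E (x + t *\<^sub>R e) * indicator {0..1} t \<partial>(lborel::real measure)) = 0" by simp
  qed
  finally show ?thesis by (auto simp: null_sets_def)
qed

text \<open>Where the liminf and the limsup of the quotients differ, two rationals separate them and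
  the point lies in one of countably many null sets \<open>slope_gap\<close>. The Lipschitz bound
  then makes the common limit finite.\<close>

lemma AE_directional_derivative_lipschitz:
  fixes g :: "'a::euclidean_space \<Rightarrow> real"
  assumes lip: "L-lipschitz_on UNIV g"
  shows "AE x in lborel. \<exists>D. ((\<lambda>t. g (x + t *\<^sub>R e)) has_real_derivative D) (at 0)"
proof -
  have "AE x in lborel. \<forall>a\<in>\<rat>. \<forall>b\<in>\<rat>. a < b \<longrightarrow> x \<notin> slope_gap g e a b"
    using slope_gap_null[OF lip]
    by (intro AE_ball_countable[THEN iffD2] ballI) (auto simp: countable_rat intro: AE_not_in)
  then show ?thesis
  proof eventually_elim
    case (elim x)
    let ?q = "\<lambda>h. (g (x + h *\<^sub>R e) - g x) / h"
    have bd: "\<bar>?q h\<bar> \<le> L * norm e" for h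
    proof -
      have "\<bar>g (x + h *\<^sub>R e) - g x\<bar> \<le> L * (\<bar>h\<bar> * norm e)"
        using lipschitz_onD[OF lip, of "x + h *\<^sub>R e" x] by (simp add: dist_norm)
      then show ?thesis 
        using lipschitz_on_nonneg[OF lip] by (cases "h = 0") (auto simp: field_simps)
    qed
    let ?F = "at (0::real)"
    have freq: "\<forall>n. \<exists>h. h \<noteq> 0 \<and> \<bar>h\<bar> < inverse (real (Suc n)) \<and> P h" if "\<exists>\<^sub>F h in ?F. P h" for P
    proof
      fix n
      have "\<forall>\<^sub>F h in ?F. h \<noteq> 0 \<and> \<bar>h\<bar> < inverse (real (Suc n))"
        by (auto simp: eventually_at intro!: exI[of _ "inverse (real (Suc n))"])
      then have "\<exists>\<^sub>F h in ?F. P h \<and> (h \<noteq> 0 \<and> \<bar>h\<bar> < inverse (real (Suc n)))"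
        by (intro frequently_rev_mp[OF that]) (auto elim: eventually_mono)
      then show "\<exists>h. h \<noteq> 0 \<and> \<bar>h\<bar> < inverse (real (Suc n)) \<and> P h"
        by (auto dest: frequently_ex)
    qed
    let ?l = "Liminf ?F (\<lambda>h. ereal (?q h))" and ?u = "Limsup ?F (\<lambda>h. ereal (?q h))"
    have lu: "?l \<le> ?u" by (intro Liminf_le_Limsup) simp
    have "?l = ?u"
    proof (rule ccontr)
      assume "?l \<noteq> ?u"
      with lu have "?l < ?u" by simp
      then obtain a' where a': "?l < ereal a'" "ereal a' < ?u" using ereal_dense2 by blast
      obtain b' where b': "ereal a' < ereal b'" "ereal b' < ?u" using a'(2) ereal_dense2 by blast
      obtain a where a: "a \<in> \<rat>" "a' < a" "a < b'" using Rats_dense_in_real[of a' b'] b' by auto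
      obtain b where b: "b \<in> \<rat>" "a < b" "b < b'" using Rats_dense_in_real[of a b'] a by auto
      have "\<exists>\<^sub>F h in ?F. b < ?q h"
      proof (rule ccontr)
        assume "\<not> ?thesis"
        then have "\<forall>\<^sub>F h in ?F. ereal (?q h) \<le> ereal b"
          by (simp add: frequently_def not_less)
        then have "?u \<le> ereal b" by (rule Limsup_bounded)
        then show False using b b' by (meson ereal_less_le less_ereal.simps(1) less_trans not_less order_less_le_trans)
      qed
      moreover have "\<exists>\<^sub>F h in ?F. ?q h < a"
      proof (rule ccontr)
        assume "\<not> ?thesis"
        then have "\<forall>\<^sub>F h in ?F. ereal a \<le> ereal (?q h)"
          by (simp add: frequently_def not_less)
        then have "ereal a \<le> ?l" by (rule Liminf_bounded)
        then show False using a a' by (meson less_ereal.simps(1) less_trans not_less order_less_le_trans)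
      qed
      ultimately have "x \<in> slope_gap g e a b"
        using freq unfolding slope_gap_def by simp
      then show False using elim a b by blast
    qed
    then have lim: "((\<lambda>h. ereal (?q h)) \<longlongrightarrow> ?u) ?F"
      by (subst tendsto_iff_Liminf_eq_Limsup) auto
    have "- (L * norm e) \<le> ?q h" "?q h \<le> L * norm e" for h
      using bd[of h] by linarith+
    then have "ereal (- (L * norm e)) \<le> ?u" "?u \<le> ereal (L * norm e)"
      by (auto intro!: tendsto_lowerbound[OF lim] tendsto_upperbound[OF lim] always_eventually)
    then obtain D where "?u = ereal D" by (cases ?u) auto
    with lim have "(?q \<longlongrightarrow> D) ?F" by simp
    then show ?case by (auto simp: DERIV_def)
  qed
qed

section \<open>The Newtonian kernel and its potential\<close>

lemma nn_integral_lborel_affine: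
  fixes f :: "'a::euclidean_space \<Rightarrow> ennreal"
  assumes [measurable]: "f \<in> borel_measurable borel" and c: "c \<noteq> 0"
  shows "(\<integral>\<^sup>+x. f x \<partial>lborel) = ennreal (\<bar>c\<bar> ^ DIM('a)) * (\<integral>\<^sup>+x. f (t + c *\<^sub>R x) \<partial>lborel)"
  by (subst lborel_affine[OF c, of t], subst nn_integral_density, simp, simp, subst nn_integral_distr)
     (auto simp: nn_integral_cmult)

lemma nn_integral_lborel_shift:
  fixes f :: "'a::euclidean_space \<Rightarrow> ennreal"
  assumes "f \<in> borel_measurable borel"
  shows "(\<integral>\<^sup>+x. f (x - y) \<partial>lborel) = (\<integral>\<^sup>+x. f x \<partial>lborel)"
    and "(\<integral>\<^sup>+x. f (y - x) \<partial>lborel) = (\<integral>\<^sup>+x. f x \<partial>lborel)"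
  using nn_integral_lborel_affine[OF assms, of 1 "-y"] nn_integral_lborel_affine[OF assms, of "-1" y]
  by simp_all

text \<open>Dyadic decomposition of the half line at 1. Each dyadic shell is enlarged to a ball on
  which the weight has a constant bound, so only ball volumes are needed afterwards.\<close>

lemma power_pair_pointwise:
  fixes s b d :: real
  assumes s: "0 < s" and bd: "0 < d" and \<beta>: "b \<le> \<beta>" "0 \<le> \<beta>"
  shows "\<exists>k::nat. (s \<le> 2 powr - real k \<and> min (s powr - b) (s powr - d) \<le> 2 powr ((real k + 1) * \<beta>)) \<or>
     (s \<le> 2 powr (real k + 1) \<and> min (s powr - b) (s powr - d) \<le> 2 powr (- (real k * d)))"
proof -
  define t where "t = log 2 s"
  have st: "s = 2 powr t" using s by (simp add: t_def)
  have sp: "s powr - a = 2 powr (- (t * a))" for a by (simp add: st powr_powr)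
  show ?thesis
  proof (cases "t < 0")
    case True
    define k where "k = nat \<lfloor>- t\<rfloor>"
    have k: "real k \<le> - t" "- t \<le> real k + 1" using True by (auto simp: k_def)
    have "s powr - b \<le> 2 powr ((real k + 1) * \<beta>)"
    proof -
      have "- (t * b) \<le> - t * \<beta>" using True \<beta> by (simp add: mult_left_mono_neg)
      also have "\<dots> \<le> (real k + 1) * \<beta>" using k \<beta> by (intro mult_right_mono) auto
      finally show ?thesis unfolding sp by (intro powr_mono) auto
    qed
    moreover have "s \<le> 2 powr - real k" unfolding st using k by (intro powr_mono) auto
    ultimately show ?thesis by (meson min.coboundedI1)
  next
    case False
    define k where "k = nat \<lfloor>t\<rfloor>"
    have k: "real k \<le> t" "t \<le> real k + 1" using False by (auto simp: k_def)
    have "s powr - d \<le> 2 powr (- (real k * d))"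
      unfolding sp using k bd by (intro powr_mono) (auto intro: mult_right_mono)
    moreover have "s \<le> 2 powr (real k + 1)" unfolding st using k by (intro powr_mono) auto
    ultimately show ?thesis by (meson min.coboundedI2)
  qed
qed

text \<open>The exponent \<open>b\<close> rules near the origin and \<open>d\<close> at infinity;
  the dyadic bounds sum to geometric series of ratios 2^(\<beta>-N) and 2^(N-d). Weights of this
  shape dominate every source term estimated below.\<close>

lemma nn_integral_power_pair:
  fixes b d :: real
  assumes b: "b < real DIM('a::euclidean_space)" and d: "real DIM('a) < d"
  shows "(\<integral>\<^sup>+z. ennreal (min (norm z powr - b) (norm z powr - d)) \<partial>(lborel :: 'a measure)) < \<infinity>"
proof -
  define N where "N = real DIM('a)"
  \<comment> \<open>\<open>b\<close> may be negative, since \<open>a0\<close> has no lower bound;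
    replacing it by its positive part keeps the exponent below N and makes the dyadic bound
    monotone.\<close>
  define \<beta> where "\<beta> = max b 0"
  have N: "0 < N" "\<beta> < N" "N < d" "0 \<le> \<beta>" "b \<le> \<beta>" using assms by (auto simp: N_def \<beta>_def)
  define v where "v = unit_ball_vol N"
  have v: "0 \<le> v" by (simp add: v_def N_def)
  define f1 where "f1 k z = ennreal (2 powr ((real k + 1) * \<beta>)) * indicator (cball 0 (2 powr - real k)) z" for k and z :: 'a
  define f2 where "f2 k z = ennreal (2 powr (- (real k * d))) * indicator (cball 0 (2 powr (real k + 1))) z" for k and z :: 'a
  have f1m [measurable]: "f1 k \<in> borel_measurable borel" for k
    unfolding f1_def[abs_def] by (intro borel_measurable_times_ennreal borel_measurable_indicator) auto
  have f2m [measurable]: "f2 k \<in> borel_measurable borel" for k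
    unfolding f2_def[abs_def] by (intro borel_measurable_times_ennreal borel_measurable_indicator) auto
  have ball: "emeasure lborel (cball (0::'a) (2 powr s)) = ennreal (v * 2 powr (s * N))" for s
    by (simp add: emeasure_cball v_def N_def powr_powr[symmetric] powr_realpow)
  have pw: "ennreal (min (norm z powr - b) (norm z powr - d)) \<le> (\<Sum>k. f1 k z) + (\<Sum>k. f2 k z)" for z :: 'a
  proof (cases "z = 0")
    case True
    then show ?thesis by simp
  next
    case False
    have le1: "f1 k z \<le> (\<Sum>k. f1 k z)" and le2: "f2 k z \<le> (\<Sum>k. f2 k z)" for k
      using sum_le_suminf[of "\<lambda>k. f1 k z" "{k}"] sum_le_suminf[of "\<lambda>k. f2 k z" "{k}"] by auto
    let ?m = "min (norm z powr - b) (norm z powr - d)"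
    obtain k where "(norm z \<le> 2 powr - real k \<and> ?m \<le> 2 powr ((real k + 1) * \<beta>)) \<or>
     (norm z \<le> 2 powr (real k + 1) \<and> ?m \<le> 2 powr (- (real k * d)))"
      using power_pair_pointwise[of "norm z" d b \<beta>] False N by auto
    then have "ennreal ?m \<le> f1 k z \<or> ennreal ?m \<le> f2 k z"
      by (auto simp: f1_def f2_def ennreal_leI simp del: min_le_iff_disj)
    then show ?thesis
      using le1[of k] le2[of k] by (meson add_increasing add_increasing2 order_trans zero_le)
  qed
  have i1: "(\<integral>\<^sup>+z. f1 k z \<partial>lborel) = ennreal (v * 2 powr \<beta> * (2 powr (\<beta> - N)) ^ k)" for k
    by (simp add: f1_def nn_integral_cmult_indicator ball ennreal_mult'[symmetric] powr_realpow[symmetric] powr_powr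
        powr_add[symmetric] algebra_simps)
  have i2: "(\<integral>\<^sup>+z. f2 k z \<partial>lborel) = ennreal (v * 2 powr N * (2 powr (N - d)) ^ k)" for k
    by (simp add: f2_def nn_integral_cmult_indicator ball ennreal_mult'[symmetric] powr_realpow[symmetric] powr_powr
        powr_add[symmetric] algebra_simps)
  have geo: "(\<Sum>k. ennreal (C * q ^ k)) < \<infinity>" if "0 \<le> C" "0 \<le> q" "q < 1" for C q
  proof -
    have "summable (\<lambda>k. C * q ^ k)" using that by (intro summable_mult summable_geometric) auto
    then have "(\<Sum>k. ennreal (C * q ^ k)) = ennreal (\<Sum>k. C * q ^ k)"
      using that by (intro suminf_ennreal2) auto
    then show ?thesis by simp
  qed
  have fin1: "(\<Sum>k. \<integral>\<^sup>+z. f1 k z \<partial>lborel) < \<infinity>"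
    unfolding i1 using N v powr_less_mono[of "\<beta> - N" 0 2] by (intro geo) simp_all
  have fin2: "(\<Sum>k. \<integral>\<^sup>+z. f2 k z \<partial>lborel) < \<infinity>"
    unfolding i2 using N v powr_less_mono[of "N - d" 0 2] by (intro geo) simp_all
  have "(\<integral>\<^sup>+z. ennreal (min (norm z powr - b) (norm z powr - d)) \<partial>(lborel :: 'a measure)) \<le> 
     (\<integral>\<^sup>+z. (\<Sum>k. f1 k z) + (\<Sum>k. f2 k z) \<partial>(lborel :: 'a measure))"
    by (intro nn_integral_mono pw)
  also have "\<dots> = (\<Sum>k. \<integral>\<^sup>+z. f1 k z \<partial>lborel) + (\<Sum>k. \<integral>\<^sup>+z. f2 k z \<partial>lborel)"
    by (subst nn_integral_add) (auto simp: nn_integral_suminf)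
  also have "\<dots> < \<infinity>" using fin1 fin2 by (simp add: less_top[symmetric])
  finally show ?thesis .
qed

section \<open>The kernel and its normalisation\<close>

text \<open>This is minus the Laplacian of (|z|^2+e^2)^((2-N)/2). It concentrates at the origin as
  \<open>e\<close> tends to 0, with total mass independent of \<open>e\<close>.\<close>

definition bubble :: "real \<Rightarrow> real^'n \<Rightarrow> real" where
  "bubble e z = real CARD('n) * (real CARD('n) - 2) * e\<^sup>2 *
     (norm z ^ 2 + e\<^sup>2) powr (- (real CARD('n) + 2) / 2)"

text \<open>Dividing by the mass of \<open>bubble 1\<close> gives the fundamental solution; the mass
  is (N-2) times the area of the unit sphere, which never has to be computed. By the convention for
  \<open>powr\<close>, \<open>newton 0 = 0\<close>, so pointwise lower bounds exclude the
  origin.\<close>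

definition newton :: "real^'n \<Rightarrow> real" where
  "newton x = norm x powr (2 - real CARD('n)) / (LINT z|(lborel :: (real^'n) measure). bubble 1 z)"

text \<open>Values in [0,\<infinity>] make the potential meaningful for every Borel source, before
  any finiteness is known.\<close>

definition newton_pot :: "(real^'n \<Rightarrow> ennreal) \<Rightarrow> real^'n \<Rightarrow> ennreal" where
  "newton_pot f x = (\<integral>\<^sup>+y. ennreal (newton (x - y)) * f y \<partial>lborel)"

lemma bubble_borel [measurable]: "bubble e \<in> borel_measurable borel"
  unfolding bubble_def by measurable

lemma newton_borel [measurable]: "newton \<in> borel_measurable borel"
  unfolding newton_def by measurable

lemma newton_pot_borel [measurable]:
  fixes f :: "real^'n \<Rightarrow> ennreal"
  assumes [measurable]: "f \<in> borel_measurable borel"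
  shows "newton_pot f \<in> borel_measurable borel"
  unfolding newton_pot_def by measurable

lemma newton_minus: "newton (- x) = newton x"
  by (simp add: newton_def)

lemma bubble_nonneg:
  assumes "2 < CARD('n::finite)"
  shows "0 \<le> bubble e (z :: real^'n)"
  using assms by (simp add: bubble_def)

lemma bubble_integrable:
  assumes N: "2 < CARD('n::finite)"
  shows "integrable lborel (bubble 1 :: real^'n \<Rightarrow> real)"
proof (rule integrableI_bounded)
  define C where "C = real CARD('n) * (real CARD('n) - 2)"
  define N where "N = real CARD('n)"
  have C: "0 \<le> C" using N by (simp add: C_def)
  have bd: "ennreal (norm (bubble 1 z)) \<le> ennreal C * ennreal (min (norm z powr - 0) (norm z powr - (N + 2)))"
    if "z \<noteq> 0" for z :: "real^'n"
  proof -
    let ?s = "norm z"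
    have s: "0 < ?s" using that by simp
    have "(?s\<^sup>2 + 1) powr (- (N + 2) / 2) \<le> 1"
      using powr_mono[of "- (N + 2) / 2" 0 "?s\<^sup>2 + 1"] s by (simp add: N_def split: if_splits)
    moreover have "(?s\<^sup>2 + 1) powr (- (N + 2) / 2) \<le> (?s\<^sup>2) powr (- (N + 2) / 2)"
      using s by (intro powr_mono2') (auto simp: N_def)
    moreover have "(?s\<^sup>2) powr (- (N + 2) / 2) = ?s powr - (N + 2)"
    proof -
      have "(?s\<^sup>2) powr (- (N + 2) / 2) = (?s powr 2) powr (- (N + 2) / 2)"
        using s by (simp add: powr_numeral)
      also have "2 * (- (N + 2) / 2) = - (N + 2)" by (simp add: field_simps)
      then have "(?s powr 2) powr (- (N + 2) / 2) = ?s powr - (N + 2)" unfolding powr_powr by (rule arg_cong)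
      finally show ?thesis .
    qed
    ultimately have "(?s\<^sup>2 + 1) powr (- (N + 2) / 2) \<le> min (?s powr - 0) (?s powr - (N + 2))"
      using s by simp
    then have "bubble 1 z \<le> C * min (?s powr - 0) (?s powr - (N + 2))"
      using C by (simp add: bubble_def C_def N_def mult_left_mono)
    then show ?thesis using C bubble_nonneg[OF N, of 1 z]
      by (subst ennreal_mult'[symmetric]) (auto intro!: ennreal_leI)
  qed
  have "(\<integral>\<^sup>+z. ennreal (norm (bubble 1 z)) \<partial>(lborel :: (real^'n) measure)) \<le>
     (\<integral>\<^sup>+z. ennreal C * ennreal (min (norm z powr - 0) (norm z powr - (N + 2))) \<partial>(lborel :: (real^'n) measure))"
  proof (rule nn_integral_mono_AE)
    show "AE z in (lborel :: (real^'n) measure). ennreal (norm (bubble 1 z)) \<le>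
        ennreal C * ennreal (min (norm z powr - 0) (norm z powr - (N + 2)))"
      using AE_lborel_singleton[of "0 :: real^'n"] by eventually_elim (rule bd)
  qed
  also have "\<dots> = ennreal C * (\<integral>\<^sup>+z. ennreal (min (norm z powr - 0) (norm z powr - (N + 2))) \<partial>(lborel :: (real^'n) measure))"
    by (intro nn_integral_cmult) measurable
  also have "\<dots> < \<infinity>"
    using nn_integral_power_pair[where 'a = "real^'n", of 0 "N + 2"]
    by (auto simp: N_def ennreal_mult_less_top)
  finally show "(\<integral>\<^sup>+z. ennreal (norm (bubble 1 z)) \<partial>(lborel :: (real^'n) measure)) < \<infinity>" .
qed simp

lemma bubble_mass_pos:
  assumes N: "2 < CARD('n::finite)"
  shows "0 < (LINT z|(lborel :: (real^'n) measure). bubble 1 z)"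
proof -
  have pos: "0 < bubble 1 z" for z :: "real^'n"
  proof -
    have "0 < norm z ^ 2 + 1" by (simp add: add_nonneg_pos)
    then show ?thesis using N unfolding bubble_def by (intro mult_pos_pos) auto
  qed
  have "(LINT z|(lborel :: (real^'n) measure). bubble 1 z) \<noteq> 0"
  proof
    assume "(LINT z|(lborel :: (real^'n) measure). bubble 1 z) = 0"
    then have "AE z in (lborel :: (real^'n) measure). bubble 1 z = 0"
      by (subst (asm) integral_nonneg_eq_0_iff_AE[OF bubble_integrable[OF N]]) (auto intro: bubble_nonneg N)
    moreover have "bubble 1 z \<noteq> 0" for z :: "real^'n" using pos[of z] by simp
    ultimately have "AE z in (lborel :: (real^'n) measure). False" by simp
    then show False by (simp add: eventually_False ae_filter_eq_bot_iff)
  qed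
  moreover have "0 \<le> (LINT z|(lborel :: (real^'n) measure). bubble 1 z)"
    by (intro integral_nonneg_AE) (auto intro: bubble_nonneg N)
  ultimately show ?thesis by simp
qed

lemma newton_pos:
  assumes "2 < CARD('n::finite)" and "x \<noteq> 0"
  shows "0 < newton (x :: real^'n)"
  using assms bubble_mass_pos[OF assms(1)] by (simp add: newton_def)

lemma newton_nonneg:
  assumes "2 < CARD('n::finite)"
  shows "0 \<le> newton (x :: real^'n)"
  using bubble_mass_pos[OF assms] by (simp add: newton_def)

lemma newton_antimono:
  assumes N: "2 < CARD('n::finite)" and "r \<le> norm x" "0 < r"
  shows "newton (x :: real^'n) \<le> r powr (2 - real CARD('n)) / (LINT z|(lborel :: (real^'n) measure). bubble 1 z)"
  using assms bubble_mass_pos[OF N] unfolding newton_def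
  by (intro divide_right_mono powr_mono2') auto

lemma indicator_cball_borel [measurable]:
  "(indicator (cball a R) :: 'a::metric_space \<Rightarrow> ennreal) \<in> borel_measurable borel"
  by (intro borel_measurable_indicator) simp

section \<open>Potential estimates\<close>

text \<open>Uniformity in the pole \<open>y\<close> comes from a splitting: points within R of
  \<open>y\<close> lie in a ball about the pole, where scaling gives c R^2, and elsewhere the kernel
  is at most a multiple of R^(2-N) against a volume of order R^N.\<close>

lemma newton_ball_bound:
  assumes N: "2 < CARD('n::finite)"
  shows "\<exists>C>0. \<forall>R>0. \<forall>a y :: real^'n.
    (\<integral>\<^sup>+x. ennreal (newton (x - y)) * indicator (cball a R) x \<partial>lborel) \<le> ennreal (C * R\<^sup>2)"
proof -
  define n where "n = real CARD('n)"
  define \<kappa> where "\<kappa> = (LINT z|(lborel :: (real^'n) measure). bubble 1 z)"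
  have \<kappa>: "0 < \<kappa>" using bubble_mass_pos[OF N] by (simp add: \<kappa>_def)
  have n: "2 < n" using N by (simp add: n_def)
  let ?I = "\<integral>\<^sup>+z. ennreal (newton z) * indicator (cball 0 1) z \<partial>(lborel :: (real^'n) measure)"
  \<comment> \<open>Any second exponent above \<open>n\<close> would do: on the unit ball the
    minimum is attained by the first power.\<close>
  have "?I \<le> (\<integral>\<^sup>+z. ennreal (1 / \<kappa>) * ennreal (min (norm z powr - (n - 2)) (norm z powr - (n + 1))) \<partial>(lborel :: (real^'n) measure))"
  proof (intro nn_integral_mono)
    fix z :: "real^'n"
    have "newton z \<le> 1 / \<kappa> * min (norm z powr - (n - 2)) (norm z powr - (n + 1))" if "norm z \<le> 1"
    proof -
      have "norm z powr - (n - 2) \<le> norm z powr - (n + 1)"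
        using that by (cases "z = 0") (auto intro!: powr_mono')
      then show ?thesis using \<kappa> by (simp add: newton_def n_def \<kappa>_def)
    qed
    then show "ennreal (newton z) * indicator (cball 0 1) z \<le>
       ennreal (1 / \<kappa>) * ennreal (min (norm z powr - (n - 2)) (norm z powr - (n + 1)))"
      using \<kappa> by (auto simp: indicator_def ennreal_mult'[symmetric] intro!: ennreal_leI)
  qed
  also have "\<dots> = ennreal (1 / \<kappa>) * (\<integral>\<^sup>+z. ennreal (min (norm z powr - (n - 2)) (norm z powr - (n + 1))) \<partial>(lborel :: (real^'n) measure))"
    by (intro nn_integral_cmult) measurable
  also have "\<dots> < \<infinity>"
    using nn_integral_power_pair[where 'a = "real^'n", of "n - 2" "n + 1"]
    by (auto simp: n_def ennreal_mult_less_top)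
  finally have "?I < \<infinity>" .
  then obtain c where c: "?I = ennreal c" "0 \<le> c" by (cases ?I) auto
  define C where "C = c + unit_ball_vol n / \<kappa> + 1"
  have v: "0 \<le> unit_ball_vol n" using n by simp
  \<comment> \<open>Homogeneity of degree 2 - n against the volume factor R^n yields exactly c
    R^2.\<close>
  have small: "(\<integral>\<^sup>+z. ennreal (newton z) * indicator (cball 0 R) z \<partial>(lborel :: (real^'n) measure)) = ennreal (c * R\<^sup>2)"
    if R: "0 < R" for R
  proof -
    have ptw: "ennreal (newton (0 + R *\<^sub>R x)) * indicator (cball 0 R) (0 + R *\<^sub>R x) =
        ennreal (R powr (2 - n)) * (ennreal (newton x) * indicator (cball 0 1) x)" for x :: "real^'n"
      using R newton_nonneg[OF N, of x]
      by (auto simp: indicator_def newton_def n_def powr_mult ennreal_mult'[symmetric])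
    have "(\<integral>\<^sup>+z. ennreal (newton z) * indicator (cball 0 R) z \<partial>(lborel :: (real^'n) measure)) =
      ennreal (\<bar>R\<bar> ^ CARD('n)) * (\<integral>\<^sup>+x. ennreal (R powr (2 - n)) * (ennreal (newton x) * indicator (cball 0 1) x) \<partial>(lborel :: (real^'n) measure))"
      using nn_integral_lborel_affine[of "\<lambda>z :: real^'n. ennreal (newton z) * indicator (cball 0 R) z" R 0,
        OF borel_measurable_times_ennreal[OF _ indicator_cball_borel]] R unfolding ptw by simp
    also have "\<dots> = ennreal (R powr n) * (ennreal (R powr (2 - n)) * ennreal c)"
      using R by (subst nn_integral_cmult) (auto simp: c n_def powr_realpow)
    also have "\<dots> = ennreal (c * R\<^sup>2)"
      using R c by (simp add: ennreal_mult'[symmetric] powr_add[symmetric] mult.assoc[symmetric] powr_numeral)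
    finally show ?thesis .
  qed
  have "(\<integral>\<^sup>+x. ennreal (newton (x - y)) * indicator (cball a R) x \<partial>lborel) \<le> ennreal (C * R\<^sup>2)"
    if R: "0 < R" for R and a y :: "real^'n"
  proof -
    have "ennreal (newton (x - y)) * indicator (cball a R) x \<le>
       ennreal (newton (x - y)) * indicator (cball 0 R) (x - y) + ennreal (R powr (2 - n) / \<kappa>) * indicator (cball a R) x" for x
    proof (cases "norm (x - y) \<le> R")
      case True
      then show ?thesis by (auto simp: indicator_def)
    next
      case False
      then have "newton (x - y) \<le> R powr (2 - n) / \<kappa>"
        using newton_antimono[OF N, of R "x - y"] R by (simp add: n_def \<kappa>_def)
      then show ?thesis by (auto simp: indicator_def intro!: ennreal_leI add_increasing)
    qed
    then have "(\<integral>\<^sup>+x. ennreal (newton (x - y)) * indicator (cball a R) x \<partial>lborel) \<le>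
      (\<integral>\<^sup>+x. ennreal (newton (x - y)) * indicator (cball 0 R) (x - y) + ennreal (R powr (2 - n) / \<kappa>) * indicator (cball a R) x \<partial>lborel)"
      by (intro nn_integral_mono)
    also have "\<dots> = (\<integral>\<^sup>+x. ennreal (newton (x - y)) * indicator (cball 0 R) (x - y) \<partial>lborel) +
       ennreal (R powr (2 - n) / \<kappa>) * emeasure lborel (cball a R)"
      by (subst nn_integral_add) (auto simp: nn_integral_cmult)
    also have "(\<integral>\<^sup>+x. ennreal (newton (x - y)) * indicator (cball 0 R) (x - y) \<partial>lborel) = ennreal (c * R\<^sup>2)"
      using nn_integral_lborel_shift(1)[of "\<lambda>z. ennreal (newton z) * indicator (cball 0 R) z" y] small[OF R] by simp
    also have "ennreal (R powr (2 - n) / \<kappa>) * emeasure lborel (cball a R) = ennreal (unit_ball_vol n / \<kappa> * R\<^sup>2)"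
    proof -
      have "R powr (2 - n) * R ^ CARD('n) = R\<^sup>2"
      proof -
        have "R ^ CARD('n) = R powr n" using R by (simp add: n_def powr_realpow)
        then have "R powr (2 - n) * R ^ CARD('n) = R powr 2" by (simp flip: powr_add)
        then show ?thesis using R by simp
      qed
      have "R powr (2 - n) / \<kappa> * (unit_ball_vol n * R ^ CARD('n)) = unit_ball_vol n / \<kappa> * (R powr (2 - n) * R ^ CARD('n))"
        by simp
      also note \<open>R powr (2 - n) * R ^ CARD('n) = R\<^sup>2\<close>
      finally have "R powr (2 - n) / \<kappa> * (unit_ball_vol n * R ^ CARD('n)) = unit_ball_vol n / \<kappa> * R\<^sup>2"
        .
      then show ?thesis using R \<kappa> v by (simp add: emeasure_cball ennreal_mult'[symmetric] n_def)
    qed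
    also have "ennreal (c * R\<^sup>2) + ennreal (unit_ball_vol n / \<kappa> * R\<^sup>2) \<le> ennreal (C * R\<^sup>2)"
      using c v \<kappa> R by (subst ennreal_plus[symmetric]) (auto simp: C_def algebra_simps intro!: ennreal_leI)
    finally show ?thesis .
  qed
  moreover have "0 < C" using c v \<kappa> by (auto simp: C_def intro!: add_nonneg_pos add_nonneg_nonneg)
  ultimately show ?thesis by blast
qed

text \<open>Split at |x - y| = |x|/2. In the far zone the kernel is at most a multiple of its value
  at \<open>x\<close>, and the weight has finite mass. In the near zone |y| \<ge> |x|/2, so the
  weight is of order |x|^(-N), and the ball bound contributes |x|^2. Both parts have order
  |x|^(2-N).\<close>

lemma newton_pot_power_pair:
  assumes N: "2 < CARD('n::finite)" and b: "b < real CARD('n)" and d: "real CARD('n) < d"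
  shows "\<exists>B>0. \<forall>x :: real^'n. x \<noteq> 0 \<longrightarrow>
    newton_pot (\<lambda>y. ennreal (min (norm y powr - b) (norm y powr - d))) x \<le> ennreal (B * newton x)"
proof -
  define n where "n = real CARD('n)"
  define \<kappa> where "\<kappa> = (LINT z|(lborel :: (real^'n) measure). bubble 1 z)"
  have \<kappa>: "0 < \<kappa>" using bubble_mass_pos[OF N] by (simp add: \<kappa>_def)
  have n: "2 < n" "b < n" "n < d" using assms by (simp_all add: n_def)
  let ?f = "\<lambda>y :: real^'n. min (norm y powr - b) (norm y powr - d)"
  have "(\<integral>\<^sup>+y. ennreal (?f y) \<partial>lborel) < \<infinity>"
    using nn_integral_power_pair[where 'a = "real^'n", of b d] assms by simp
  then obtain m where m: "(\<integral>\<^sup>+y. ennreal (?f y) \<partial>lborel) = ennreal m" "0 \<le> m"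
    by (cases "\<integral>\<^sup>+y. ennreal (?f y) \<partial>lborel") auto
  obtain C where C: "0 < C" "\<And>R a y. 0 < R \<Longrightarrow> 
    (\<integral>\<^sup>+x. ennreal (newton (x - y)) * indicator (cball a R) x \<partial>(lborel :: (real^'n) measure)) \<le> ennreal (C * R\<^sup>2)"
    using newton_ball_bound[OF N] by blast
  \<comment> \<open>The first summand comes from the far zone, the second from the near zone, where
    \<open>\<kappa>\<close> turns |x|^(2-n) into \<open>newton x\<close>; the 1 only ensures
    positivity.\<close>
  define B where "B = 2 powr (n - 2) * m + 2 powr n * \<kappa> * C + 1"
  have "newton_pot (\<lambda>y. ennreal (?f y)) x \<le> ennreal (B * newton x)" if x: "x \<noteq> 0" for x :: "real^'n"
  proof -
    let ?r = "norm x / 2"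
    have r: "0 < ?r" using x by simp
    have nx: "newton x = norm x powr (2 - n) / \<kappa>" by (simp add: newton_def n_def \<kappa>_def)
    have ptw: "ennreal (newton (x - y)) * ennreal (?f y) \<le>
       ennreal (2 powr (n - 2) * newton x) * ennreal (?f y) +
       ennreal (2 powr n * norm x powr - n) * (ennreal (newton (y - x)) * indicator (cball x ?r) y)" for y
    proof (cases "?r \<le> norm (x - y)")
      case True
      have "newton (x - y) \<le> ?r powr (2 - n) / \<kappa>"
        using newton_antimono[OF N True r] by (simp add: n_def \<kappa>_def)
      also have "\<dots> = 2 powr (n - 2) * newton x"
        using x by (simp add: nx powr_divide) (simp add: powr_diff field_simps)
      finally have "ennreal (newton (x - y)) * ennreal (?f y) \<le> ennreal (2 powr (n - 2) * newton x) * ennreal (?f y)"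
        by (intro mult_right_mono ennreal_leI) auto
      then show ?thesis by (meson add_increasing2 zero_le)
    next
      case False
      have "norm x \<le> norm (x - y) + norm y" by (metis diff_add_cancel norm_triangle_ineq)
      with False have y: "?r \<le> norm y" by linarith
      have yb: "y \<in> cball x ?r" using False by (simp add: dist_norm)
      \<comment> \<open>Since b < n < d, the minimum lies below the critical power on both sides of
        the unit sphere.\<close>
      have "?f y \<le> norm y powr - n"
      proof (cases "norm y \<le> 1")
        case True
        have "norm y powr - b \<le> norm y powr - n" using True n y r by (intro powr_mono') auto
        then show ?thesis by (rule min.coboundedI1)
      next
        case False
        have "norm y powr - d \<le> norm y powr - n" using False n by (intro powr_mono) auto
        then show ?thesis by (rule min.coboundedI2)
      qed
      also have "\<dots> \<le> ?r powr - n" using y r n by (intro powr_mono2') auto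
      also have "\<dots> = 2 powr n * norm x powr - n" using x by (simp add: powr_divide powr_minus field_simps)
      finally have "ennreal (newton (x - y)) * ennreal (?f y) \<le> ennreal (2 powr n * norm x powr - n) * ennreal (newton (y - x))"
        using newton_minus[of "x - y"] by (subst mult.commute, intro mult_mono ennreal_leI) auto
      with yb show ?thesis by (simp add: add_increasing)
    qed
    have "newton_pot (\<lambda>y. ennreal (?f y)) x \<le> (\<integral>\<^sup>+y. ennreal (2 powr (n - 2) * newton x) * ennreal (?f y) +
       ennreal (2 powr n * norm x powr - n) * (ennreal (newton (y - x)) * indicator (cball x ?r) y) \<partial>lborel)"
      unfolding newton_pot_def by (intro nn_integral_mono ptw)
    also have "\<dots> = ennreal (2 powr (n - 2) * newton x) * ennreal m +
      ennreal (2 powr n * norm x powr - n) * (\<integral>\<^sup>+y. ennreal (newton (y - x)) * indicator (cball x ?r) y \<partial>lborel)"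
    proof -
      have m1: "(\<lambda>y. ennreal (?f y)) \<in> borel_measurable lborel" by measurable
      have m2: "(\<lambda>y. ennreal (newton (y - x)) * indicator (cball x ?r) y) \<in> borel_measurable lborel"
        by measurable
      show ?thesis
        unfolding m(1)[symmetric] nn_integral_cmult[OF m1, symmetric] nn_integral_cmult[OF m2, symmetric]
        using m1 m2 by (intro nn_integral_add borel_measurable_times_ennreal) auto
    qed
    also have "\<dots> \<le> ennreal (2 powr (n - 2) * newton x) * ennreal m + ennreal (2 powr n * norm x powr - n) * ennreal (C * ?r\<^sup>2)"
      by (intro add_left_mono mult_left_mono C r) auto
    also have "\<dots> = ennreal (2 powr (n - 2) * newton x * m + 2 powr n * norm x powr - n * (C * ?r\<^sup>2))"
      using m C newton_nonneg[OF N, of x] by (subst (1 2) ennreal_mult'[symmetric]) (auto simp: ennreal_plus)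
    also have "\<dots> \<le> ennreal (B * newton x)"
    proof (rule ennreal_leI)
      have "norm x powr - n * ?r\<^sup>2 = norm x powr (2 - n) / 4"
        using x by (simp add: powr_diff powr_minus field_simps power2_eq_square powr_numeral)
      then have "2 powr n * norm x powr - n * (C * ?r\<^sup>2) = 2 powr n * C / 4 * (\<kappa> * newton x)"
        using \<kappa> by (simp add: nx)
      also have "\<dots> \<le> 2 powr n * C * (\<kappa> * newton x)"
        using C \<kappa> newton_nonneg[OF N, of x] by simp
      finally show "2 powr (n - 2) * newton x * m + 2 powr n * norm x powr - n * (C * ?r\<^sup>2) \<le> B * newton x"
        using newton_nonneg[OF N, of x] by (simp add: B_def algebra_simps)
    qed
    finally show ?thesis .
  qed
  moreover have "0 < B" using m C \<kappa> by (auto simp: B_def intro!: add_nonneg_pos add_nonneg_nonneg)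
  ultimately show ?thesis by blast
qed

section \<open>Green representation of test functions\<close>

lemma integrable_bounded_support:
  fixes f :: "'a::euclidean_space \<Rightarrow> real"
  assumes "f \<in> borel_measurable borel" and b: "\<And>x. \<bar>f x\<bar> \<le> M" and z: "\<And>x. R < norm x \<Longrightarrow> f x = 0"
  shows "integrable lborel f"
proof (rule integrableI_bounded_set[where A = "cball 0 R" and B = M])
  show "AE x in lborel. x \<in> cball 0 R \<longrightarrow> norm (f x) \<le> M" using b by simp
  show "emeasure lborel (cball (0::'a) R) < \<infinity>" by (simp add: emeasure_lborel_cball_finite[unfolded infinity_ennreal_def])
  show "AE x in lborel. x \<notin> cball 0 R \<longrightarrow> f x = 0"
    using z by (auto simp: not_le)
qed (use assms(1) in auto)

lemma lborel_integral_translate: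
  fixes f :: "'a::euclidean_space \<Rightarrow> real"
  assumes [measurable]: "f \<in> borel_measurable borel"
  shows "(LINT x|lborel. f (x + a)) = (LINT x|lborel. f x)"
proof -
  have "(LINT x|lborel. f x) = (LINT x|distr lborel borel ((+) a). f x)"
    by (simp add: lborel_distr_plus)
  also have "\<dots> = (LINT x|lborel. f (a + x))" by (subst integral_distr) auto
  finally show ?thesis by (simp add: add.commute)
qed

lemma lborel_integral_affine:
  fixes f :: "'a::euclidean_space \<Rightarrow> real"
  assumes [measurable]: "f \<in> borel_measurable borel" and c: "c \<noteq> 0"
  shows "(LINT x|lborel. f x) = \<bar>c\<bar> ^ DIM('a) * (LINT x|lborel. f (t + c *\<^sub>R x))"
  by (subst lborel_affine[OF c, of t], subst integral_density, simp_all add: integral_distr)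

lemma difference_quotient_sequence:
  fixes f :: "real \<Rightarrow> real"
  assumes "(f has_real_derivative D) (at 0)" and "s \<longlonglongrightarrow> 0" and "\<And>n. s n \<noteq> 0"
  shows "(\<lambda>n. (f (s n) - f 0) / s n) \<longlonglongrightarrow> D"
proof -
  have "((\<lambda>h. (f h - f 0) / h) \<longlongrightarrow> D) (at 0)" using assms(1) by (simp add: DERIV_def)
  moreover have "filterlim s (at 0) sequentially" using assms(2,3) by (simp add: filterlim_at)
  ultimately show ?thesis by (rule filterlim_compose)
qed

text \<open>Difference quotients are moved from \<open>g\<close> to \<open>\<phi>\<close> by translation before the limit is
  taken, so only the almost everywhere derivative of the Lipschitz function is needed.\<close>

lemma integral_by_parts_lipschitz:
  fixes \<phi> \<phi>' g d :: "'a::euclidean_space \<Rightarrow> real"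
  assumes der: "\<And>x. ((\<lambda>t. \<phi> (x + t *\<^sub>R e)) has_real_derivative \<phi>' x) (at 0)"
    and c0: "continuous_on UNIV \<phi>" and c1: "continuous_on UNIV \<phi>'"
    and lip: "L-lipschitz_on UNIV g" and supp: "\<And>x. R < norm x \<Longrightarrow> g x = 0"
    and d: "AE x in lborel. (\<lambda>n. (g (x + (1 / real (Suc n)) *\<^sub>R e) - g x) / (1 / real (Suc n))) \<longlonglongrightarrow> d x"
    and dm [measurable]: "d \<in> borel_measurable borel"
  shows "(LINT x|lborel. \<phi> x * d x) = - (LINT x|lborel. \<phi>' x * g x)"
    and "integrable lborel (\<lambda>x. \<phi> x * d x)"
proof -
  define h where "h n = 1 / real (Suc n)" for n
  have h: "0 < h n" "h n \<le> 1" for n by (auto simp: h_def)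
  have h0: "h \<longlonglongrightarrow> 0" unfolding h_def[abs_def] by (rule LIMSEQ_Suc[OF lim_1_over_n])
  \<comment> \<open>Steps have length at most \<open>norm e\<close>, so every difference quotient of
    \<open>g\<close> vanishes outside the ball of radius \<open>R'\<close>.\<close>
  define R' where "R' = \<bar>R\<bar> + norm e"
  have contg: "continuous_on UNIV g" using lip lipschitz_on_continuous_on by blast
  have [measurable]: "\<phi> \<in> borel_measurable borel" "\<phi>' \<in> borel_measurable borel" "g \<in> borel_measurable borel"
    using c0 c1 contg by (auto intro: borel_measurable_continuous_onI)
  have bdd: "\<exists>M\<ge>0. \<forall>x\<in>cball 0 R'. \<bar>f x\<bar> \<le> M" if "continuous_on UNIV f" for f :: "'a \<Rightarrow> real"
  proof -
    have "compact (f ` cball 0 R')"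
      using that by (intro compact_continuous_image) (auto intro: continuous_on_subset)
    then obtain M where "\<forall>y\<in>f ` cball 0 R'. norm y \<le> M"
      using compact_imp_bounded bounded_iff by metis
    then show ?thesis by (intro exI[of _ "max M 0"]) (auto simp: le_max_iff_disj)
  qed
  obtain M where M: "0 \<le> M" "\<And>x. norm x \<le> R' \<Longrightarrow> \<bar>\<phi> x\<bar> \<le> M" using bdd[OF c0] by auto
  obtain M' where M': "0 \<le> M'" "\<And>x. norm x \<le> R' \<Longrightarrow> \<bar>\<phi>' x\<bar> \<le> M'" using bdd[OF c1] by auto
  obtain G where G: "0 \<le> G" "\<And>x. norm x \<le> R' \<Longrightarrow> \<bar>g x\<bar> \<le> G" using bdd[OF contg] by auto
  have RR: "R < norm x" if "R' < norm x" for x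
    using that norm_ge_zero[of e] unfolding R'_def by linarith
  have gz: "g x = 0" if "\<not> norm x \<le> R'" for x
    using that RR[of x] supp[of x] by simp
  have G': "\<bar>g x\<bar> \<le> G" for x
    using G gz[of x] by (cases "norm x \<le> R'") auto
  have L0: "0 \<le> L" using lip by (rule lipschitz_on_nonneg)
  define q where "q n x = (g (x + h n *\<^sub>R e) - g x) / h n" for n x
  define r where "r n x = (\<phi> (x - h n *\<^sub>R e) - \<phi> x) / h n" for n x
  have [measurable]: "q n \<in> borel_measurable borel" "r n \<in> borel_measurable borel" for n
    unfolding q_def r_def by measurable
  have qb: "\<bar>q n x\<bar> \<le> L * norm e" for n x
  proof -
    have "\<bar>g (x + h n *\<^sub>R e) - g x\<bar> \<le> L * (h n * norm e)"
      using lipschitz_onD[OF lip, of "x + h n *\<^sub>R e" x] h(1)[of n] by (simp add: dist_norm)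
    then show ?thesis using h(1)[of n] by (simp add: q_def field_simps)
  qed
  have qz: "q n x = 0" if "R' < norm x" for n x
  proof -
    have "norm (h n *\<^sub>R e) \<le> norm e" using h[of n] by (simp add: mult_left_le_one_le)
    moreover have "norm x - norm (h n *\<^sub>R e) \<le> norm (x + h n *\<^sub>R e)" by (rule norm_diff_ineq)
    ultimately have "R < norm (x + h n *\<^sub>R e)" "R < norm x"
      using that norm_ge_zero[of e] unfolding R'_def by linarith+
    then show ?thesis by (simp add: q_def supp)
  qed
  have bq: "\<bar>\<phi> x * q n x\<bar> \<le> M * (L * norm e) * indicator (cball 0 R') x" for n x
  proof (cases "norm x \<le> R'")
    case True
    then show ?thesis using M qb[of n x] by (simp add: abs_mult mult_mono)
  next
    case False
    then show ?thesis using qz by simp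
  qed
  have rb: "\<bar>r n x\<bar> \<le> M'" if x: "norm x \<le> \<bar>R\<bar>" for n x
  proof -
    have dt: "((\<lambda>t. \<phi> (x + t *\<^sub>R e)) has_real_derivative \<phi>' (x + s *\<^sub>R e)) (at s)" for s
      using der[of "x + s *\<^sub>R e"] DERIV_at_within_shift[of "\<lambda>t. \<phi> (x + t *\<^sub>R e)" _ s 0 UNIV]
      by (simp add: algebra_simps)
    have "\<exists>z. -h n < z \<and> z < 0 \<and> \<phi> (x + 0 *\<^sub>R e) - \<phi> (x + (-h n) *\<^sub>R e) = (0 - (- h n)) * \<phi>' (x + z *\<^sub>R e)"
      using h[of n] by (intro MVT2) (auto intro: dt)
    then obtain z where z: "-h n < z" "z < 0" "\<phi> x - \<phi> (x - h n *\<^sub>R e) = h n * \<phi>' (x + z *\<^sub>R e)"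
      by auto
    have "norm (z *\<^sub>R e) \<le> norm e" using z h[of n] mult_left_le_one_le[of "norm e" "\<bar>z\<bar>"] by simp
    then have "norm (x + z *\<^sub>R e) \<le> R'"
      using x norm_triangle_ineq[of x "z *\<^sub>R e"] by (simp add: R'_def)
    moreover have "r n x = - \<phi>' (x + z *\<^sub>R e)" using z(3) h(1)[of n] by (simp add: r_def field_simps)
    ultimately show ?thesis using M' by simp
  qed
  have br: "\<bar>r n x * g x\<bar> \<le> M' * G * indicator (cball 0 R') x" for n x
  proof (cases "norm x \<le> \<bar>R\<bar>")
    case True
    then have "norm x \<le> R'" by (simp add: R'_def add_increasing2)
    then show ?thesis using rb[OF True, of n] G'[of x] M' by (simp add: abs_mult mult_mono)
  next
    case False
    then show ?thesis using supp[of x] M' G by simp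
  qed
  have ib: "integrable lborel (\<lambda>x. C * indicator (cball (0::'a) R') x)" for C :: real
    by (intro integrable_mult_right integrable_indicator) (auto simp: emeasure_lborel_cball_finite[unfolded infinity_ennreal_def])
  have lim1: "(\<lambda>n. LINT x|lborel. \<phi> x * q n x) \<longlonglongrightarrow> (LINT x|lborel. \<phi> x * d x)"
    and int1: "integrable lborel (\<lambda>x. \<phi> x * d x)"
  proof -
    have "AE x in lborel. (\<lambda>n. \<phi> x * q n x) \<longlonglongrightarrow> \<phi> x * d x"
      using d by eventually_elim (auto intro!: tendsto_mult simp: q_def h_def)
    note lim = this
    have bnd: "AE x in lborel. norm (\<phi> x * q n x) \<le> M * (L * norm e) * indicator (cball 0 R') x" for n
      using bq by simp
    show "(\<lambda>n. LINT x|lborel. \<phi> x * q n x) \<longlonglongrightarrow> (LINT x|lborel. \<phi> x * d x)"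
      by (rule integral_dominated_convergence[OF _ _ ib lim bnd]) measurable
    show "integrable lborel (\<lambda>x. \<phi> x * d x)"
      by (rule integrable_dominated_convergence[OF _ _ ib lim bnd]) measurable
  qed
  have lim2: "(\<lambda>n. LINT x|lborel. r n x * g x) \<longlonglongrightarrow> (LINT x|lborel. - \<phi>' x * g x)"
  proof (rule integral_dominated_convergence[OF _ _ ib])
    have "(\<lambda>n. r n x) \<longlonglongrightarrow> - \<phi>' x" for x
    proof -
      have "(\<lambda>n. (\<phi> (x + (- h n) *\<^sub>R e) - \<phi> (x + 0 *\<^sub>R e)) / (- h n)) \<longlonglongrightarrow> \<phi>' x"
        using der[of x] h h0 by (intro difference_quotient_sequence) (auto simp: less_imp_neq[symmetric] intro: tendsto_minus_cancel)
      from tendsto_minus[OF this] show ?thesis by (simp add: r_def[abs_def])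
    qed
    then show "AE x in lborel. (\<lambda>n. r n x * g x) \<longlonglongrightarrow> - \<phi>' x * g x"
      by (intro AE_I2 tendsto_mult) auto
    show "AE x in lborel. norm (r n x * g x) \<le> M' * G * indicator (cball 0 R') x" for n
      using br by simp
  qed auto
  \<comment> \<open>Discrete integration by parts: the shifted copy of \<open>g\<close> becomes an
    oppositely shifted copy of \<open>\<phi>\<close>, by translation invariance.\<close>
  have eq: "(LINT x|lborel. \<phi> x * q n x) = (LINT x|lborel. r n x * g x)" for n
  proof -
    let ?a = "h n *\<^sub>R e"
    have na: "norm ?a \<le> norm e" using h[of n] by (simp add: mult_left_le_one_le)
    have i1: "integrable lborel (\<lambda>x. \<phi> x * g x)"
    proof (rule integrable_bounded_support[of _ "M * G" R'])
      show "\<bar>\<phi> x * g x\<bar> \<le> M * G" for x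
        using M(2)[of x] M(1) G gz[of x]
        by (cases "norm x \<le> R'") (auto simp: abs_mult intro!: mult_mono)
      show "\<phi> x * g x = 0" if "R' < norm x" for x
        using gz[of x] that by auto
    qed measurable
    have i2: "integrable lborel (\<lambda>x. \<phi> (x - ?a) * g x)"
    proof (rule integrable_bounded_support[of _ "M * G" "\<bar>R\<bar>"])
      show "\<bar>\<phi> (x - ?a) * g x\<bar> \<le> M * G" for x
      proof (cases "norm x \<le> \<bar>R\<bar>")
        case True
        then have "norm (x - ?a) \<le> R'" using norm_triangle_ineq4[of x ?a] na by (simp add: R'_def)
        then show ?thesis using M G' G by (simp add: abs_mult mult_mono)
      next
        case False
        then show ?thesis using supp[of x] M G by simp
      qed
      show "\<phi> (x - ?a) * g x = 0" if "\<bar>R\<bar> < norm x" for x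
        using supp[of x] that by simp
    qed measurable
    have i3: "integrable lborel (\<lambda>x. \<phi> x * g (x + ?a))"
    proof (rule integrable_bounded_support[of _ "M * G" R'])
      have z: "g (x + ?a) = 0" if "R' < norm x" for x
        using norm_diff_ineq[of x ?a] na that by (intro supp) (auto simp: R'_def)
      show "\<bar>\<phi> x * g (x + ?a)\<bar> \<le> M * G" for x
        using M G G'[of "x + ?a"] z[of x] by (cases "norm x \<le> R'") (auto simp: abs_mult intro!: mult_mono)
      show "\<phi> x * g (x + ?a) = 0" if "R' < norm x" for x using z[OF that] by simp
    qed measurable
    have "(LINT x|lborel. \<phi> x * q n x) = ((LINT x|lborel. \<phi> x * g (x + ?a)) - (LINT x|lborel. \<phi> x * g x)) / h n"
      using i1 i3 by (subst Bochner_Integration.integral_diff[symmetric]) (simp_all add: q_def right_diff_distrib)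
    also have "(LINT x|lborel. \<phi> x * g (x + ?a)) = (LINT x|lborel. \<phi> (x - ?a) * g x)"
      using lborel_integral_translate[of "\<lambda>x. \<phi> (x - ?a) * g x" ?a] by simp
    also have "((LINT x|lborel. \<phi> (x - ?a) * g x) - (LINT x|lborel. \<phi> x * g x)) / h n = (LINT x|lborel. r n x * g x)"
      using i1 i2 by (subst Bochner_Integration.integral_diff[symmetric]) (simp_all add: r_def left_diff_distrib)
    finally show ?thesis .
  qed
  show "(LINT x|lborel. \<phi> x * d x) = - (LINT x|lborel. \<phi>' x * g x)"
    using LIMSEQ_unique[OF lim1] lim2 unfolding eq by simp
  show "integrable lborel (\<lambda>x. \<phi> x * d x)" by (rule int1)
qed

lemma norm_add_axis:
  fixes z :: "real^'n"
  shows "norm (z + t *\<^sub>R axis i 1) ^ 2 = norm z ^ 2 + 2 * t * z $ i + t\<^sup>2"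
  unfolding power2_norm_eq_inner
  by (simp add: inner_add_left inner_add_right inner_commute inner_axis inner_axis_axis algebra_simps
      power2_eq_square)

lemma sum_component_squares: "(\<Sum>i\<in>UNIV. (z $ i)\<^sup>2) = norm (z :: real^'n) ^ 2"
  unfolding power2_norm_eq_inner inner_vec_def by (simp add: power2_eq_square)

lemma has_real_derivative_along_axis:
  assumes "\<And>x. (\<xi> has_derivative (\<lambda>h. g x \<bullet> h)) (at x)"
  shows "((\<lambda>t. \<xi> (x + t *\<^sub>R axis i 1)) has_real_derivative g x $ i) (at 0)"
proof -
  have "((\<lambda>t. \<xi> (x + t *\<^sub>R axis i 1)) has_derivative (\<lambda>t. g (x + 0 *\<^sub>R axis i 1) \<bullet> (t *\<^sub>R axis i 1))) (at 0)"
    by (rule has_derivative_compose[of "\<lambda>t. x + t *\<^sub>R axis i 1" "\<lambda>t. t *\<^sub>R axis i 1" 0 UNIV \<xi> "\<lambda>h. g (x + 0 *\<^sub>R axis i 1) \<bullet> h"])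
       (auto intro!: derivative_eq_intros assms)
  then show ?thesis
    by (simp add: has_field_derivative_def inner_axis mult.commute[of _ "g x $ i"])
qed

section \<open>Calculus of test functions of class C^{1,1}\<close>

lemma partial_deriv_gradient:
  assumes "\<And>x. (\<xi> has_derivative (\<lambda>h. g x \<bullet> h)) (at x)"
  shows "partial_deriv i \<xi> = (\<lambda>x. g x $ i)"
  unfolding partial_deriv_def[abs_def]
  by (intro ext DERIV_imp_deriv has_real_derivative_along_axis assms)

text \<open>Compact support makes the continuous gradient bounded, so the test function is itself
  Lipschitz. This lets it take the place of \<open>g\<close> in the second of two integrations by
  parts.\<close>

lemma C11_c_gradient:
  assumes "\<xi> \<in> (C11_c :: (real^'n \<Rightarrow> real) set)"
  shows "\<exists>g L R M. (\<forall>x. (\<xi> has_derivative (\<lambda>h. g x \<bullet> h)) (at x)) \<and> L-lipschitz_on UNIV g \<and> 0 < R \<and>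
    (\<forall>x. R < norm x \<longrightarrow> \<xi> x = 0 \<and> g x = 0) \<and> (\<forall>x. \<bar>\<xi> x\<bar> \<le> M) \<and> (\<forall>x. norm (g x) \<le> M) \<and> M-lipschitz_on UNIV \<xi>"
proof -
  obtain g L where g: "\<And>x. (\<xi> has_derivative (\<lambda>h. g x \<bullet> h)) (at x)" "L-lipschitz_on UNIV g"
    and K: "compact (closure {x. \<xi> x \<noteq> 0})"
    using assms unfolding C11_c_def by blast
  obtain R where R: "0 < R" "closure {x. \<xi> x \<noteq> 0} \<subseteq> ball 0 R"
    using bounded_subset_ballD[OF compact_imp_bounded[OF K], of 0] by blast
  have \<xi>0: "\<xi> x = 0" if "R \<le> norm x" for x
  proof (rule ccontr)
    assume "\<xi> x \<noteq> 0"
    then have "x \<in> ball 0 R" using R(2) closure_subset[of "{x. \<xi> x \<noteq> 0}"] by blast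
    then show False using that by simp
  qed
  have g0: "g x = 0" if "R < norm x" for x
  proof -
    have "eventually (\<lambda>y. y \<in> - cball 0 R) (nhds x)"
      using that by (intro eventually_nhds_in_open) (auto simp: open_Compl)
    then have "eventually (\<lambda>y. \<xi> y = 0) (nhds x)"
      by eventually_elim (auto intro: \<xi>0)
    then have "eventually (\<lambda>y. 0 = \<xi> y) (at x)"
      unfolding eventually_at_filter by eventually_elim simp
    then have "(\<xi> has_derivative (\<lambda>h. 0)) (at x)"
      using has_derivative_transform_eventually[of "\<lambda>_. 0" "\<lambda>_. 0" x UNIV \<xi>] \<xi>0[of x] that by simp
    then have "(\<lambda>h. g x \<bullet> h) = (\<lambda>h. 0)" using g(1) has_derivative_unique by blast
    then have "g x \<bullet> g x = 0" by metis
    then show ?thesis by simp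
  qed
  have cg: "continuous_on UNIV g" using g(2) lipschitz_on_continuous_on by blast
  have c\<xi>: "continuous_on UNIV \<xi>" by (rule has_derivative_continuous_on[OF has_derivative_at_withinI[OF g(1)]])
  have bdd: "\<exists>M\<ge>0. \<forall>x. norm (f x) \<le> M" if "continuous_on UNIV f" "\<And>x. R < norm x \<Longrightarrow> f x = 0" for f :: "real^'n \<Rightarrow> 'b::real_normed_vector"
  proof -
    have "compact (f ` cball 0 R)"
      using that by (intro compact_continuous_image) (auto intro: continuous_on_subset)
    then obtain M where M: "\<forall>y\<in>f ` cball 0 R. norm y \<le> M"
      using compact_imp_bounded bounded_iff by metis
    have "norm (f x) \<le> max M 0" for x
      using M that(2)[of x] by (cases "norm x \<le> R") (auto simp: le_max_iff_disj)
    then show ?thesis by (intro exI[of _ "max M 0"]) auto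
  qed
  obtain M1 where M1: "0 \<le> M1" "\<And>x. norm (\<xi> x) \<le> M1" using bdd[OF c\<xi>] \<xi>0 by force
  obtain M2 where M2: "0 \<le> M2" "\<And>x. norm (g x) \<le> M2" using bdd[OF cg] g0 by force
  define M where "M = max M1 M2"
  have "M-lipschitz_on UNIV \<xi>"
  proof (rule bounded_derivative_imp_lipschitz)
    show "(\<xi> has_derivative (\<lambda>h. g x \<bullet> h)) (at x within UNIV)" for x using g by simp
    show "onorm (\<lambda>h. g x \<bullet> h) \<le> M" for x
    proof (rule onorm_bound)
      show "norm (g x \<bullet> h) \<le> M * norm h" for h
      proof -
        have "norm (g x \<bullet> h) \<le> norm (g x) * norm h" using Cauchy_Schwarz_ineq2 by simp
        also have "\<dots> \<le> M * norm h" using M2(2)[of x] by (intro mult_right_mono) (auto simp: M_def)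
        finally show ?thesis .
      qed
    qed (use M1 in \<open>auto simp: M_def\<close>)
  qed (use M1 in \<open>auto simp: M_def\<close>)
  then show ?thesis
    using g R(1) \<xi>0 g0 M1 M2
    by (intro exI[of _ g] exI[of _ L] exI[of _ R] exI[of _ M]) (auto simp: M_def le_max_iff_disj)
qed

text \<open>Newtonian kernel smoothed at scale \<open>e\<close>; its Laplacian is \<open>- bubble e\<close>.\<close>

definition smooth_newton :: "real \<Rightarrow> real^'n \<Rightarrow> real" where
  "smooth_newton e z = (norm z ^ 2 + e\<^sup>2) powr ((2 - real CARD('n)) / 2)"

lemma smooth_newton_derivs:
  fixes x y :: "real^'n"
  assumes e: "0 < e"
  defines "n \<equiv> real CARD('n)"
  shows "((\<lambda>t. smooth_newton e (x - (y + t *\<^sub>R axis i 1))) has_real_derivative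
            (n - 2) * (norm (x - y) ^ 2 + e\<^sup>2) powr (- n / 2) * (x - y) $ i) (at 0)"
    and "((\<lambda>t. (n - 2) * (norm (x - (y + t *\<^sub>R axis i 1)) ^ 2 + e\<^sup>2) powr (- n / 2) * (x - (y + t *\<^sub>R axis i 1)) $ i)
           has_real_derivative
            (2 - n) * (norm (x - y) ^ 2 + e\<^sup>2) powr (- n / 2)
            + (n - 2) * n * (norm (x - y) ^ 2 + e\<^sup>2) powr (- n / 2 - 1) * ((x - y) $ i)\<^sup>2) (at 0)"
proof -
  let ?z = "x - y"
  have nrm: "norm (x - (y + t *\<^sub>R axis i 1)) ^ 2 + e\<^sup>2 = norm ?z ^ 2 + e\<^sup>2 - 2 * t * ?z $ i + t\<^sup>2" for t
  proof -
    have "x - (y + t *\<^sub>R axis i 1) = ?z + (- t) *\<^sub>R axis i 1" by simp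
    then show ?thesis using norm_add_axis[of ?z "- t" i] by (simp only:) simp
  qed
  have pos: "0 < norm ?z ^ 2 + e\<^sup>2" using e by (simp add: add_nonneg_pos)
  have s: "((\<lambda>t. norm ?z ^ 2 + e\<^sup>2 - 2 * t * ?z $ i + t\<^sup>2) has_real_derivative - 2 * ?z $ i) (at 0)"
    by (auto intro!: derivative_eq_intros)
  have p: "((\<lambda>t. (norm ?z ^ 2 + e\<^sup>2 - 2 * t * ?z $ i + t\<^sup>2) powr a) has_real_derivative
     a * (norm ?z ^ 2 + e\<^sup>2) powr (a - 1) * (- 2 * ?z $ i)) (at 0)" for a
    using DERIV_fun_powr[OF s, of a] pos by simp
  show "((\<lambda>t. smooth_newton e (x - (y + t *\<^sub>R axis i 1))) has_real_derivative
            (n - 2) * (norm (x - y) ^ 2 + e\<^sup>2) powr (- n / 2) * (x - y) $ i) (at 0)"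
  proof -
    have e1: "(2 - n) / 2 - 1 = - n / 2" by (simp add: field_simps)
    show ?thesis
      unfolding smooth_newton_def nrm n_def[symmetric]
      by (rule DERIV_cong[OF p]) (unfold e1, simp add: field_simps)
  qed
  have c: "((\<lambda>t. (x - (y + t *\<^sub>R axis i 1)) $ i) has_real_derivative - 1) (at 0)"
    by (auto intro!: derivative_eq_intros simp: axis_def)
  have p2: "((\<lambda>t. (norm ?z ^ 2 + e\<^sup>2 - 2 * t * ?z $ i + t\<^sup>2) powr (- n / 2)) has_real_derivative
     n * (norm ?z ^ 2 + e\<^sup>2) powr (- n / 2 - 1) * ?z $ i) (at 0)"
    by (rule DERIV_cong[OF p]) (simp add: field_simps)
  show "((\<lambda>t. (n - 2) * (norm (x - (y + t *\<^sub>R axis i 1)) ^ 2 + e\<^sup>2) powr (- n / 2) * (x - (y + t *\<^sub>R axis i 1)) $ i)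
           has_real_derivative
            (2 - n) * (norm (x - y) ^ 2 + e\<^sup>2) powr (- n / 2)
            + (n - 2) * n * (norm (x - y) ^ 2 + e\<^sup>2) powr (- n / 2 - 1) * ((x - y) $ i)\<^sup>2) (at 0)"
    unfolding nrm
    by (rule DERIV_cong[OF DERIV_mult[OF DERIV_cmult[OF p2] c]]) (simp add: power2_eq_square algebra_simps)
qed

text \<open>Writing s^(-n/2) as s^(-n/2-1) (|z|^2 + e^2) makes the terms in |z|^2 cancel and leaves
  only the one in e^2.\<close>

lemma bubble_eq_laplacian:
  fixes z :: "real^'n"
  assumes e: "0 < e"
  defines "n \<equiv> real CARD('n)"
  shows "(\<Sum>i\<in>UNIV. (2 - n) * (norm z ^ 2 + e\<^sup>2) powr (- n / 2)
            + (n - 2) * n * (norm z ^ 2 + e\<^sup>2) powr (- n / 2 - 1) * (z $ i)\<^sup>2) = - bubble e z"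
proof -
  let ?s = "norm z ^ 2 + e\<^sup>2"
  have pos: "0 < ?s" using e by (simp add: add_nonneg_pos)
  define P where "P = ?s powr (- n / 2 - 1)"
  define Q where "Q = ?s powr (- n / 2)"
  have QP: "Q = P * ?s" using pos by (simp add: P_def Q_def powr_diff)
  have "- (n + 2) / 2 = - n / 2 - 1" by (simp add: field_simps)
  then have "?s powr (- (n + 2) / 2) = P" unfolding P_def by (rule arg_cong)
  then have bub: "bubble e z = n * (n - 2) * e\<^sup>2 * P" unfolding bubble_def n_def by simp
  show ?thesis
    unfolding P_def[symmetric] Q_def[symmetric] bub
    by (simp add: sum.distrib sum_distrib_left[symmetric] sum_component_squares n_def[symmetric] QP) (simp add: algebra_simps)
qed

lemma smooth_newton_continuous:
  fixes x :: "real^'n"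
  assumes e: "0 < e"
  shows "continuous_on UNIV (\<lambda>y. (norm (x - y) ^ 2 + e\<^sup>2) powr a)"
proof -
  have "0 < norm (x - y) ^ 2 + e\<^sup>2" for y using e by (simp add: add_nonneg_pos)
  then have "norm (x - y) ^ 2 + e\<^sup>2 \<noteq> 0" for y by (metis less_irrefl)
  then show ?thesis by (intro continuous_intros) auto
qed

text \<open>\<open>laplacian \<xi>\<close> carries arbitrary values on a null set, so it is replaced
  by a bounded Borel function \<open>l\<close> with compact support. Two integrations by parts
  against \<open>smooth_newton\<close> then move both derivatives onto the kernel.\<close>

lemma C11_c_laplacian:
  assumes \<xi>: "\<xi> \<in> (C11_c :: (real^'n \<Rightarrow> real) set)"
  shows "\<exists>l M R. l \<in> borel_measurable borel \<and> 0 < R \<and> (\<forall>x. \<bar>l x\<bar> \<le> M) \<and> (\<forall>x. R < norm x \<longrightarrow> l x = 0) \<and>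
    (AE x in lborel. laplacian \<xi> x = l x) \<and> continuous_on UNIV \<xi> \<and> (\<forall>x. \<bar>\<xi> x\<bar> \<le> M) \<and> (\<forall>x. R < norm x \<longrightarrow> \<xi> x = 0) \<and>
    (\<forall>e>0. \<forall>x. (LINT y|lborel. smooth_newton e (x - y) * l y) = - (LINT y|lborel. bubble e (x - y) * \<xi> y))"
proof -
  obtain g L R M where g: "\<And>x. (\<xi> has_derivative (\<lambda>h. g x \<bullet> h)) (at x)" "L-lipschitz_on UNIV g" "0 < R"
     "\<And>x. R < norm x \<Longrightarrow> \<xi> x = 0" "\<And>x. R < norm x \<Longrightarrow> g x = 0" "\<And>x. \<bar>\<xi> x\<bar> \<le> M" "\<And>x. norm (g x) \<le> M"
     and lip\<xi>: "M-lipschitz_on UNIV \<xi>"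
    using C11_c_gradient[OF \<xi>] by blast
  have c\<xi>: "continuous_on UNIV \<xi>" using lip\<xi> lipschitz_on_continuous_on by blast
  have lipg: "L-lipschitz_on UNIV (\<lambda>x. g x $ i)" for i
  proof (rule lipschitz_onI)
    fix x y show "dist (g x $ i) (g y $ i) \<le> L * dist x y"
      using dist_vec_nth_le[of "g x" i "g y"] lipschitz_onD[OF g(2), of x y] by simp
  qed (use g(2) lipschitz_on_nonneg in blast)
  have cg: "continuous_on UNIV (\<lambda>x. g x $ i)" for i using lipg lipschitz_on_continuous_on by blast
  have [measurable]: "(\<lambda>x. g x $ i) \<in> borel_measurable borel" for i
    using cg by (rule borel_measurable_continuous_onI)
  define q where "q i n x = (g (x + (1 / real (Suc n)) *\<^sub>R axis i 1) $ i - g x $ i) / (1 / real (Suc n))" for i n x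
  have [measurable]: "q i n \<in> borel_measurable borel" for i n
    unfolding q_def by measurable
  \<comment> \<open>As a limit of Borel difference quotients this is Borel even where the sequence
    diverges and \<open>lim\<close> returns a default value.\<close>
  define l where "l i x = lim (\<lambda>n. q i n x)" for i x
  have lm [measurable]: "l i \<in> borel_measurable borel" for i
    unfolding l_def by measurable
  have pd: "partial_deriv i \<xi> = (\<lambda>x. g x $ i)" for i by (rule partial_deriv_gradient[OF g(1)])
  have conv: "AE x in lborel. \<forall>i. (\<lambda>n. q i n x) \<longlonglongrightarrow> l i x \<and> partial_deriv i (partial_deriv i \<xi>) x = l i x"
  proof (subst AE_all_countable, rule allI)
    fix i
    show "AE x in lborel. (\<lambda>n. q i n x) \<longlonglongrightarrow> l i x \<and> partial_deriv i (partial_deriv i \<xi>) x = l i x"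
      using AE_directional_derivative_lipschitz[OF lipg[of i], of "axis i 1"]
    proof eventually_elim
      case (elim x)
      then obtain D where D: "((\<lambda>t. g (x + t *\<^sub>R axis i 1) $ i) has_real_derivative D) (at 0)" by blast
      have "(\<lambda>n. 1 / real (Suc n)) \<longlonglongrightarrow> 0" by (rule LIMSEQ_Suc[OF lim_1_over_n])
      from difference_quotient_sequence[OF D this] have "(\<lambda>n. q i n x) \<longlonglongrightarrow> D"
        by (simp add: q_def)
      moreover from this have "l i x = D" unfolding l_def by (rule limI)
      moreover have "partial_deriv i (partial_deriv i \<xi>) x = D"
        unfolding pd unfolding partial_deriv_def using D by (rule DERIV_imp_deriv)
      ultimately show ?case by simp
    qed
  qed
  have L0: "0 \<le> L" using g(2) by (rule lipschitz_on_nonneg)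
  have qb: "\<bar>q i n x\<bar> \<le> L" for i n x
  proof -
    have "\<bar>g (x + (1 / real (Suc n)) *\<^sub>R axis i 1) $ i - g x $ i\<bar> \<le> L * (1 / real (Suc n))"
      using lipschitz_onD[OF lipg[of i], of "x + (1 / real (Suc n)) *\<^sub>R axis i 1" x]
      by (simp add: dist_norm norm_axis_1)
    then have "\<bar>g (x + (1 / real (Suc n)) *\<^sub>R axis i 1) $ i - g x $ i\<bar> / (1 / real (Suc n)) \<le> L"
      by (subst pos_divide_le_eq) auto
    then show ?thesis unfolding q_def abs_divide by simp
  qed
  \<comment> \<open>The increments 1/(n+1) are at most 1, which enlarges the support radius by
    1.\<close>
  have qz: "q i n x = 0" if "R + 1 < norm x" for i n x
  proof -
    have "norm ((1 / real (Suc n)) *\<^sub>R (axis i 1 :: real^'n)) \<le> 1" by (simp add: norm_axis_1)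
    then have "R < norm (x + (1 / real (Suc n)) *\<^sub>R axis i 1)"
      using that norm_diff_ineq[of x "(1 / real (Suc n)) *\<^sub>R axis i 1"] by linarith
    then show ?thesis using that g(5) by (simp add: q_def)
  qed
  \<comment> \<open>Clipping makes the bound and the support condition hold at every point and
    changes nothing where the quotients converge.\<close>
  define l' where "l' i x = indicator (cball 0 (R + 1)) x * max (- L) (min L (l i x))" for i x
  have [measurable]: "l' i \<in> borel_measurable borel" for i
    unfolding l'_def
    by (intro borel_measurable_times borel_measurable_max borel_measurable_min borel_measurable_const
        lm borel_measurable_indicator) auto
  have l'eq: "l' i x = l i x" if "(\<lambda>n. q i n x) \<longlonglongrightarrow> l i x" for i x
  proof -
    have "- L \<le> q i n x" "q i n x \<le> L" for n using qb[of i n x] by linarith+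
    then have "- L \<le> l i x" "l i x \<le> L"
      using that by (auto intro: LIMSEQ_le_const LIMSEQ_le_const2)
    moreover have "l i x = 0" if "R + 1 < norm x"
      using LIMSEQ_unique[OF \<open>(\<lambda>n. q i n x) \<longlonglongrightarrow> l i x\<close>] qz[OF that] by simp
    ultimately show ?thesis by (auto simp: l'_def indicator_def)
  qed
  have l'b: "\<bar>l' i x\<bar> \<le> L" for i x
    using L0 by (auto simp: l'_def indicator_def abs_le_iff min_def max_def)
  define lap where "lap x = (\<Sum>i\<in>UNIV. l' i x)" for x
  have [measurable]: "lap \<in> borel_measurable borel" unfolding lap_def by measurable
  have ibp: "(LINT y|lborel. smooth_newton e (x - y) * lap y) = - (LINT y|lborel. bubble e (x - y) * \<xi> y)"
    if e: "0 < e" for e and x :: "real^'n"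
  proof -
    let ?n = "real CARD('n)"
    define \<phi>1 where "\<phi>1 i y = (?n - 2) * (norm (x - y) ^ 2 + e\<^sup>2) powr (- ?n / 2) * (x - y) $ i" for i and y :: "real^'n"
    define \<phi>2 where "\<phi>2 i y = (2 - ?n) * (norm (x - y) ^ 2 + e\<^sup>2) powr (- ?n / 2)
            + (?n - 2) * ?n * (norm (x - y) ^ 2 + e\<^sup>2) powr (- ?n / 2 - 1) * ((x - y) $ i)\<^sup>2" for i and y :: "real^'n"
    have c0: "continuous_on UNIV (\<lambda>y. smooth_newton e (x - y))"
      unfolding smooth_newton_def by (rule smooth_newton_continuous[OF e])
    have c1: "continuous_on UNIV (\<phi>1 i)" for i
      unfolding \<phi>1_def by (intro continuous_intros smooth_newton_continuous[OF e])
    have c2: "continuous_on UNIV (\<phi>2 i)" for i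
      unfolding \<phi>2_def by (intro continuous_intros smooth_newton_continuous[OF e])
    have A: "AE y in lborel. (\<lambda>n. (g (y + (1 / real (Suc n)) *\<^sub>R axis i 1) $ i - g y $ i) / (1 / real (Suc n))) \<longlonglongrightarrow> l' i y" for i
      using conv
    proof eventually_elim
      case (elim y)
      then have "(\<lambda>n. q i n y) \<longlonglongrightarrow> l' i y" using l'eq[of i y] by simp
      then show ?case unfolding q_def .
    qed
    have B: "AE y in lborel. (\<lambda>n. (\<xi> (y + (1 / real (Suc n)) *\<^sub>R axis i 1) - \<xi> y) / (1 / real (Suc n))) \<longlonglongrightarrow> g y $ i" for i
    proof (rule AE_I2)
      fix y
      have "((\<lambda>t. \<xi> (y + t *\<^sub>R axis i 1)) has_real_derivative g y $ i) (at 0)"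
        by (rule has_real_derivative_along_axis[OF g(1)])
      from difference_quotient_sequence[OF this LIMSEQ_Suc[OF lim_1_over_n]]
      show "(\<lambda>n. (\<xi> (y + (1 / real (Suc n)) *\<^sub>R axis i 1) - \<xi> y) / (1 / real (Suc n))) \<longlonglongrightarrow> g y $ i" by simp
    qed
    have s1: "((\<lambda>t. smooth_newton e (x - (y + t *\<^sub>R axis i 1))) has_real_derivative \<phi>1 i y) (at 0)" for y i
      unfolding \<phi>1_def by (rule smooth_newton_derivs(1)[OF e])
    have s2: "((\<lambda>t. \<phi>1 i (y + t *\<^sub>R axis i 1)) has_real_derivative \<phi>2 i y) (at 0)" for y i
      unfolding \<phi>1_def \<phi>2_def by (rule smooth_newton_derivs(2)[OF e])
    have g5: "R < norm x \<Longrightarrow> g x $ i = 0" for x i using g(5) by simp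
    \<comment> \<open>First integration by parts: the Lipschitz function is the gradient component,
      whose derivative exists only almost everywhere.\<close>
    have t1: "(LINT y|lborel. smooth_newton e (x - y) * l' i y) = - (LINT y|lborel. \<phi>1 i y * g y $ i)" for i
      by (rule integral_by_parts_lipschitz(1)[OF s1[of _ i] c0 c1[of i] lipg[of i] _ A[of i], of R]) (auto simp: g5)
    have t2: "integrable lborel (\<lambda>y. smooth_newton e (x - y) * l' i y)" for i
      by (rule integral_by_parts_lipschitz(2)[OF s1[of _ i] c0 c1[of i] lipg[of i] _ A[of i], of R]) (auto simp: g5)
    \<comment> \<open>Second integration by parts, now with \<open>\<xi>\<close> as the Lipschitz
      function.\<close>
    have t3: "(LINT y|lborel. \<phi>1 i y * g y $ i) = - (LINT y|lborel. \<phi>2 i y * \<xi> y)" for i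
      by (rule integral_by_parts_lipschitz(1)[OF s2[of i] c1[of i] c2[of i] lip\<xi> _ B[of i], of R]) (auto simp: g)
    have t4: "integrable lborel (\<lambda>y. \<phi>2 i y * \<xi> y)" for i
    proof -
      have "compact (\<phi>2 i ` cball 0 R)"
        using c2 by (intro compact_continuous_image) (auto intro: continuous_on_subset)
      then obtain K where K: "\<forall>y\<in>\<phi>2 i ` cball 0 R. norm y \<le> K"
        using compact_imp_bounded bounded_iff by metis
      show ?thesis
      proof (rule integrable_bounded_support[of _ "\<bar>K\<bar> * M" R])
        show "(\<lambda>y. \<phi>2 i y * \<xi> y) \<in> borel_measurable borel"
          using c2 c\<xi> by (intro borel_measurable_continuous_onI continuous_on_mult)
        fix y
        show "\<bar>\<phi>2 i y * \<xi> y\<bar> \<le> \<bar>K\<bar> * M"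
        proof (cases "norm y \<le> R")
          case True
          then have "\<bar>\<phi>2 i y\<bar> \<le> \<bar>K\<bar>" using K by force
          then show ?thesis using g(6)[of y] by (simp add: abs_mult mult_mono)
        next
          case False
          then show ?thesis using g(4)[of y] g(6)[of y] by simp
        qed
        show "\<phi>2 i y * \<xi> y = 0" if "R < norm y" using g(4)[OF that] by simp
      qed
    qed
    have "(LINT y|lborel. smooth_newton e (x - y) * lap y) = (\<Sum>i\<in>UNIV. LINT y|lborel. smooth_newton e (x - y) * l' i y)"
      unfolding lap_def sum_distrib_left by (rule Bochner_Integration.integral_sum) (rule t2)
    also have "\<dots> = (\<Sum>i\<in>UNIV. LINT y|lborel. \<phi>2 i y * \<xi> y)" by (simp add: t1 t3)
    also have "\<dots> = (LINT y|lborel. (\<Sum>i\<in>UNIV. \<phi>2 i y * \<xi> y))"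
      by (rule Bochner_Integration.integral_sum[symmetric]) (rule t4)
    also have "\<dots> = (LINT y|lborel. - (bubble e (x - y) * \<xi> y))"
      unfolding sum_distrib_right[symmetric] \<phi>2_def bubble_eq_laplacian[OF e] by simp
    finally show ?thesis by simp
  qed
  have lapeq: "AE x in lborel. laplacian \<xi> x = lap x"
    using conv by eventually_elim (simp add: laplacian_def lap_def l'eq)
  have lapb: "\<bar>lap x\<bar> \<le> real CARD('n) * L" for x
  proof -
    have "\<bar>lap x\<bar> \<le> (\<Sum>i\<in>UNIV. \<bar>l' i x\<bar>)" unfolding lap_def by (rule sum_abs)
    also have "\<dots> \<le> real CARD('n) * L" using sum_bounded_above[of UNIV "\<lambda>i. \<bar>l' i x\<bar>" L] l'b by simp
    finally show ?thesis .
  qed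
  have lapz: "lap x = 0" if "R + 1 < norm x" for x using that by (simp add: lap_def l'_def)
  show ?thesis
  proof (intro exI conjI allI impI)
    show "\<bar>lap x\<bar> \<le> max (real CARD('n) * L) M" for x using lapb[of x] by simp
    show "\<bar>\<xi> x\<bar> \<le> max (real CARD('n) * L) M" for x using g(6)[of x] by simp
    show "lap x = 0" if "R + 1 < norm x" for x by (rule lapz[OF that])
    show "\<xi> x = 0" if "R + 1 < norm x" for x using g(4) that by simp
  qed (use g(3) lapeq c\<xi> ibp in auto)
qed

section \<open>Passage to the singular kernel\<close>

lemma newton_integrable_ball:
  assumes N: "2 < CARD('n::finite)"
  shows "integrable lborel (\<lambda>y. newton (x - y :: real^'n) * indicator (cball a R) y)"
proof (rule integrableI_bounded)
  obtain C where C: "\<And>R a y. 0 < R \<Longrightarrow> 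
    (\<integral>\<^sup>+x. ennreal (newton (x - y)) * indicator (cball a R) x \<partial>(lborel :: (real^'n) measure)) \<le> ennreal (C * R\<^sup>2)"
    using newton_ball_bound[OF N] by blast
  have "(\<integral>\<^sup>+y. ennreal (norm (newton (x - y) * indicator (cball a R) y)) \<partial>lborel) \<le>
    (\<integral>\<^sup>+y. ennreal (newton (y - x)) * indicator (cball a (\<bar>R\<bar> + 1)) y \<partial>lborel)"
  proof (rule nn_integral_mono)
    fix y :: "real^'n"
    show "ennreal (norm (newton (x - y) * indicator (cball a R) y)) \<le> ennreal (newton (y - x)) * indicator (cball a (\<bar>R\<bar> + 1)) y"
      using newton_nonneg[OF N, of "x - y"] newton_minus[of "x - y"] by (auto simp: indicator_def)
  qed
  also have "\<dots> \<le> ennreal (C * (\<bar>R\<bar> + 1)\<^sup>2)" by (rule C) simp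
  finally show "(\<integral>\<^sup>+y. ennreal (norm (newton (x - y) * indicator (cball a R) y)) \<partial>lborel) < \<infinity>"
    by (rule le_less_trans) simp
qed (intro borel_measurable_times borel_measurable_indicator; measurable)

text \<open>The family is the mass-preserving rescaling of one profile, which makes it an
  approximate identity up to its mass.\<close>

lemma bubble_scale:
  fixes z :: "real^'n"
  assumes e: "0 < e"
  shows "e ^ CARD('n) * bubble e (e *\<^sub>R z) = bubble 1 z"
proof -
  let ?n = "real CARD('n)" and ?s = "norm z ^ 2 + 1"
  have s: "0 < ?s" by (simp add: add_nonneg_pos)
  have h1: "norm (e *\<^sub>R z) ^ 2 + e\<^sup>2 = e\<^sup>2 * ?s" using e by (simp add: power_mult_distrib algebra_simps)
  have h2: "(e\<^sup>2 * ?s) powr (- (?n + 2) / 2) = (e\<^sup>2) powr (- (?n + 2) / 2) * ?s powr (- (?n + 2) / 2)"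
    using s by (simp add: powr_mult)
  have h3: "(e\<^sup>2) powr (- (?n + 2) / 2) = e powr (- (?n + 2))"
  proof -
    have "e\<^sup>2 = e powr 2" using e by simp
    then have "(e\<^sup>2) powr (- (?n + 2) / 2) = e powr (2 * (- (?n + 2) / 2))" by (simp only: powr_powr)
    also have "2 * (- (?n + 2) / 2) = - (?n + 2)" by (simp add: field_simps)
    finally show ?thesis .
  qed
  have h4: "e ^ CARD('n) * e\<^sup>2 * e powr (- (?n + 2)) = 1"
  proof -
    have "e ^ CARD('n) = e powr ?n" "e\<^sup>2 = e powr 2" using e by (simp_all add: powr_realpow)
    then have "e ^ CARD('n) * e\<^sup>2 * e powr (- (?n + 2)) = e powr (?n + 2 + - (?n + 2))"
      by (simp only: powr_add)
    then show ?thesis using e by simp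
  qed
  have "e ^ CARD('n) * bubble e (e *\<^sub>R z) =
      (e ^ CARD('n) * e\<^sup>2 * e powr (- (?n + 2))) * (?n * (?n - 2) * ?s powr (- (?n + 2) / 2))"
    unfolding bubble_def h1 h2 h3 by (simp only: mult_ac)
  then show ?thesis unfolding h4 unfolding bubble_def by simp
qed

text \<open>Let \<open>e\<close> tend to 0 in the regularised formula. On the left the kernels are
  dominated by \<open>\<kappa> * newton\<close>; on the right rescaling turns the integral into an
  average of \<xi> concentrating at \<open>x\<close>. The factor \<open>\<kappa>\<close> appears on
  both sides and cancels.\<close>

lemma newton_representation:
  assumes N: "2 < CARD('n::finite)" and \<xi>: "\<xi> \<in> (C11_c :: (real^'n \<Rightarrow> real) set)"
  shows "\<exists>l M R. l \<in> borel_measurable borel \<and> 0 < R \<and> (\<forall>x. \<bar>l x\<bar> \<le> M) \<and> (\<forall>x. R < norm x \<longrightarrow> l x = 0) \<and>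
    (AE x in lborel. laplacian \<xi> x = l x) \<and> continuous_on UNIV \<xi> \<and> (\<forall>x. \<bar>\<xi> x\<bar> \<le> M) \<and>
    (\<forall>x. (LINT y|lborel. newton (x - y) * l y) = - \<xi> x)"
proof -
  obtain l M R where lm [measurable]: "l \<in> borel_measurable borel" and R: "0 < R"
    and lM: "\<And>x. \<bar>l x\<bar> \<le> M" and lR: "\<And>x. R < norm x \<Longrightarrow> l x = 0"
    and ll: "AE x in lborel. laplacian \<xi> x = l x" and c\<xi>: "continuous_on UNIV \<xi>"
    and \<xi>M: "\<And>x. \<bar>\<xi> x\<bar> \<le> M" and \<xi>R: "\<And>x. R < norm x \<Longrightarrow> \<xi> x = 0"
    and ibp: "\<And>e x. 0 < e \<Longrightarrow> (LINT y|lborel. smooth_newton e (x - y) * l y) = - (LINT y|lborel. bubble e (x - y) * \<xi> y)"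
    using C11_c_laplacian[OF \<xi>] by (elim exE conjE, intro that) blast+
  have [measurable]: "\<xi> \<in> borel_measurable borel" using c\<xi> by (rule borel_measurable_continuous_onI)
  define \<kappa> where "\<kappa> = (LINT z|(lborel :: (real^'n) measure). bubble 1 z)"
  have \<kappa>: "0 < \<kappa>" using bubble_mass_pos[OF N] by (simp add: \<kappa>_def)
  let ?n = "real CARD('n)"
  have n: "2 < ?n" using N by simp
  have nw: "norm z powr (2 - ?n) = \<kappa> * newton z" for z :: "real^'n"
    using \<kappa> by (simp add: newton_def \<kappa>_def)
  have nw2: "(norm (x - y) ^ 2) powr ((2 - ?n) / 2) = \<kappa> * newton (x - y)" if "y \<noteq> x" for x y :: "real^'n"
  proof -
    have "norm (x - y) ^ 2 = norm (x - y) powr 2" using that by simp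
    then have "(norm (x - y) ^ 2) powr ((2 - ?n) / 2) = norm (x - y) powr (2 * ((2 - ?n) / 2))" by (simp only: powr_powr)
    also have "2 * ((2 - ?n) / 2) = 2 - ?n" by (simp add: field_simps)
    finally show ?thesis by (simp add: nw)
  qed
  define e where "e m = 1 / real (Suc m)" for m
  have e: "0 < e m" for m by (simp add: e_def)
  have e0: "e \<longlonglongrightarrow> 0" unfolding e_def[abs_def] by (rule LIMSEQ_Suc[OF lim_1_over_n])
  have "(LINT y|lborel. newton (x - y) * l y) = - \<xi> x" for x
  proof -
    have bubm: "(\<lambda>y. bubble t (x - y) * \<xi> y) \<in> borel_measurable borel" for t by measurable
    have A: "(LINT y|lborel. bubble (e m) (x - y) * \<xi> y) = (LINT z|lborel. bubble 1 z * \<xi> (x - e m *\<^sub>R z))" for m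
    proof -
      have "(LINT y|lborel. bubble (e m) (x - y) * \<xi> y) = 
         \<bar>- e m\<bar> ^ CARD('n) * (LINT z|lborel. bubble (e m) (x - (x + (- e m) *\<^sub>R z)) * \<xi> (x + (- e m) *\<^sub>R z))"
        using e[of m] lborel_integral_affine[OF bubm, of "- e m" "e m" x] by simp
      also have "\<dots> = (LINT z|lborel. e m ^ CARD('n) * (bubble (e m) (e m *\<^sub>R z) * \<xi> (x - e m *\<^sub>R z)))"
        using e[of m] by simp
      also have "\<dots> = (LINT z|lborel. bubble 1 z * \<xi> (x - e m *\<^sub>R z))"
        by (simp add: mult.assoc[symmetric] bubble_scale[OF e])
      finally show ?thesis .
    qed
    have "(\<lambda>m. LINT z|lborel. bubble 1 z * \<xi> (x - e m *\<^sub>R z)) \<longlonglongrightarrow> (LINT z|(lborel :: (real^'n) measure). bubble 1 z * \<xi> x)"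
    proof (rule integral_dominated_convergence)
      show "integrable lborel (\<lambda>z :: real^'n. bubble 1 z * M)"
        using bubble_integrable[OF N] by simp
      show "AE z in lborel. norm (bubble 1 z * \<xi> (x - e m *\<^sub>R z)) \<le> bubble 1 z * M" for m
      proof (rule AE_I2)
        fix z :: "real^'n"
        show "norm (bubble 1 z * \<xi> (x - e m *\<^sub>R z)) \<le> bubble 1 z * M"
          using \<xi>M[of "x - e m *\<^sub>R z"] bubble_nonneg[OF N, of 1 z] by (simp add: abs_mult mult_left_mono)
      qed
      show "AE z in lborel. (\<lambda>m. bubble 1 z * \<xi> (x - e m *\<^sub>R z)) \<longlonglongrightarrow> bubble 1 z * \<xi> x"
      proof (rule AE_I2)
        fix z :: "real^'n"
        have "(\<lambda>m. x - e m *\<^sub>R z) \<longlonglongrightarrow> x - 0 *\<^sub>R z" by (intro tendsto_intros e0)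
        then have t: "(\<lambda>m. x - e m *\<^sub>R z) \<longlonglongrightarrow> x" by simp
        have "isCont \<xi> x" using c\<xi> by (simp add: continuous_on_eq_continuous_at)
        then have "(\<lambda>m. \<xi> (x - e m *\<^sub>R z)) \<longlonglongrightarrow> \<xi> x"
          by (rule isCont_tendsto_compose[OF _ t])
        then show "(\<lambda>m. bubble 1 z * \<xi> (x - e m *\<^sub>R z)) \<longlonglongrightarrow> bubble 1 z * \<xi> x" by (intro tendsto_intros)
      qed
    qed measurable
    then have lim1: "(\<lambda>m. LINT y|lborel. smooth_newton (e m) (x - y) * l y) \<longlonglongrightarrow> - (\<kappa> * \<xi> x)"
      unfolding ibp[OF e] A by (intro tendsto_minus) (simp add: \<kappa>_def)
    have "(\<lambda>m. LINT y|lborel. smooth_newton (e m) (x - y) * l y) \<longlonglongrightarrow> (LINT y|lborel. \<kappa> * newton (x - y) * l y)"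
    proof (rule integral_dominated_convergence)
      show "integrable lborel (\<lambda>y. \<kappa> * M * (newton (x - y) * indicator (cball 0 R) y))"
        by (intro integrable_mult_right newton_integrable_ball[OF N])
      \<comment> \<open>The pole must be excluded: there the majorant is 0 by the convention
        \<open>newton 0 = 0\<close>, while \<open>smooth_newton\<close> is positive.\<close>
      have ne: "AE y in lborel. y \<noteq> x" by (rule AE_lborel_singleton)
      then show "AE y in lborel. norm (smooth_newton (e m) (x - y) * l y) \<le> \<kappa> * M * (newton (x - y) * indicator (cball 0 R) y)" for m
      proof eventually_elim
        case (elim y)
        note p = nw2[OF elim]
        have "smooth_newton (e m) (x - y) \<le> (norm (x - y) ^ 2) powr ((2 - ?n) / 2)"
          unfolding smooth_newton_def using elim n by (intro powr_mono2') auto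
        then have s: "smooth_newton (e m) (x - y) \<le> \<kappa> * newton (x - y)" by (simp add: p)
        have s0: "0 \<le> smooth_newton (e m) (x - y)" by (simp add: smooth_newton_def)
        show ?case
        proof (cases "norm y \<le> R")
          case True
          have "norm (smooth_newton (e m) (x - y) * l y) \<le> (\<kappa> * newton (x - y)) * M"
            using s s0 lM[of y] by (simp add: abs_mult mult_mono)
          then show ?thesis using True by (simp add: mult_ac)
        next
          case False
          then show ?thesis using lR[of y] by simp
        qed
      qed
      show "AE y in lborel. (\<lambda>m. smooth_newton (e m) (x - y) * l y) \<longlonglongrightarrow> \<kappa> * newton (x - y) * l y"
        using ne
      proof eventually_elim
        case (elim y)
        note p = nw2[OF elim]
        have "(\<lambda>m. (norm (x - y) ^ 2 + (e m)\<^sup>2) powr ((2 - ?n) / 2)) \<longlonglongrightarrow> (norm (x - y) ^ 2 + 0\<^sup>2) powr ((2 - ?n) / 2)"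
          using elim by (intro tendsto_intros e0) auto
        then have "(\<lambda>m. smooth_newton (e m) (x - y)) \<longlonglongrightarrow> \<kappa> * newton (x - y)"
          unfolding smooth_newton_def p[symmetric] by simp
        then show ?case by (intro tendsto_intros)
      qed
    qed (simp_all add: smooth_newton_def[abs_def])
    from LIMSEQ_unique[OF this lim1]
    have "\<kappa> * (LINT y|lborel. newton (x - y) * l y) = - (\<kappa> * \<xi> x)" by (simp add: mult.assoc)
    then have "\<kappa> * (LINT y|lborel. newton (x - y) * l y) = \<kappa> * (- \<xi> x)" by simp
    then show ?thesis using \<kappa> by (metis less_irrefl mult_left_cancel)
  qed
  then show ?thesis using lm R lM lR ll c\<xi> \<xi>M by blast
qed

section \<open>Radial test functions\<close>

text \<open>With F' = \<psi>/2, the function F(|x-a|^2) has gradient \<psi>(|x-a|^2) (x-a), which is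
  Lipschitz as soon as \<open>\<psi>\<close> is Lipschitz and vanishes for large arguments. The
  variable |x-a|^2 avoids the singularity of the norm at the centre.\<close>

lemma radial_test_function:
  fixes \<psi> :: "real \<Rightarrow> real" and a :: "real^'n"
  assumes R: "0 < R" and lip: "K-lipschitz_on UNIV \<psi>" and supp: "\<And>s. R\<^sup>2 \<le> s \<Longrightarrow> \<psi> s = 0"
  shows "\<exists>\<xi>\<in>C11_c. \<forall>x D. (\<psi> has_real_derivative D) (at (norm (x - a) ^ 2)) \<longrightarrow>
     laplacian \<xi> x = real CARD('n) * \<psi> (norm (x - a) ^ 2) + 2 * norm (x - a) ^ 2 * D"
proof -
  have K: "0 \<le> K" using lip by (rule lipschitz_on_nonneg)
  have c\<psi>: "continuous_on UNIV \<psi>" using lip lipschitz_on_continuous_on by blast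
  \<comment> \<open>The lower limit -1 keeps 0 in the interior, so \<open>F\<close> has a two-sided
    derivative at the argument belonging to x = a.\<close>
  define F where "F s = integral {-1..s} (\<lambda>t. \<psi> t / 2)" for s
  have c2: "continuous_on S (\<lambda>t. \<psi> t / 2)" for S
    using c\<psi> by (intro continuous_intros) (auto intro: continuous_on_subset)
  have F: "(F has_real_derivative \<psi> s / 2) (at s)" if "-1 < s" for s
  proof -
    have "((\<lambda>s. integral {-1..s} (\<lambda>t. \<psi> t / 2)) has_real_derivative \<psi> s / 2) (at s within {-1..s+1})"
      using that by (intro integral_has_real_derivative c2) auto
    moreover have "at s within {-1..s+1} = at s"
      using that by (intro at_within_interior) auto
    ultimately show ?thesis unfolding F_def[abs_def] by simp
  qed
  have Fc: "F s = F (R\<^sup>2)" if "R\<^sup>2 \<le> s" for s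
  proof -
    have "integral {-1..R\<^sup>2} (\<lambda>t. \<psi> t / 2) + integral {R\<^sup>2..s} (\<lambda>t. \<psi> t / 2) = integral {-1..s} (\<lambda>t. \<psi> t / 2)"
      using that by (intro Henstock_Kurzweil_Integration.integral_combine integrable_continuous_interval c2) (auto intro: order_trans[of _ 0])
    moreover have "integral {R\<^sup>2..s} (\<lambda>t. \<psi> t / 2) = integral {R\<^sup>2..s} (\<lambda>t. 0)"
      by (rule integral_cong) (simp add: supp)
    ultimately show ?thesis by (simp add: F_def)
  qed
  define \<xi> where "\<xi> x = F (norm (x - a) ^ 2) - F (R\<^sup>2)" for x :: "real^'n"
  define g where "g x = \<psi> (norm (x - a) ^ 2) *\<^sub>R (x - a)" for x :: "real^'n"
  have der: "(\<xi> has_derivative (\<lambda>h. g x \<bullet> h)) (at x)" for x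
  proof -
    let ?s = "norm (x - a) ^ 2"
    have "-1 < ?s" by (rule less_le_trans[of _ 0]) auto
    then have "(F has_derivative (\<lambda>t. \<psi> ?s / 2 * t)) (at ?s)"
      using F[of ?s] unfolding has_field_derivative_def by blast
    moreover have "((\<lambda>x. norm (x - a) ^ 2) has_derivative (\<lambda>h. 2 * ((x - a) \<bullet> h))) (at x)"
      unfolding power2_norm_eq_inner
      by (auto intro!: derivative_eq_intros simp: inner_commute)
    ultimately have "((\<lambda>x. F (norm (x - a) ^ 2)) has_derivative (\<lambda>h. \<psi> ?s / 2 * (2 * ((x - a) \<bullet> h)))) (at x)"
      by (rule has_derivative_compose[rotated])
    then have "((\<lambda>x. F (norm (x - a) ^ 2) - F (R\<^sup>2)) has_derivative (\<lambda>h. \<psi> ?s / 2 * (2 * ((x - a) \<bullet> h)) - 0)) (at x)"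
      by (intro has_derivative_diff has_derivative_const)
    then show ?thesis by (simp add: \<xi>_def[abs_def] g_def)
  qed
  have \<psi>b: "\<bar>\<psi> s\<bar> \<le> K * R\<^sup>2" if "0 \<le> s" for s
  proof (cases "s \<le> R\<^sup>2")
    case True
    have "\<bar>\<psi> s - \<psi> (R\<^sup>2)\<bar> \<le> K * \<bar>s - R\<^sup>2\<bar>"
      using lipschitz_onD[OF lip, of s "R\<^sup>2"] by (simp add: dist_real_def)
    also have "\<dots> \<le> K * R\<^sup>2" using True that K by (intro mult_left_mono) auto
    finally show ?thesis using supp by simp
  next
    case False
    then show ?thesis using supp[of s] K by simp
  qed
  have le: "norm (\<psi> (norm u ^ 2) *\<^sub>R u - \<psi> (norm v ^ 2) *\<^sub>R v) \<le> (3 * K * R\<^sup>2) * norm (u - v)"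
    if uv: "norm u \<le> norm v" for u v :: "real^'n"
  proof (cases "R \<le> norm u")
    case True
    then have "\<psi> (norm u ^ 2) = 0" "\<psi> (norm v ^ 2) = 0"
      using uv R by (auto intro!: supp power_mono)
    then show ?thesis using K by simp
  next
    case False
    \<comment> \<open>Replacing the larger radius by its minimum with \<open>R\<close> leaves the
      value of \<open>\<psi>\<close> unchanged and bounds the sum of radii by 2R. This contributes 2
      K R^2, and the bound on \<open>\<psi>\<close> adds K R^2.\<close>
    define w where "w = min (norm v) R"
    have w: "norm u \<le> w" "w \<le> norm v" "w \<le> R" "0 \<le> w" using uv False R by (auto simp: w_def)
    have pw: "\<psi> (norm v ^ 2) = \<psi> (w ^ 2)"
      using R supp[of "norm v ^ 2"] supp[of "R\<^sup>2"] by (auto simp: w_def min_def)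
    have "\<bar>\<psi> (norm u ^ 2) - \<psi> (w ^ 2)\<bar> \<le> K * \<bar>norm u ^ 2 - w ^ 2\<bar>"
      using lipschitz_onD[OF lip, of "norm u ^ 2" "w ^ 2"] by (simp add: dist_real_def)
    also have "\<bar>norm u ^ 2 - w ^ 2\<bar> = (w + norm u) * (w - norm u)"
    proof -
      have "norm u ^ 2 \<le> w ^ 2" using w by (intro power_mono) auto
      then show ?thesis by (simp add: power2_eq_square algebra_simps)
    qed
    also have "K * \<dots> \<le> K * ((2 * R) * norm (u - v))"
    proof (intro mult_left_mono mult_mono)
      show "w - norm u \<le> norm (u - v)" using w norm_triangle_ineq2[of v u] by (simp add: norm_minus_commute)
    qed (use w K R in auto)
    finally have 1: "\<bar>\<psi> (norm u ^ 2) - \<psi> (norm v ^ 2)\<bar> \<le> 2 * K * R * norm (u - v)" by (simp add: pw)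
    have "\<psi> (norm u ^ 2) *\<^sub>R u - \<psi> (norm v ^ 2) *\<^sub>R v =
       (\<psi> (norm u ^ 2) - \<psi> (norm v ^ 2)) *\<^sub>R u + \<psi> (norm v ^ 2) *\<^sub>R (u - v)"
      by (simp add: algebra_simps)
    also have "norm \<dots> \<le> \<bar>\<psi> (norm u ^ 2) - \<psi> (norm v ^ 2)\<bar> * norm u + \<bar>\<psi> (norm v ^ 2)\<bar> * norm (u - v)"
      by (rule order_trans[OF norm_triangle_ineq]) simp
    also have "\<dots> \<le> (2 * K * R * norm (u - v)) * R + (K * R\<^sup>2) * norm (u - v)"
      using 1 False K R by (intro add_mono mult_mono \<psi>b) auto
    finally show ?thesis by (simp add: power2_eq_square algebra_simps)
  qed
  have lipg: "(3 * K * R\<^sup>2)-lipschitz_on UNIV g"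
  proof (rule lipschitz_onI)
    fix x y :: "real^'n"
    show "dist (g x) (g y) \<le> 3 * K * R\<^sup>2 * dist x y"
    proof (cases "norm (x - a) \<le> norm (y - a)")
      case True
      then show ?thesis using le[OF True] by (simp add: g_def dist_norm)
    next
      case False
      then have "norm (y - a) \<le> norm (x - a)" by simp
      from le[OF this] show ?thesis by (simp add: g_def dist_norm norm_minus_commute)
    qed
  qed (use K in simp)
  have "closure {x. \<xi> x \<noteq> 0} \<subseteq> cball a R"
  proof (rule closure_minimal)
    show "{x. \<xi> x \<noteq> 0} \<subseteq> cball a R"
    proof (clarify, rule ccontr)
      fix x assume "\<xi> x \<noteq> 0" "x \<notin> cball a R"
      then have "R \<le> norm (x - a)" by (simp add: dist_norm norm_minus_commute)
      then have "R\<^sup>2 \<le> norm (x - a) ^ 2" using R by (intro power_mono) auto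
      from Fc[OF this] \<open>\<xi> x \<noteq> 0\<close> show False by (simp only: \<xi>_def diff_self)
    qed
  qed simp
  then have "compact (closure {x. \<xi> x \<noteq> 0})"
    using bounded_cball bounded_subset compact_eq_bounded_closed by blast
  then have C: "\<xi> \<in> C11_c" unfolding C11_c_def using der lipg by blast
  have "laplacian \<xi> x = real CARD('n) * \<psi> (norm (x - a) ^ 2) + 2 * norm (x - a) ^ 2 * D"
    if D: "(\<psi> has_real_derivative D) (at (norm (x - a) ^ 2))" for x D
  proof -
    let ?z = "x - a"
    have pd: "partial_deriv i (partial_deriv i \<xi>) x = \<psi> (norm ?z ^ 2) + 2 * D * (?z $ i)\<^sup>2" for i
    proof -
      have nrm: "norm (x + t *\<^sub>R axis i 1 - a) ^ 2 = norm ?z ^ 2 + 2 * t * ?z $ i + t\<^sup>2" for t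
      proof -
        have "x + t *\<^sub>R axis i 1 - a = ?z + t *\<^sub>R axis i 1" by simp
        then show ?thesis by (simp only: norm_add_axis)
      qed
      have s: "((\<lambda>t. norm ?z ^ 2 + 2 * t * ?z $ i + t\<^sup>2) has_real_derivative 2 * ?z $ i) (at 0)"
        by (auto intro!: derivative_eq_intros)
      have "((\<lambda>t. \<psi> (norm ?z ^ 2 + 2 * t * ?z $ i + t\<^sup>2)) has_real_derivative D * (2 * ?z $ i)) (at 0)"
        by (rule DERIV_chain2[OF _ s]) (use D in simp)
      moreover have "((\<lambda>t. (x + t *\<^sub>R axis i 1 - a) $ i) has_real_derivative 1) (at 0)"
        by (auto intro!: derivative_eq_intros simp: axis_def)
      ultimately have "((\<lambda>t. \<psi> (norm ?z ^ 2 + 2 * t * ?z $ i + t\<^sup>2) * (x + t *\<^sub>R axis i 1 - a) $ i)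
          has_real_derivative \<psi> (norm ?z ^ 2) + 2 * D * (?z $ i)\<^sup>2) (at 0)"
        by (rule DERIV_cong[OF DERIV_mult]) (simp add: power2_eq_square algebra_simps)
      then have "((\<lambda>t. g (x + t *\<^sub>R axis i 1) $ i) has_real_derivative \<psi> (norm ?z ^ 2) + 2 * D * (?z $ i)\<^sup>2) (at 0)"
        unfolding g_def nrm by simp
      then show ?thesis
        unfolding partial_deriv_gradient[OF der] unfolding partial_deriv_def by (rule DERIV_imp_deriv)
    qed
    show ?thesis
      unfolding laplacian_def pd sum.distrib sum_distrib_left[symmetric] sum_component_squares by simp
  qed
  with C show ?thesis by blast
qed

section \<open>Weakly harmonic functions with vanishing averages\<close>

text \<open>Completeness gives measurability to \<open>laplacian \<xi>\<close>, which is known only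
  through an almost everywhere equal Borel function.\<close>

lemma borel_measurable_completion_cong_AE:
  fixes f g :: "'a \<Rightarrow> 'b::topological_space"
  assumes f: "f \<in> borel_measurable (completion M)" and eq: "AE x in completion M. g x = f x"
  shows "g \<in> borel_measurable (completion M)"
proof (rule borel_measurableI)
  fix S :: "'b set" assume S: "open S"
  let ?M = "completion M"
  obtain N where N: "N \<in> null_sets ?M" "{x \<in> space ?M. g x \<noteq> f x} \<subseteq> N"
    using eq unfolding eventually_ae_filter by blast
  have "g -` S \<inter> space ?M \<inter> N \<in> null_sets ?M"
    by (rule null_sets_completion_subset[OF _ N(1)]) (rule Int_lower2)
  moreover have "f -` S \<inter> space ?M - N \<in> sets ?M"
    using S N(1) by (intro sets.Diff measurable_sets[OF f]) (simp_all only: borel_open null_setsD2)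
  moreover have "g -` S \<inter> space ?M = (f -` S \<inter> space ?M - N) \<union> (g -` S \<inter> space ?M \<inter> N)"
  proof (rule set_eqI)
    fix x
    have "g x = f x" if "x \<in> space ?M" "x \<notin> N" using N(2) that by (simp add: subset_eq) metis
    then show "x \<in> g -` S \<inter> space ?M \<longleftrightarrow> x \<in> (f -` S \<inter> space ?M - N) \<union> (g -` S \<inter> space ?M \<inter> N)"
      by (cases "x \<in> space ?M"; cases "x \<in> N") simp_all
  qed
  ultimately show "g -` S \<inter> space ?M \<in> sets ?M" by (metis null_setsD2 sets.Un)
qed

lemma AE_not_on_sphere:
  fixes a :: "'a::euclidean_space"
  shows "AE x in lborel. norm (x - a) \<noteq> r"
proof -
  have "sphere a r \<in> null_sets lebesgue"
    using negligible_sphere[of a r] by (simp add: negligible_iff_null_sets)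
  then have "AE x in lebesgue. x \<notin> sphere a r" by (rule AE_not_in)
  then have "AE x in lborel. x \<notin> sphere a r" by (simp add: AE_completion_iff)
  then show ?thesis by eventually_elim (simp add: dist_norm norm_minus_commute)
qed

text \<open>The profile is chosen so that the Laplacian is constant in the ball and in the shell:
  \<open>s powr (- n / 2)\<close> at \<open>s = \<bar>x - a\<bar>\<^sup>2\<close> is the gradient factor of the Newtonian kernel.\<close>

lemma ball_test_function:
  fixes a :: "real^'n"
  assumes r: "0 < r" "r < R"
  defines "n \<equiv> real CARD('n)"
  shows "\<exists>\<xi>\<in>C11_c. AE x in lborel. laplacian \<xi> x =
    n * (R powr - n * indicator (cball a R) x - r powr - n * indicator (cball a r) x)"
proof -
  have n: "0 < n" by (simp add: n_def)
  define f where "f s = s powr (- n / 2)" for s :: real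
  have f2: "f (t\<^sup>2) = t powr - n" if "0 < t" for t
  proof -
    have "f (t\<^sup>2) = (t powr 2) powr (- n / 2)" using that by (simp add: f_def)
    also have "\<dots> = t powr (2 * (- n / 2))" by (simp only: powr_powr)
    also have "2 * (- n / 2) = - n" by simp
    finally show ?thesis .
  qed
  have fd: "(f has_real_derivative (- n / 2) * s powr (- n / 2 - 1)) (at s)" if "0 < s" for s
    unfolding f_def[abs_def] using that by (rule has_real_derivative_powr)
  \<comment> \<open>Constant below r^2, equal to R^(-n) - s^(-n/2) in the shell, zero beyond R^2. In
    n \<psi> + 2 s \<psi>' the powers of s cancel in the shell and n R^(-n) remains.\<close>
  define \<psi> where "\<psi> s = - max 0 (f (max s (r\<^sup>2)) - R powr - n)" for s
  define K where "K = (n / 2) * (r\<^sup>2) powr (- n / 2 - 1)"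
  have K: "0 \<le> K" using n by (simp add: K_def)
  have r2: "0 < r\<^sup>2" using r by simp
  have lf: "\<bar>f s - f t\<bar> \<le> K * \<bar>s - t\<bar>" if "r\<^sup>2 \<le> s" "r\<^sup>2 \<le> t" for s t
  proof -
    have "norm (f s - f t) \<le> K * norm (s - t)"
    proof (rule field_differentiable_bound[of "{r\<^sup>2..}" f "\<lambda>s. (- n / 2) * s powr (- n / 2 - 1)"])
      show "(f has_field_derivative (- n / 2) * z powr (- n / 2 - 1)) (at z within {r\<^sup>2..})" if "z \<in> {r\<^sup>2..}" for z
        by (rule has_field_derivative_at_within[OF fd[OF less_le_trans[OF r2]]]) (use that in simp)
      show "norm ((- n / 2) * z powr (- n / 2 - 1)) \<le> K" if "z \<in> {r\<^sup>2..}" for z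
      proof -
        have "z powr (- n / 2 - 1) \<le> (r\<^sup>2) powr (- n / 2 - 1)"
          using that r2 n by (intro powr_mono2') auto
        then show ?thesis using n by (simp add: K_def abs_mult)
      qed
    qed (use that in auto)
    then show ?thesis by simp
  qed
  have lip: "K-lipschitz_on UNIV \<psi>"
  proof (rule lipschitz_onI)
    fix s t :: real
    have "dist (\<psi> s) (\<psi> t) \<le> \<bar>f (max s (r\<^sup>2)) - f (max t (r\<^sup>2))\<bar>"
      unfolding \<psi>_def dist_real_def by linarith
    also have "\<dots> \<le> K * \<bar>max s (r\<^sup>2) - max t (r\<^sup>2)\<bar>" by (rule lf) auto
    also have "\<dots> \<le> K * dist s t"
      using K unfolding dist_real_def by (intro mult_left_mono) linarith+
    finally show "dist (\<psi> s) (\<psi> t) \<le> K * dist s t" .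
  qed (rule K)
  have rR: "r\<^sup>2 < R\<^sup>2" using r by (simp add: power_strict_mono)
  have fanti: "f t \<le> f s" if "0 < s" "s \<le> t" for s t
    unfolding f_def using that n by (intro powr_mono2') auto
  have fR: "f (R\<^sup>2) = R powr - n" using f2 r by simp
  have supp: "\<psi> s = 0" if "R\<^sup>2 \<le> s" for s
  proof -
    have "f s \<le> f (R\<^sup>2)" by (rule fanti) (use that rR r2 in linarith)+
    moreover have "max s (r\<^sup>2) = s" using that rR by simp
    ultimately show ?thesis using fR by (simp add: \<psi>_def)
  qed
  obtain \<xi> where \<xi>: "\<xi> \<in> C11_c" and lap: "\<And>x D. (\<psi> has_real_derivative D) (at (norm (x - a) ^ 2)) \<Longrightarrow>
     laplacian \<xi> x = real CARD('n) * \<psi> (norm (x - a) ^ 2) + 2 * norm (x - a) ^ 2 * D"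
    using radial_test_function[of R K \<psi> a] r lip supp by (auto simp: less_trans[OF r])
  have "AE x in lborel. laplacian \<xi> x = n * (R powr - n * indicator (cball a R) x - r powr - n * indicator (cball a r) x)"
    using AE_not_on_sphere[of a r] AE_not_on_sphere[of a R]
  proof eventually_elim
    case (elim x)
    let ?s = "norm (x - a) ^ 2"
    have ind: "indicator (cball a \<rho>) x = (if norm (x - a) \<le> \<rho> then 1 else 0 :: real)" for \<rho>
      by (simp add: indicator_def dist_norm norm_minus_commute)
    consider "norm (x - a) < r" | "r < norm (x - a)" "norm (x - a) < R" | "R < norm (x - a)"
      using elim by linarith
    then show ?case
    proof cases
      case 1
      have s: "?s < r\<^sup>2" using 1 by (simp add: power_strict_mono)
      have c: "\<psi> t = - (r powr - n - R powr - n)" if "t < r\<^sup>2" for t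
      proof -
        have "R powr - n \<le> r powr - n" using r n by (intro powr_mono2') auto
        then show ?thesis using that f2[OF r(1)] by (simp add: \<psi>_def)
      qed
      have "(\<psi> has_real_derivative 0) (at ?s)"
        by (rule has_field_derivative_transform_within_open[of "\<lambda>_. - (r powr - n - R powr - n)" 0 _ "{..<r\<^sup>2}"])
           (use s c in auto)
      from lap[OF this] show ?thesis using c[OF s] 1 r unfolding ind by (simp add: n_def algebra_simps)
    next
      case 2
      have s: "r\<^sup>2 < ?s" "?s < R\<^sup>2" using 2 r by (auto intro!: power_strict_mono)
      have c: "\<psi> t = - (f t - R powr - n)" if "t \<in> {r\<^sup>2<..<R\<^sup>2}" for t
        using that fanti[of t "R\<^sup>2"] fR r2 by (simp add: \<psi>_def)
      have s0: "0 < ?s" using s r2 by linarith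
      have "((\<lambda>t. - (f t - R powr - n)) has_real_derivative - ((- n / 2) * ?s powr (- n / 2 - 1) - 0)) (at ?s)"
        by (intro DERIV_minus DERIV_diff fd s0 DERIV_const)
      then have "(\<psi> has_real_derivative - ((- n / 2) * ?s powr (- n / 2 - 1) - 0)) (at ?s)"
        by (rule has_field_derivative_transform_within_open[of _ _ _ "{r\<^sup>2<..<R\<^sup>2}"]) (use s c in auto)
      from lap[OF this] have "laplacian \<xi> x = n * (- (f ?s - R powr - n)) + n * (?s * ?s powr (- n / 2 - 1))"
        using c[of ?s] s by (simp add: n_def)
      also have "?s * ?s powr (- n / 2 - 1) = f ?s"
        unfolding f_def powr_diff using s0 by simp
      finally show ?thesis using 2 unfolding ind by (simp add: algebra_simps)
    next
      case 3
      have s: "R\<^sup>2 < ?s" using 3 r by (auto intro!: power_strict_mono)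
      have "(\<psi> has_real_derivative 0) (at ?s)"
        by (rule has_field_derivative_transform_within_open[of "\<lambda>_. 0" 0 _ "{R\<^sup>2<..}"])
           (use s supp in auto)
      from lap[OF this] show ?thesis using supp[of ?s] s 3 r unfolding ind by simp
    qed
  qed
  with \<xi> show ?thesis by blast
qed

text \<open>By the Vitali covering theorem every open set is, up to a null set, a countable disjoint
  union of closed balls.\<close>

lemma measure_eqI_cballs:
  fixes P Q :: "'a::euclidean_space measure"
  assumes sPQ: "sets P = sets borel" "sets Q = sets borel"
    and ac: "\<And>A. A \<in> null_sets lborel \<Longrightarrow> A \<in> null_sets P \<and> A \<in> null_sets Q"
    and fin: "\<And>a r. emeasure P (cball a r) < \<infinity>"
    and ball: "\<And>a r. 0 < r \<Longrightarrow> emeasure P (cball a r) = emeasure Q (cball a r)"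
  shows "P = Q"
proof -
  have op: "emeasure P U = emeasure Q U" if U: "open U" for U
  proof -
    define K where "K = {(a, r). 0 < r \<and> cball a r \<subseteq> U}"
    have 1: "0 < snd i" if "i \<in> K" for i using that by (auto simp: K_def)
    have 2: "\<exists>i. i \<in> K \<and> x \<in> cball (fst i) (snd i) \<and> snd i < d" if x: "x \<in> U" and d: "0 < d" for x d
    proof -
      obtain e where e: "0 < e" "cball x e \<subseteq> U" using U x by (meson open_contains_cball)
      define r where "r = min e (d / 2)"
      have "0 < r" "r < d" "r \<le> e" using e d by (auto simp: r_def)
      moreover have "cball x r \<subseteq> U" using e \<open>r \<le> e\<close> subset_cball by blast
      ultimately show ?thesis by (intro exI[of _ "(x, r)"]) (auto simp: K_def)
    qed
    obtain C where C: "countable C" "C \<subseteq> K"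
      "pairwise (\<lambda>i j. disjnt (cball (fst i) (snd i)) (cball (fst j) (snd j))) C"
      "negligible (U - (\<Union>i\<in>C. cball (fst i) (snd i)))"
      using Vitali_covering_theorem_cballs[of K snd U fst] 1 2 by blast
    let ?B = "\<lambda>i. cball (fst i) (snd i)"
    have disj: "disjoint_family_on ?B C"
      using C(3) by (auto simp: pairwise_def disjoint_family_on_def disjnt_def)
    have "?B i \<subseteq> U" if "i \<in> K" for i using that by (cases i) (simp add: K_def)
    then have UB: "(\<Union>i\<in>C. ?B i) \<subseteq> U" using C(2) by blast
    have Bm: "(\<Union>i\<in>C. ?B i) \<in> sets borel" using C(1) by (intro sets.countable_UN') auto
    then have Dm: "U - (\<Union>i\<in>C. ?B i) \<in> sets borel" using U by auto
    then have null: "U - (\<Union>i\<in>C. ?B i) \<in> null_sets lborel"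
      using C(4) by (auto simp: negligible_iff_null_sets null_sets_def)
    have *: "emeasure M U = (\<integral>\<^sup>+i. emeasure M (?B i) \<partial>count_space C)"
      if sM: "sets M = sets borel" and nM: "U - (\<Union>i\<in>C. ?B i) \<in> null_sets M" for M
    proof -
      have "emeasure M U = emeasure M ((\<Union>i\<in>C. ?B i) \<union> (U - (\<Union>i\<in>C. ?B i)))"
        using UB by (intro arg_cong[where f = "emeasure M"]) auto
      also have "\<dots> = emeasure M (\<Union>i\<in>C. ?B i)"
        using Bm nM sM by (intro emeasure_Un_null_set) auto
      also have "\<dots> = (\<integral>\<^sup>+i. emeasure M (?B i) \<partial>count_space C)"
        using C(1) disj sM by (intro emeasure_UN_countable) auto
      finally show ?thesis .
    qed
    have "U - (\<Union>i\<in>C. ?B i) \<in> null_sets P" "U - (\<Union>i\<in>C. ?B i) \<in> null_sets Q"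
      using ac[OF null] by simp_all
    then have "emeasure P U = (\<integral>\<^sup>+i. emeasure P (?B i) \<partial>count_space C)"
      "emeasure Q U = (\<integral>\<^sup>+i. emeasure Q (?B i) \<partial>count_space C)"
      using sPQ by (auto intro!: *)
    moreover have "(\<integral>\<^sup>+i. emeasure P (?B i) \<partial>count_space C) = (\<integral>\<^sup>+i. emeasure Q (?B i) \<partial>count_space C)"
      using C(2) by (intro nn_integral_cong ball) (auto simp: K_def)
    ultimately show ?thesis by simp
  qed
  show "P = Q"
  proof (rule measure_eqI_generator_eq[where E = "{S. open S}" and \<Omega> = UNIV and A = "\<lambda>i::nat. ball 0 (real i)"])
    show "Int_stable {S::'a set. open S}" by (auto simp: Int_stable_def)
    show "sets P = sigma_sets UNIV {S. open S}" "sets Q = sigma_sets UNIV {S. open S}"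
      by (simp_all add: sPQ borel_def)
    show "(\<Union>i. ball (0::'a) (real i)) = UNIV"
      by (auto intro: reals_Archimedean2)
    show "emeasure P (ball 0 (real i)) \<noteq> \<infinity>" for i
    proof -
      have "emeasure P (ball 0 (real i)) \<le> emeasure P (cball 0 (real i))"
        by (intro emeasure_mono) (auto simp: sPQ)
      then show ?thesis using fin[of 0 "real i"] by (auto simp: top_unique)
    qed
  qed (auto simp: op)
qed

text \<open>The positive and negative parts of \<open>h\<close>, taken as densities, have equal mass
  on every ball, so the two measures coincide and so do their densities. As \<open>ennreal\<close>
  truncates at 0, agreement of the two parts forces h = 0.\<close>

lemma AE_zero_of_ball_integrals:
  fixes h :: "'a::euclidean_space \<Rightarrow> real"
  assumes [measurable]: "h \<in> borel_measurable borel"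
    and int: "\<And>a r. integrable lborel (\<lambda>x. h x * indicator (cball a r) x)"
    and zero: "\<And>a r. 0 < r \<Longrightarrow> (LINT x|lborel. h x * indicator (cball a r) x) = 0"
  shows "AE x in lborel. h x = 0"
proof -
  define P where "P = density lborel (\<lambda>x. ennreal (h x))"
  define Q where "Q = density lborel (\<lambda>x. ennreal (- h x))"
  have sPQ: "sets P = sets borel" "sets Q = sets borel" by (simp_all add: P_def Q_def)
  have fin: "emeasure P (cball a r) < \<infinity>" "emeasure Q (cball a r) < \<infinity>" for a r
  proof -
    have "(\<integral>\<^sup>+x. ennreal (norm (h x * indicator (cball a r) x)) \<partial>lborel) < \<infinity>"
      using int[of a r] by (simp add: integrable_iff_bounded)
    moreover have "(\<integral>\<^sup>+x. ennreal (h x) * indicator (cball a r) x \<partial>lborel) \<le> (\<integral>\<^sup>+x. ennreal (norm (h x * indicator (cball a r) x)) \<partial>lborel)"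
      "(\<integral>\<^sup>+x. ennreal (- h x) * indicator (cball a r) x \<partial>lborel) \<le> (\<integral>\<^sup>+x. ennreal (norm (h x * indicator (cball a r) x)) \<partial>lborel)"
      by (intro nn_integral_mono; auto simp: indicator_def intro!: ennreal_leI)+
    ultimately show "emeasure P (cball a r) < \<infinity>" "emeasure Q (cball a r) < \<infinity>"
      by (auto simp: P_def Q_def emeasure_density intro: le_less_trans)
  qed
  have ball: "emeasure P (cball a r) = emeasure Q (cball a r)" if "0 < r" for a r
  proof -
    let ?g = "\<lambda>x. h x * indicator (cball a r) x"
    have g: "integrable lborel ?g" by (rule int)
    have "enn2real (\<integral>\<^sup>+x. ennreal (?g x) \<partial>lborel) - enn2real (\<integral>\<^sup>+x. ennreal (- ?g x) \<partial>lborel) = 0"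
      using real_lebesgue_integral_def[OF g] zero[OF that, of a] by simp
    moreover have "(\<integral>\<^sup>+x. ennreal (?g x) \<partial>lborel) = emeasure P (cball a r)"
      unfolding P_def by (subst emeasure_density) (auto intro!: nn_integral_cong simp: indicator_def)
    moreover have "(\<integral>\<^sup>+x. ennreal (- ?g x) \<partial>lborel) = emeasure Q (cball a r)"
      unfolding Q_def by (subst emeasure_density) (auto intro!: nn_integral_cong simp: indicator_def)
    ultimately have "ennreal (enn2real (emeasure P (cball a r))) = ennreal (enn2real (emeasure Q (cball a r)))" by simp
    then show ?thesis
      using ennreal_enn2real[OF fin(1)[unfolded infinity_ennreal_def]]
        ennreal_enn2real[OF fin(2)[unfolded infinity_ennreal_def]] by (simp only:)
  qed
  have "P = Q"
  proof (rule measure_eqI_cballs[OF sPQ _ fin(1) ball])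
    fix A :: "'a set" assume A: "A \<in> null_sets lborel"
    have nd: "A \<in> null_sets (density lborel g)" if "g \<in> borel_measurable lborel" for g
    proof -
      have "AE x in lborel. x \<in> A \<longrightarrow> g x = 0" using AE_not_in[OF A] by eventually_elim blast
      then show ?thesis unfolding null_sets_density_iff[OF that] using A by auto
    qed
    show "A \<in> null_sets P \<and> A \<in> null_sets Q"
      unfolding P_def Q_def by (intro conjI nd) measurable
  qed
  then have "AE x in lborel. ennreal (h x) = ennreal (- h x)"
    unfolding P_def Q_def by (intro sigma_finite_measure.density_unique[OF sigma_finite_lborel]) auto
  then show ?thesis
  proof eventually_elim
    case (elim x)
    then show ?case by (cases "0 \<le> h x") (simp_all add: ennreal_neg ennreal_eq_0_iff)
  qed
qed

text \<open>Every ball average of a weakly harmonic function equals the average over any larger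
  concentric ball, hence vanishes if the averages over large balls tend to zero.\<close>

lemma weakly_harmonic_zero:
  fixes h :: "real^'n \<Rightarrow> real"
  assumes hm [measurable]: "h \<in> borel_measurable borel"
    and int: "\<And>a r. integrable lborel (\<lambda>x. h x * indicator (cball a r) x)"
    and harm: "\<And>\<xi>. \<xi> \<in> C11_c \<Longrightarrow> (LINT x|lebesgue. h x * laplacian \<xi> x) = 0"
    and decay: "\<And>a e. 0 < e \<Longrightarrow> \<exists>R0. \<forall>R\<ge>R0. (LINT x|lborel. \<bar>h x\<bar> * indicator (cball a R) x) \<le> e * R ^ CARD('n)"
  shows "AE x in lborel. h x = 0"
proof (rule AE_zero_of_ball_integrals[OF hm int])
  fix a :: "real^'n" and r :: real
  assume r: "0 < r"
  let ?n = "real CARD('n)"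
  let ?I = "\<lambda>r. LINT x|lborel. h x * indicator (cball a r) x"
  have mv: "R powr - ?n * ?I R = r powr - ?n * ?I r" if rR: "r < R" for R
  proof -
    obtain \<xi> where \<xi>: "\<xi> \<in> C11_c" and l: "AE x in lborel. laplacian \<xi> x =
      ?n * (R powr - ?n * indicator (cball a R) x - r powr - ?n * indicator (cball a r) x)"
      using ball_test_function[OF r rR, of a] by blast
    have "0 = (LINT x|lebesgue. h x * laplacian \<xi> x)" using harm[OF \<xi>] by simp
    also have "\<dots> = (LINT x|lebesgue. ?n * (R powr - ?n * (h x * indicator (cball a R) x) - r powr - ?n * (h x * indicator (cball a r) x)))"
    proof (rule integral_cong_AE)
      let ?f = "\<lambda>x. ?n * (R powr - ?n * (h x * indicator (cball a R) x) - r powr - ?n * (h x * indicator (cball a r) x))"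
      have "?f \<in> borel_measurable lborel" unfolding measurable_lborel1 by (intro borel_measurable_times borel_measurable_diff borel_measurable_indicator hm) auto
      then show m: "?f \<in> borel_measurable lebesgue" by (rule measurable_completion)
      show eq: "AE x in lebesgue. h x * laplacian \<xi> x = ?f x"
        using AE_completion[OF l] by eventually_elim (simp only: right_diff_distrib mult.left_commute mult.assoc)
      show "(\<lambda>x. h x * laplacian \<xi> x) \<in> borel_measurable lebesgue"
        by (rule borel_measurable_completion_cong_AE[OF m eq])
    qed
    also have "\<dots> = (LINT x|lborel. ?n * (R powr - ?n * (h x * indicator (cball a R) x) - r powr - ?n * (h x * indicator (cball a r) x)))"
      by (intro integral_completion borel_measurable_times borel_measurable_diff borel_measurable_indicator) (use hm in auto)
    also have "\<dots> = ?n * (R powr - ?n * ?I R - r powr - ?n * ?I r)"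
      using int by simp
    finally show ?thesis by simp
  qed
  have small: "\<bar>r powr - ?n * ?I r\<bar> \<le> e" if e: "0 < e" for e
  proof -
    obtain R0 where R0: "\<And>R. R0 \<le> R \<Longrightarrow> (LINT x|lborel. \<bar>h x\<bar> * indicator (cball a R) x) \<le> e * R ^ CARD('n)"
      using decay[OF e] by blast
    define R where "R = max R0 (r + 1)"
    have R: "R0 \<le> R" "r < R" "0 < R" using r by (auto simp: R_def)
    have "\<bar>?I R\<bar> \<le> (LINT x|lborel. \<bar>h x * indicator (cball a R) x\<bar>)" by (rule integral_abs_bound)
    also have "\<dots> = (LINT x|lborel. \<bar>h x\<bar> * indicator (cball a R) x)" by (simp add: abs_mult)
    also have "\<dots> \<le> e * R ^ CARD('n)" by (rule R0[OF R(1)])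
    also have "\<dots> = e * R powr ?n" using R by (simp add: powr_realpow)
    finally have "R powr - ?n * \<bar>?I R\<bar> \<le> R powr - ?n * (e * R powr ?n)" by (intro mult_left_mono) auto
    also have "\<dots> = e" using R by (simp add: powr_minus field_simps)
    finally have "\<bar>R powr - ?n * ?I R\<bar> \<le> e" by (simp add: abs_mult)
    then show ?thesis unfolding mv[OF R(2)] .
  qed
  have "\<bar>r powr - ?n * ?I r\<bar> \<le> 0" by (rule field_le_epsilon) (use small in simp)
  then show "?I r = 0" using r by simp
qed

section \<open>Solutions as fixed points of the potential equation\<close>

text \<open>Tonelli reduces this to the kernel bound that is uniform in the pole. Growth R^2 is of
  lower order than the ball volume R^N for N > 2, as the Liouville argument requires.\<close>

lemma newton_pot_ball_bound:
  assumes N: "2 < CARD('n::finite)"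
  shows "\<exists>C>0. \<forall>f \<in> borel_measurable borel. \<forall>R>0. \<forall>a :: real^'n.
    (\<integral>\<^sup>+x. newton_pot f x * indicator (cball a R) x \<partial>lborel) \<le> ennreal (C * R\<^sup>2) * (\<integral>\<^sup>+x. f x \<partial>lborel)"
proof -
  obtain C where C: "0 < C" "\<And>R a y. 0 < R \<Longrightarrow> 
    (\<integral>\<^sup>+x. ennreal (newton (x - y)) * indicator (cball a R) x \<partial>(lborel :: (real^'n) measure)) \<le> ennreal (C * R\<^sup>2)"
    using newton_ball_bound[OF N] by blast
  have "(\<integral>\<^sup>+x. newton_pot f x * indicator (cball a R) x \<partial>lborel) \<le> ennreal (C * R\<^sup>2) * (\<integral>\<^sup>+x. f x \<partial>lborel)"
    if fm [measurable]: "f \<in> borel_measurable borel" and R: "0 < R" for f R and a :: "real^'n"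
  proof -
    have "(\<integral>\<^sup>+x. newton_pot f x * indicator (cball a R) x \<partial>lborel) =
      (\<integral>\<^sup>+x. (\<integral>\<^sup>+y. ennreal (newton (x - y)) * f y * indicator (cball a R) x \<partial>lborel) \<partial>lborel)"
      unfolding newton_pot_def by (intro nn_integral_cong nn_integral_multc[symmetric]) measurable
    also have "\<dots> = (\<integral>\<^sup>+y. (\<integral>\<^sup>+x. ennreal (newton (x - y)) * f y * indicator (cball a R) x \<partial>lborel) \<partial>lborel)"
      by (rule lborel_pair.Fubini') measurable
    also have "\<dots> = (\<integral>\<^sup>+y. f y * (\<integral>\<^sup>+x. ennreal (newton (x - y)) * indicator (cball a R) x \<partial>lborel) \<partial>lborel)"
      by (intro nn_integral_cong) (subst nn_integral_cmult[symmetric]; measurable?; simp add: mult_ac)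
    also have "\<dots> \<le> (\<integral>\<^sup>+y. f y * ennreal (C * R\<^sup>2) \<partial>lborel)"
      by (intro nn_integral_mono mult_left_mono C R) simp
    also have "\<dots> = ennreal (C * R\<^sup>2) * (\<integral>\<^sup>+x. f x \<partial>lborel)"
      by (subst nn_integral_multc) (simp_all add: mult.commute)
    finally show ?thesis .
  qed
  then show ?thesis using C(1) by blast
qed

lemma newton_pot_finite_AE:
  assumes N: "2 < CARD('n::finite)" and fm [measurable]: "f \<in> borel_measurable borel"
    and fin: "(\<integral>\<^sup>+x. f x \<partial>lborel) < \<infinity>"
  shows "AE x :: real^'n in lborel. newton_pot f x < \<infinity>"
proof -
  obtain C where C: "\<And>R a. 0 < R \<Longrightarrow>
    (\<integral>\<^sup>+x. newton_pot f x * indicator (cball a R) x \<partial>lborel) \<le> ennreal (C * R\<^sup>2) * (\<integral>\<^sup>+x. f x \<partial>lborel)"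
    using newton_pot_ball_bound[OF N] fm by blast
  have "AE x in lborel. newton_pot f x * indicator (cball 0 (real (Suc m))) x \<noteq> \<infinity>" for m
  proof (rule nn_integral_PInf_AE)
    show "(\<integral>\<^sup>+x. newton_pot f x * indicator (cball 0 (real (Suc m))) x \<partial>lborel) \<noteq> \<infinity>"
      using C[of "real (Suc m)" 0] fin by (auto simp: top_unique ennreal_mult_eq_top_iff)
  qed measurable
  then have "AE x in lborel. \<forall>m. newton_pot f x * indicator (cball 0 (real (Suc m))) x \<noteq> \<infinity>"
    by (simp add: AE_all_countable)
  then show ?thesis
  proof eventually_elim
    case (elim x)
    obtain m where "norm x \<le> real (Suc m)" using real_arch_simple[of "norm x"] by (metis le_SucI of_nat_le_iff order_trans order_refl)
    with elim[rule_format, of m] show ?case by (simp add: less_top)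
  qed
qed

lemma newton_pot_integrable_ball:
  assumes N: "2 < CARD('n::finite)" and fm [measurable]: "f \<in> borel_measurable borel"
    and fin: "(\<integral>\<^sup>+x. f x \<partial>lborel) < \<infinity>"
  shows "integrable lborel (\<lambda>x :: real^'n. enn2real (newton_pot f x) * indicator (cball a R) x)"
proof (rule integrableI_bounded)
  obtain C where C: "\<And>R a. 0 < R \<Longrightarrow>
    (\<integral>\<^sup>+x. newton_pot f x * indicator (cball a R) x \<partial>lborel) \<le> ennreal (C * R\<^sup>2) * (\<integral>\<^sup>+x. f x \<partial>lborel)"
    using newton_pot_ball_bound[OF N] fm by blast
  have "(\<integral>\<^sup>+x. ennreal (norm (enn2real (newton_pot f x) * indicator (cball a R) x)) \<partial>lborel) \<le>
    (\<integral>\<^sup>+x. newton_pot f x * indicator (cball a (\<bar>R\<bar> + 1)) x \<partial>lborel)"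
  proof (rule nn_integral_mono)
    fix x
    have "ennreal (enn2real t) \<le> t" for t by (cases t) auto
    then show "ennreal (norm (enn2real (newton_pot f x) * indicator (cball a R) x)) \<le> newton_pot f x * indicator (cball a (\<bar>R\<bar> + 1)) x"
      by (auto simp: indicator_def)
  qed
  also have "\<dots> \<le> ennreal (C * (\<bar>R\<bar> + 1)\<^sup>2) * (\<integral>\<^sup>+x. f x \<partial>lborel)" by (rule C) simp
  also have "\<dots> < \<infinity>" using fin by (simp add: ennreal_mult_less_top)
  finally show "(\<integral>\<^sup>+x. ennreal (norm (enn2real (newton_pot f x) * indicator (cball a R) x)) \<partial>lborel) < \<infinity>" .
qed (intro borel_measurable_times borel_measurable_indicator; measurable)

text \<open>Fubini and the symmetry of the kernel move the potential from \<open>f\<close> to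
  \<open>l\<close>, whose potential is -\<xi>. With \<open>l\<close> standing for the Laplacian of
  \<xi>, this is the weak form of -\<Delta>(\<Gamma> * f) = f.\<close>

lemma newton_pot_duality:
  fixes f l \<xi> :: "real^'n \<Rightarrow> real"
  assumes N: "2 < CARD('n)" and f: "integrable lborel f" "\<And>x. 0 \<le> f x"
    and lm [measurable]: "l \<in> borel_measurable borel"
    and lM: "\<And>x. \<bar>l x\<bar> \<le> M" and lR: "\<And>x. R < norm x \<Longrightarrow> l x = 0"
    and rep: "\<And>x. (LINT y|lborel. newton (x - y) * l y) = - \<xi> x"
  shows "(LINT x|lborel. enn2real (newton_pot (\<lambda>y. ennreal (f y)) x) * l x) = - (LINT x|lborel. f x * \<xi> x)"
    and "integrable lborel (\<lambda>x. enn2real (newton_pot (\<lambda>y. ennreal (f y)) x) * l x)"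
proof -
  have fm [measurable]: "f \<in> borel_measurable borel" using f(1) by (simp add: integrable_iff_bounded)
  let ?P = "newton_pot (\<lambda>y. ennreal (f y))"
  have fin: "(\<integral>\<^sup>+x. ennreal (f x) \<partial>lborel) < \<infinity>"
    using f by (simp add: integrable_iff_bounded)
  have fm': "(\<lambda>y. ennreal (f y)) \<in> borel_measurable borel" by measurable
  have M: "0 \<le> M" using lM[of 0] by simp
  define F where "F x y = newton (x - y) * f y * l x" for x y
  have P: "(LINT y|lborel. newton (x - y) * f y) = enn2real (?P x)" for x
    unfolding newton_pot_def
    using newton_nonneg[OF N] f(2)
    by (subst integral_eq_nn_integral) (auto simp: ennreal_mult' intro!: AE_I2)
  have Fm: "case_prod F \<in> borel_measurable (lborel \<Otimes>\<^sub>M lborel)"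
    unfolding F_def by measurable
  have "integrable (lborel \<Otimes>\<^sub>M lborel) (case_prod F)"
  proof (rule integrableI_bounded[OF Fm])
    obtain C where C: "\<And>R a. 0 < R \<Longrightarrow>
      (\<integral>\<^sup>+x. ?P x * indicator (cball a R) x \<partial>lborel) \<le> ennreal (C * R\<^sup>2) * (\<integral>\<^sup>+x. ennreal (f x) \<partial>lborel)"
      using newton_pot_ball_bound[OF N] fm' by blast
    have "(\<integral>\<^sup>+z. ennreal (norm (case_prod F z)) \<partial>(lborel \<Otimes>\<^sub>M lborel)) =
      (\<integral>\<^sup>+x. (\<integral>\<^sup>+y. ennreal (norm (F x y)) \<partial>lborel) \<partial>lborel)"
      using Fm by (subst lborel.nn_integral_fst[symmetric]) auto
    also have "\<dots> \<le> (\<integral>\<^sup>+x. ennreal M * (?P x * indicator (cball 0 (\<bar>R\<bar> + 1)) x) \<partial>lborel)"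
    proof (rule nn_integral_mono)
      fix x :: "real^'n"
      have "(\<integral>\<^sup>+y. ennreal (norm (F x y)) \<partial>lborel) = (\<integral>\<^sup>+y. ennreal \<bar>l x\<bar> * (ennreal (newton (x - y)) * ennreal (f y)) \<partial>lborel)"
        using newton_nonneg[OF N] f(2)
        by (intro nn_integral_cong) (auto simp: F_def abs_mult ennreal_mult'[symmetric] mult_ac)
      also have "\<dots> = ennreal \<bar>l x\<bar> * ?P x"
        unfolding newton_pot_def by (rule nn_integral_cmult) measurable
      also have "\<dots> \<le> ennreal M * (?P x * indicator (cball 0 (\<bar>R\<bar> + 1)) x)"
      proof (cases "norm x \<le> \<bar>R\<bar> + 1")
        case True
        then show ?thesis using lM[of x] by (simp add: mult_right_mono ennreal_leI)
      next
        case False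
        then show ?thesis using lR[of x] by simp
      qed
      finally show "(\<integral>\<^sup>+y. ennreal (norm (F x y)) \<partial>lborel) \<le> ennreal M * (?P x * indicator (cball 0 (\<bar>R\<bar> + 1)) x)" .
    qed
    also have "\<dots> = ennreal M * (\<integral>\<^sup>+x. ?P x * indicator (cball 0 (\<bar>R\<bar> + 1)) x \<partial>lborel)"
      by (rule nn_integral_cmult) measurable
    also have "\<dots> \<le> ennreal M * (ennreal (C * (\<bar>R\<bar> + 1)\<^sup>2) * (\<integral>\<^sup>+x. ennreal (f x) \<partial>lborel))"
      by (intro mult_left_mono C) auto
    also have "\<dots> < \<infinity>" using fin by (simp add: ennreal_mult_less_top)
    finally show "(\<integral>\<^sup>+z. ennreal (norm (case_prod F z)) \<partial>(lborel \<Otimes>\<^sub>M lborel)) < \<infinity>" .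
  qed
  note Fi = this
  have fst: "(LINT y|lborel. F x y) = enn2real (?P x) * l x" for x
    unfolding F_def by (simp add: P)
  have snd: "(LINT x|lborel. F x y) = - (f y * \<xi> y)" for y
  proof -
    have "(LINT x|lborel. F x y) = (LINT x|lborel. f y * (newton (y - x) * l x))"
      unfolding F_def by (intro Bochner_Integration.integral_cong) (auto simp: mult_ac newton_minus[of "_ - _", simplified])
    also have "\<dots> = f y * (LINT x|lborel. newton (y - x) * l x)" by simp
    finally show ?thesis by (simp add: rep)
  qed
  have "(LINT x|lborel. (LINT y|lborel. F x y)) = (LINT y|lborel. (LINT x|lborel. F x y))"
    by (rule lborel_pair.Fubini_integral[OF Fi, symmetric])
  then show "(LINT x|lborel. enn2real (?P x) * l x) = - (LINT x|lborel. f x * \<xi> x)"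
    unfolding fst snd by simp
  show "integrable lborel (\<lambda>x. enn2real (?P x) * l x)"
    using lborel_pair.integrable_fst'[OF Fi] unfolding fst[symmetric] by simp
qed

section \<open>Almost everywhere reformulations of the solution concept\<close>

text \<open>The right-hand side is stable under passing to smaller nonnegative functions and under
  changes on null sets; decay is used in this form from here on.\<close>

lemma esssup_decay_iff:
  fixes u :: "'a::euclidean_space \<Rightarrow> real"
  assumes um: "u \<in> borel_measurable lebesgue" and nn: "AE x in lebesgue. 0 \<le> u x"
  shows "((\<lambda>r. esssup (restrict_space lebesgue (- ball 0 r)) (\<lambda>x. ereal (u x))) \<longlongrightarrow> 0) at_top \<longleftrightarrow>
    (\<forall>e>0. \<exists>r. AE x in lebesgue. r \<le> norm x \<longrightarrow> u x \<le> e)" (is "(?E \<longlongrightarrow> 0) at_top \<longleftrightarrow> ?R")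
proof -
  have ms: "- ball 0 r \<inter> space lebesgue \<in> sets lebesgue" for r :: real
    by (simp add: borel_open sets.compl_sets[of _ borel, simplified] Compl_eq_Diff_UNIV)
  have AEr: "(AE x in restrict_space lebesgue (- ball 0 r). P x) \<longleftrightarrow> (AE x in lebesgue. r \<le> norm x \<longrightarrow> P x)" for P and r :: real
    by (subst AE_restrict_space_iff[OF ms]) (simp add: not_less)
  have mu: "(\<lambda>x. ereal (u x)) \<in> borel_measurable (restrict_space lebesgue (- ball 0 r))" for r
    using um by (intro measurable_restrict_space1) auto
  \<comment> \<open>An essential supremum over a null space could be negative; here the exterior of
    a ball has infinite measure.\<close>
  have pos: "0 \<le> ?E r" for r
  proof (rule ccontr)
    assume "\<not> 0 \<le> ?E r"
    then have "?E r < 0" by simp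
    have "AE x in restrict_space lebesgue (- ball 0 r). ereal (u x) < 0"
      using esssup_AE[where M = "restrict_space lebesgue (- ball 0 r)" and f = "\<lambda>x. ereal (u x)"]
      by eventually_elim (rule le_less_trans[OF _ \<open>?E r < 0\<close>])
    then have "AE x in lebesgue. r \<le> norm x \<longrightarrow> u x < 0"
      unfolding AEr by simp
    with nn have "AE x in lebesgue. x \<in> ball (0::'a) r"
      by eventually_elim auto
    then have "emeasure lebesgue (- ball (0::'a) r) = 0"
      using ms[of r] by (subst (asm) AE_iff_measurable[where N = "- ball (0::'a) r"]) auto
    then have "emeasure lborel (- ball (0::'a) r) = 0"
      by (subst (asm) emeasure_completion) (auto simp: borel_closed)
    moreover have "emeasure lborel (UNIV :: 'a set) \<le> emeasure lborel (ball (0::'a) r) + emeasure lborel (- ball (0::'a) r)"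
    proof -
      have "(UNIV :: 'a set) = ball 0 r \<union> - ball 0 r" by auto
      then show ?thesis using emeasure_subadditive[of "ball (0::'a) r" lborel "- ball (0::'a) r"] by (simp add: borel_closed)
    qed
    ultimately show False using emeasure_lborel_ball_finite[of "0::'a" r] by (simp add: top_unique)
  qed
  show ?thesis
  proof
    assume L: "(?E \<longlongrightarrow> 0) at_top"
    show ?R
    proof (intro allI impI)
      fix e :: real assume "0 < e"
      then have "eventually (\<lambda>r. ?E r < ereal e) at_top" using L by (intro order_tendstoD) auto
      then obtain r where r: "?E r < ereal e" by (auto simp: eventually_at_top_linorder)
      have "AE x in restrict_space lebesgue (- ball 0 r). u x \<le> e"
        using esssup_AE[where M = "restrict_space lebesgue (- ball 0 r)" and f = "\<lambda>x. ereal (u x)"]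
      proof eventually_elim
        case (elim x)
        then have "ereal (u x) < ereal e" using r by (rule le_less_trans)
        then show ?case by simp
      qed
      then show "\<exists>r. AE x in lebesgue. r \<le> norm x \<longrightarrow> u x \<le> e" unfolding AEr by blast
    qed
  next
    assume R: ?R
    show "(?E \<longlongrightarrow> 0) at_top"
    proof (rule order_tendstoI)
      fix a :: ereal assume "a < 0"
      then show "eventually (\<lambda>r. a < ?E r) at_top"
        using pos by (intro always_eventually allI) (rule less_le_trans)
    next
      fix a :: ereal assume "0 < a"
      then obtain e where e: "0 < ereal e" "ereal e < a" using ereal_dense2 by blast
      then obtain r0 where r0: "AE x in lebesgue. r0 \<le> norm x \<longrightarrow> u x \<le> e" using R by auto
      have "?E r \<le> ereal e" if "r0 \<le> r" for r
      proof (rule esssup_I[OF mu])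
        show "AE x in restrict_space lebesgue (- ball 0 r). ereal (u x) \<le> ereal e"
          unfolding AEr using r0 by eventually_elim (use that in auto)
      qed
      then show "eventually (\<lambda>r. ?E r < a) at_top"
        using e(2) unfolding eventually_at_top_linorder by (meson le_less_trans)
    qed
  qed
qed

lemma L1_loc_measurable:
  assumes "u \<in> (L1_loc :: (real^'n \<Rightarrow> real) set)"
  shows "u \<in> borel_measurable lebesgue"
proof (rule borel_measurable_LIMSEQ_real)
  show "(\<lambda>x. indicator (cball 0 (real m)) x *\<^sub>R u x) \<in> borel_measurable lebesgue" for m
  proof -
    have "set_integrable lebesgue (cball 0 (real m)) u" using assms unfolding L1_loc_def by simp
    then show ?thesis unfolding set_integrable_def by (rule borel_measurable_integrable)
  qed
  show "(\<lambda>m. indicator (cball 0 (real m)) x *\<^sub>R u x) \<longlonglongrightarrow> u x" for x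
  proof (rule tendsto_eventually)
    obtain m0 where "norm x \<le> real m0" using real_arch_simple by blast
    then show "eventually (\<lambda>m. indicator (cball 0 (real m)) x *\<^sub>R u x = u x) sequentially"
      unfolding eventually_sequentially by (intro exI[of _ m0]) (auto simp: indicator_def)
  qed
qed

lemma borel_nonneg_representative:
  fixes u :: "'a::euclidean_space \<Rightarrow> real"
  assumes "u \<in> borel_measurable lebesgue" and "AE x in lebesgue. 0 \<le> u x"
  shows "\<exists>v\<in>borel_measurable borel. (\<forall>x. 0 \<le> v x) \<and> (AE x in lebesgue. u x = v x)"
proof -
  obtain w where w: "w \<in> borel_measurable lborel" "AE x in lborel. u x = w x"
    using completion_ex_borel_measurable_real[OF assms(1)] by blast
  have "(\<lambda>x. max 0 (w x)) \<in> borel_measurable borel" using w(1) by simp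
  moreover have "AE x in lebesgue. u x = max 0 (w x)"
    using AE_completion[OF w(2)] assms(2) by eventually_elim simp
  ultimately show ?thesis by (intro bexI[of _ "\<lambda>x. max 0 (w x)"]) auto
qed

lemma laplacian_measurable:
  assumes "\<xi> \<in> (C11_c :: (real^'n \<Rightarrow> real) set)"
  shows "laplacian \<xi> \<in> borel_measurable lebesgue"
proof -
  obtain l where l: "l \<in> borel_measurable borel" "AE x in lborel. laplacian \<xi> x = l x"
    using C11_c_laplacian[OF assms] by blast
  have "l \<in> borel_measurable lebesgue" using l(1) by (intro measurable_completion) simp
  then show ?thesis by (rule borel_measurable_completion_cong_AE) (rule AE_completion[OF l(2)])
qed

lemma C11_c_measurable:
  assumes "\<xi> \<in> (C11_c :: (real^'n \<Rightarrow> real) set)"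
  shows "\<xi> \<in> borel_measurable lebesgue"
proof -
  have "continuous_on UNIV \<xi>" using C11_c_laplacian[OF assms] by blast
  then have "\<xi> \<in> borel_measurable lborel" by (simp add: borel_measurable_continuous_onI)
  then show ?thesis by (rule measurable_completion)
qed

text \<open>This permits replacing a solution by a nonnegative Borel representative, and a potential
  by one with a prescribed value at the origin.\<close>

lemma is_solution_cong:
  fixes V W u v :: "real^'n \<Rightarrow> real"
  assumes sol: "is_solution p V k u"
    and VW: "AE x in lebesgue. V x = W x" and uv: "AE x in lebesgue. u x = v x"
  shows "is_solution p W k v"
proof -
  note S = sol[unfolded is_solution_def]
  have um: "u \<in> borel_measurable lebesgue" using S L1_loc_measurable by blast
  have vm: "v \<in> borel_measurable lebesgue"
    using uv by (intro borel_measurable_completion_cong_AE[OF um]) (auto elim: eventually_mono)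
  have f: "AE x in lebesgue. V x * u x powr p = W x * v x powr p"
    using VW uv by eventually_elim simp
  have fi: "integrable lebesgue (\<lambda>x. V x * u x powr p)" using S by blast
  have fm: "(\<lambda>x. W x * v x powr p) \<in> borel_measurable lebesgue"
    using f by (intro borel_measurable_completion_cong_AE[OF borel_measurable_integrable[OF fi]]) (auto elim: eventually_mono)
  have gi: "integrable lebesgue (\<lambda>x. W x * v x powr p)"
    by (rule integrable_cong_AE_imp[OF fi fm]) (use f in \<open>auto elim: eventually_mono\<close>)
  have nn: "AE x in lebesgue. 0 \<le> u x" using S by blast
  have nnv: "AE x in lebesgue. 0 \<le> v x" using nn uv by eventually_elim simp
  have "v \<in> L1_loc"
  proof (unfold L1_loc_def, intro CollectI allI impI)
    fix K :: "(real^'n) set" assume K: "compact K"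
    then have i: "integrable lebesgue (\<lambda>x. indicator K x *\<^sub>R u x)"
      using S unfolding L1_loc_def set_integrable_def by blast
    have eq: "AE x in lebesgue. indicator K x *\<^sub>R u x = indicator K x *\<^sub>R v x"
      using uv by eventually_elim simp
    have "(\<lambda>x. indicator K x *\<^sub>R v x) \<in> borel_measurable lebesgue"
      using eq by (intro borel_measurable_completion_cong_AE[OF borel_measurable_integrable[OF i]]) (auto elim: eventually_mono)
    then show "set_integrable lebesgue K v"
      unfolding set_integrable_def by (rule integrable_cong_AE_imp[OF i]) (use eq in \<open>auto elim: eventually_mono\<close>)
  qed
  moreover have "((\<lambda>r. esssup (restrict_space lebesgue (- ball 0 r)) (\<lambda>x. ereal (v x))) \<longlongrightarrow> 0) at_top"
  proof (subst esssup_decay_iff[OF vm nnv], intro allI impI)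
    fix e :: real assume "0 < e"
    moreover have "\<forall>e>0. \<exists>r. AE x in lebesgue. r \<le> norm x \<longrightarrow> u x \<le> e"
      using S esssup_decay_iff[OF um nn] by blast
    ultimately obtain r where "AE x in lebesgue. r \<le> norm x \<longrightarrow> u x \<le> e" by blast
    then have "AE x in lebesgue. r \<le> norm x \<longrightarrow> v x \<le> e" using uv by eventually_elim simp
    then show "\<exists>r. AE x in lebesgue. r \<le> norm x \<longrightarrow> v x \<le> e" by blast
  qed
  moreover have "(LINT x|lebesgue. v x * (- laplacian \<xi> x)) = (LINT x|lebesgue. W x * v x powr p * \<xi> x) + k * \<xi> 0"
    if \<xi>: "\<xi> \<in> C11_c" for \<xi>
  proof -
    have "(LINT x|lebesgue. v x * (- laplacian \<xi> x)) = (LINT x|lebesgue. u x * (- laplacian \<xi> x))"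
      using uv by (intro integral_cong_AE borel_measurable_times borel_measurable_uminus um vm laplacian_measurable[OF \<xi>])
        (auto elim: eventually_mono)
    moreover have "(LINT x|lebesgue. W x * v x powr p * \<xi> x) = (LINT x|lebesgue. V x * u x powr p * \<xi> x)"
      using f by (intro integral_cong_AE borel_measurable_times[OF fm] borel_measurable_times[OF borel_measurable_integrable[OF fi]]
          C11_c_measurable[OF \<xi>]) (auto elim: eventually_mono)
    ultimately show ?thesis using S \<xi> by simp
  qed
  ultimately show ?thesis unfolding is_solution_def using nnv gi by blast
qed

lemma is_positive_solution_cong:
  fixes V W u v :: "real^'n \<Rightarrow> real"
  assumes "is_positive_solution p V k u"
    and "AE x in lebesgue. V x = W x" and uv: "AE x in lebesgue. u x = v x"
  shows "is_positive_solution p W k v"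
proof -
  have "AE x in lebesgue. 0 < u x" using assms(1) unfolding is_positive_solution_def by blast
  then have "AE x in lebesgue. 0 < v x" using uv by eventually_elim simp
  then show ?thesis using assms is_solution_cong unfolding is_positive_solution_def by blast
qed

lemma is_minimal_solution_cong:
  fixes V W u :: "real^'n \<Rightarrow> real"
  assumes m: "is_minimal_solution p V k u" and VW: "AE x in lebesgue. V x = W x"
  shows "is_minimal_solution p W k u"
proof -
  have WV: "AE x in lebesgue. W x = V x" using VW by eventually_elim simp
  show ?thesis
    using m is_positive_solution_cong[OF _ VW, of p k u u] is_positive_solution_cong[OF _ WV, of p k]
    unfolding is_minimal_solution_def by (metis (mono_tags, lifting) AE_I2)
qed

section \<open>Equivalence of weak solutions and fixed points\<close>

text \<open>Beyond some radius w is at most e divided by the volume of the unit ball, which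
  contributes at most e R^N. The remaining mass is a constant independent of \<open>a\<close> and
  \<open>R\<close>.\<close>

lemma ball_integral_growth:
  fixes w :: "'a::euclidean_space \<Rightarrow> real"
  assumes [measurable]: "w \<in> borel_measurable borel" and w: "\<And>x. 0 \<le> w x"
    and int: "\<And>a R. integrable lborel (\<lambda>x. w x * indicator (cball a R) x)"
    and dec: "\<And>e. 0 < e \<Longrightarrow> \<exists>r. AE x in lborel. r \<le> norm x \<longrightarrow> w x \<le> e" and e: "0 < e"
  shows "\<exists>A\<ge>0. \<forall>R>0. \<forall>a. (LINT x|lborel. w x * indicator (cball a R) x) \<le> A + e * R ^ DIM('a)"
proof -
  define v where "v = unit_ball_vol (real DIM('a))"
  have v: "0 < v" by (simp add: v_def)
  obtain r where r: "AE x in lborel. r \<le> norm x \<longrightarrow> w x \<le> e / v" using dec[of "e / v"] e v by auto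
  let ?A = "LINT x|lborel. w x * indicator (cball 0 r) x"
  have A: "0 \<le> ?A" using w by (intro integral_nonneg_AE AE_I2) auto
  have "(LINT x|lborel. w x * indicator (cball a R) x) \<le> ?A + e * R ^ DIM('a)" if R: "0 < R" for R a
  proof -
    have ii: "integrable lborel (\<lambda>x. e / v * indicator (cball a R) x)"
      by (intro integrable_mult_right integrable_real_indicator) (auto simp: emeasure_lborel_cball_finite[unfolded infinity_ennreal_def])
    have "(LINT x|lborel. w x * indicator (cball a R) x) \<le>
       (LINT x|lborel. w x * indicator (cball 0 r) x + e / v * indicator (cball a R) x)"
    proof (rule integral_mono_AE)
      show "AE x in lborel. w x * indicator (cball a R) x \<le> w x * indicator (cball 0 r) x + e / v * indicator (cball a R) x"
        using r
      proof eventually_elim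
        case (elim x)
        show ?case
        proof (cases "norm x \<le> r")
          case True
          then show ?thesis using e v w[of x] by (simp add: indicator_def)
        next
          case False
          then show ?thesis using elim w[of x] by (auto simp: indicator_def)
        qed
      qed
    qed (use int ii in auto)
    also have "\<dots> = ?A + (LINT x|lborel. e / v * indicator (cball a R) x)"
      using int ii by (intro Bochner_Integration.integral_add)
    also have "(LINT x|lborel. e / v * indicator (cball a R) x) = e / v * measure lborel (cball a R)"
      by (simp add: emeasure_lborel_cball_finite[unfolded infinity_ennreal_def])
    also have "measure lborel (cball a R) = v * R ^ DIM('a)"
      using R by (simp add: measure_def emeasure_cball v_def)
    finally show ?thesis using v by simp
  qed
  then show ?thesis using A by blast
qed

lemma integrable_mult_bounded_support:
  fixes g l :: "'a::euclidean_space \<Rightarrow> real"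
  assumes gi: "integrable lborel (\<lambda>x. g x * indicator (cball 0 R) x)"
    and [measurable]: "g \<in> borel_measurable borel" "l \<in> borel_measurable borel"
    and lM: "\<And>x. \<bar>l x\<bar> \<le> M" and lR: "\<And>x. R < norm x \<Longrightarrow> l x = 0"
  shows "integrable lborel (\<lambda>x. g x * l x)"
proof (rule Bochner_Integration.integrable_bound[OF integrable_mult_right[OF gi, of M]])
  have "norm (g x * l x) \<le> norm (M * (g x * indicator (cball 0 R) x))" for x
  proof (cases "norm x \<le> R")
    case True
    have "\<bar>l x\<bar> \<le> \<bar>M\<bar>" using lM[of x] by linarith
    from mult_right_mono[OF this abs_ge_zero[of "g x"]] show ?thesis
      using True by (simp add: abs_mult mult.commute[of "\<bar>g x\<bar>"])
  next
    case False
    then show ?thesis using lR[of x] by simp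
  qed
  then show "AE x in lborel. norm (g x * l x) \<le> norm (M * (g x * indicator (cball 0 R) x))" by simp
qed measurable

lemma solution_representation:
  fixes W v :: "real^'n \<Rightarrow> real"
  assumes N: "2 < CARD('n)" and k: "0 < k"
    and [measurable]: "W \<in> borel_measurable borel" "v \<in> borel_measurable borel"
    and W: "\<And>x. 0 \<le> W x" and v: "\<And>x. 0 \<le> v x"
    and sol: "is_solution p W k v"
  shows "AE x in lborel. ennreal (k * newton x) + newton_pot (\<lambda>y. ennreal (W y * v y powr p)) x = ennreal (v x)"
proof -
  note S = sol[unfolded is_solution_def]
  define f where "f x = W x * v x powr p" for x
  have f0: "0 \<le> f x" for x using W by (simp add: f_def)
  have fm [measurable]: "f \<in> borel_measurable borel" unfolding f_def by measurable
  have fi: "integrable lborel f"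
    using S fm by (simp add: f_def[abs_def] integrable_completion)
  have fin: "(\<integral>\<^sup>+x. ennreal (f x) \<partial>lborel) < \<infinity>"
    using fi f0 by (simp add: integrable_iff_bounded)
  have fm': "(\<lambda>x. ennreal (f x)) \<in> borel_measurable borel" by measurable
  define P where "P x = enn2real (newton_pot (\<lambda>y. ennreal (f y)) x)" for x
  have Pm [measurable]: "P \<in> borel_measurable borel" unfolding P_def by measurable
  have P0: "0 \<le> P x" for x by (simp add: P_def)
  have vi: "integrable lborel (\<lambda>x. v x * indicator (cball a R) x)" for a R
  proof -
    have "integrable lebesgue (\<lambda>x. indicator (cball a R) x *\<^sub>R v x)"
      using S unfolding L1_loc_def set_integrable_def by simp
    then show ?thesis by (subst (asm) integrable_completion) (auto simp: mult.commute intro!: borel_measurable_times borel_measurable_indicator)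
  qed
  have Pi: "integrable lborel (\<lambda>x. P x * indicator (cball a R) x)" for a R
    unfolding P_def by (rule newton_pot_integrable_ball[OF N fm' fin])
  have Ni: "integrable lborel (\<lambda>x :: real^'n. newton x * indicator (cball a R) x)" for a R
    using newton_integrable_ball[OF N, of 0 a R] by (simp add: newton_minus)
  define h where "h x = v x - k * newton x - P x" for x
  have hm: "h \<in> borel_measurable borel" unfolding h_def by measurable
  have hi: "integrable lborel (\<lambda>x. h x * indicator (cball a R) x)" for a R
    unfolding h_def left_diff_distrib mult.assoc using vi Pi Ni by (intro Bochner_Integration.integrable_diff integrable_mult_right)
  have "AE x in lborel. h x = 0"
  proof (rule weakly_harmonic_zero[OF hm hi])
    fix \<xi> :: "real^'n \<Rightarrow> real" assume \<xi>: "\<xi> \<in> C11_c"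
    obtain l M R where lm [measurable]: "l \<in> borel_measurable borel" and lM: "\<And>x. \<bar>l x\<bar> \<le> M"
      and lR: "\<And>x. R < norm x \<Longrightarrow> l x = 0"
      and ll: "AE x in lborel. laplacian \<xi> x = l x" and c\<xi>: "continuous_on UNIV \<xi>"
      and rep: "\<And>x. (LINT y|lborel. newton (x - y) * l y) = - \<xi> x"
      using newton_representation[OF N \<xi>] by (elim exE conjE, intro that) blast+
    have \<xi>m [measurable]: "\<xi> \<in> borel_measurable borel" using c\<xi> by (rule borel_measurable_continuous_onI)
    have d2: "integrable lborel (\<lambda>x. v x * l x)" by (rule integrable_mult_bounded_support[OF vi _ _ lM lR]) auto
    have d3: "integrable lborel (\<lambda>x. newton x * l x)" by (rule integrable_mult_bounded_support[OF Ni _ _ lM lR]) auto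
    have d4: "(LINT x|lborel. P x * l x) = - (LINT x|lborel. f x * \<xi> x)" "integrable lborel (\<lambda>x. P x * l x)"
      unfolding P_def by (rule newton_pot_duality[OF N fi f0 lm lM lR rep]; simp)+
    have lb: "(LINT x|lebesgue. g x * laplacian \<xi> x) = (LINT x|lborel. g x * l x)"
      if gm: "g \<in> borel_measurable borel" for g
    proof -
      have gm': "g \<in> borel_measurable lebesgue" "l \<in> borel_measurable lebesgue"
        using gm lm by (auto intro!: measurable_completion)
      have "(LINT x|lebesgue. g x * laplacian \<xi> x) = (LINT x|lebesgue. g x * l x)"
        by (intro integral_cong_AE borel_measurable_times gm' laplacian_measurable[OF \<xi>])
          (use AE_completion[OF ll] in \<open>auto elim: eventually_mono\<close>)
      also have "\<dots> = (LINT x|lborel. g x * l x)"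
        by (rule integral_completion) (use gm lm in simp)
      finally show ?thesis .
    qed
    have w: "(LINT x|lborel. v x * l x) = - ((LINT x|lborel. f x * \<xi> x) + k * \<xi> 0)"
    proof -
      have "(LINT x|lebesgue. v x * (- laplacian \<xi> x)) = (LINT x|lebesgue. f x * \<xi> x) + k * \<xi> 0"
        using S \<xi> by (simp add: f_def)
      moreover have "(LINT x|lebesgue. v x * (- laplacian \<xi> x)) = - (LINT x|lborel. v x * l x)"
        using lb[of v] by simp
      moreover have "(LINT x|lebesgue. f x * \<xi> x) = (LINT x|lborel. f x * \<xi> x)"
        by (rule integral_completion) simp
      ultimately show ?thesis by simp
    qed
    have n0: "(LINT x|lborel. newton x * l x) = - \<xi> 0"
      using rep[of 0] by (simp add: newton_minus)
    have "(LINT x|lebesgue. h x * laplacian \<xi> x) = (LINT x|lborel. h x * l x)" by (rule lb[OF hm])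
    also have "\<dots> = (LINT x|lborel. v x * l x - k * (newton x * l x) - P x * l x)"
      by (simp add: h_def left_diff_distrib mult.assoc)
    also have "\<dots> = (LINT x|lborel. v x * l x) - k * (LINT x|lborel. newton x * l x) - (LINT x|lborel. P x * l x)"
      using d2 d3 d4(2) by simp
    finally show "(LINT x|lebesgue. h x * laplacian \<xi> x) = 0" using w n0 d4(1) by simp
  next
    fix a :: "real^'n" and e :: real assume e: "0 < e"
    obtain C1 where C1: "0 < C1" "\<And>R a y. 0 < R \<Longrightarrow> 
      (\<integral>\<^sup>+x. ennreal (newton (x - y)) * indicator (cball a R) x \<partial>(lborel :: (real^'n) measure)) \<le> ennreal (C1 * R\<^sup>2)"
      using newton_ball_bound[OF N] by blast
    obtain C2 where C2: "0 < C2" "\<And>R a. 0 < R \<Longrightarrow>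
      (\<integral>\<^sup>+x. newton_pot (\<lambda>y. ennreal (f y)) x * indicator (cball a R) x \<partial>lborel) \<le> ennreal (C2 * R\<^sup>2) * (\<integral>\<^sup>+x. ennreal (f x) \<partial>lborel)"
      using newton_pot_ball_bound[OF N] fm' by blast
    obtain m where m: "(\<integral>\<^sup>+x. ennreal (f x) \<partial>lborel) = ennreal m" "0 \<le> m"
      using fin by (cases "\<integral>\<^sup>+x. ennreal (f x) \<partial>lborel") auto
    have NB: "(LINT x|lborel. newton x * indicator (cball a R) x) \<le> C1 * R\<^sup>2" if R: "0 < R" for R
    proof -
      have "ennreal (LINT x|lborel. newton x * indicator (cball a R) x) = (\<integral>\<^sup>+x. ennreal (newton x * indicator (cball a R) x) \<partial>lborel)"
        using Ni newton_nonneg[OF N] by (intro nn_integral_eq_integral[symmetric]) auto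
      also have "\<dots> = (\<integral>\<^sup>+x. ennreal (newton (x - 0)) * indicator (cball a R) x \<partial>lborel)"
        by (intro nn_integral_cong) (auto simp: indicator_def)
      also have "\<dots> \<le> ennreal (C1 * R\<^sup>2)" by (rule C1(2)[OF R])
      finally show ?thesis using C1(1) by (subst (asm) ennreal_le_iff) auto
    qed
    have PB: "(LINT x|lborel. P x * indicator (cball a R) x) \<le> C2 * m * R\<^sup>2" if R: "0 < R" for R
    proof -
      have le: "ennreal (enn2real t) \<le> t" for t by (cases t) auto
      have "ennreal (LINT x|lborel. P x * indicator (cball a R) x) = (\<integral>\<^sup>+x. ennreal (P x * indicator (cball a R) x) \<partial>lborel)"
        using Pi P0 by (intro nn_integral_eq_integral[symmetric]) auto
      also have "\<dots> \<le> (\<integral>\<^sup>+x. newton_pot (\<lambda>y. ennreal (f y)) x * indicator (cball a R) x \<partial>lborel)"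
        by (intro nn_integral_mono) (auto simp: P_def indicator_def le)
      also have "\<dots> \<le> ennreal (C2 * R\<^sup>2) * ennreal m" unfolding m(1)[symmetric] by (rule C2(2)[OF R])
      also have "\<dots> = ennreal (C2 * m * R\<^sup>2)"
        using C2(1) m by (simp add: ennreal_mult'[symmetric] mult_ac)
      finally show ?thesis using C2(1) m by (subst (asm) ennreal_le_iff) auto
    qed
    have dec: "\<exists>r. AE x in lborel. r \<le> norm x \<longrightarrow> v x \<le> e" if "0 < e" for e
    proof -
      have "v \<in> borel_measurable lebesgue" by (intro measurable_completion) simp
      moreover have "AE x in lebesgue. 0 \<le> v x" by (simp add: v)
      ultimately have "\<forall>e>0. \<exists>r. AE x in lebesgue. r \<le> norm x \<longrightarrow> v x \<le> e"
        using S esssup_decay_iff[of v] by blast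
      with that show ?thesis by (simp add: AE_completion_iff)
    qed
    obtain A where A: "0 \<le> A" "\<And>R a. 0 < R \<Longrightarrow> (LINT x|lborel. v x * indicator (cball a R) x) \<le> A + e / 2 * R ^ DIM(real^'n)"
      using ball_integral_growth[OF _ v vi dec, of "e / 2"] e by auto
    define B where "B = k * C1 + C2 * m + A"
    have B: "0 \<le> B" using k C1(1) C2(1) m A(1) by (simp add: B_def)
    \<comment> \<open>Beyond \<open>R0\<close>, B R^2 \<le> (e/2) R^3 \<le> (e/2) R^N, the last step
      by N > 2. The bound R \<ge> 1 also absorbs the constant A into A R^2.\<close>
    define R0 where "R0 = max 1 (2 * B / e)"
    show "\<exists>R0. \<forall>R\<ge>R0. (LINT x|lborel. \<bar>h x\<bar> * indicator (cball a R) x) \<le> e * R ^ CARD('n)"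
    proof (intro exI allI impI)
      fix R assume "R0 \<le> R"
      then have R: "1 \<le> R" "2 * B / e \<le> R" by (auto simp: R0_def)
      then have BR: "B \<le> e / 2 * R" using e by (simp add: field_simps)
      have "(LINT x|lborel. \<bar>h x\<bar> * indicator (cball a R) x) \<le>
        (LINT x|lborel. v x * indicator (cball a R) x + k * (newton x * indicator (cball a R) x) + P x * indicator (cball a R) x)"
      proof (rule integral_mono)
        show "integrable lborel (\<lambda>x. \<bar>h x\<bar> * indicator (cball a R) x)"
          using integrable_abs[OF hi[of a R]] by (simp add: abs_mult)
        show "\<bar>h x\<bar> * indicator (cball a R) x \<le> v x * indicator (cball a R) x + k * (newton x * indicator (cball a R) x) + P x * indicator (cball a R) x" for x
        proof -
          have "0 \<le> k * newton x" using k newton_nonneg[OF N, of x] by simp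
          then have "\<bar>h x\<bar> \<le> v x + k * newton x + P x" using v[of x] P0[of x] unfolding h_def by linarith
          then show ?thesis by (simp add: indicator_def)
        qed
      qed (use vi Ni Pi in auto)
      also have "\<dots> = (LINT x|lborel. v x * indicator (cball a R) x) + k * (LINT x|lborel. newton x * indicator (cball a R) x) + (LINT x|lborel. P x * indicator (cball a R) x)"
        using vi Ni Pi by simp
      also have "\<dots> \<le> (A + e / 2 * R ^ CARD('n)) + k * (C1 * R\<^sup>2) + C2 * m * R\<^sup>2"
        using A(2)[of R a] NB[of R] PB[of R] R k by (intro add_mono mult_left_mono) auto
      also have "\<dots> \<le> B * R\<^sup>2 + e / 2 * R ^ CARD('n)"
      proof -
        have "A * 1 \<le> A * R\<^sup>2" using A(1) R by (intro mult_left_mono) auto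
        then show ?thesis by (simp add: B_def algebra_simps)
      qed
      also have "B * R\<^sup>2 \<le> e / 2 * R ^ CARD('n)"
      proof -
        have "B * R\<^sup>2 \<le> (e / 2 * R) * R\<^sup>2" using BR by (intro mult_right_mono) auto
        also have "\<dots> = e / 2 * R ^ 3" by (simp add: power2_eq_square power3_eq_cube)
        also have "\<dots> \<le> e / 2 * R ^ CARD('n)" using e R N by (intro mult_left_mono power_increasing) auto
        finally show ?thesis .
      qed
      finally show "(LINT x|lborel. \<bar>h x\<bar> * indicator (cball a R) x) \<le> e * R ^ CARD('n)" by simp
    qed
  qed
  then show ?thesis using newton_pot_finite_AE[OF N fm' fin]
  proof eventually_elim
    case (elim x)
    have kn: "0 \<le> k * newton x" using k newton_nonneg[OF N, of x] by simp
    have "newton_pot (\<lambda>y. ennreal (f y)) x = ennreal (P x)" using elim(2) by (simp add: P_def)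
    moreover have "v x = k * newton x + P x" using elim(1) by (simp add: h_def)
    ultimately show ?case using kn P0[of x] by (simp add: f_def[symmetric])
  qed
qed

text \<open>Green's formula at the pole 0 turns k \<Gamma> into k \<xi>(0), and duality turns the
  potential into the source integral. Source integrability and decay are hypotheses because a
  supersolution lying above will supply them.\<close>

lemma solution_of_representation:
  fixes W v :: "real^'n \<Rightarrow> real"
  assumes N: "2 < CARD('n)" and k: "0 \<le> k"
    and [measurable]: "W \<in> borel_measurable borel" "v \<in> borel_measurable borel"
    and W: "\<And>x. 0 \<le> W x" and v: "\<And>x. 0 \<le> v x"
    and fi: "integrable lborel (\<lambda>x. W x * v x powr p)"
    and dec: "\<And>e. 0 < e \<Longrightarrow> \<exists>r. AE x in lborel. r \<le> norm x \<longrightarrow> v x \<le> e"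
    and rep: "AE x in lborel. ennreal (k * newton x) + newton_pot (\<lambda>y. ennreal (W y * v y powr p)) x = ennreal (v x)"
  shows "is_solution p W k v"
proof -
  define f where "f x = W x * v x powr p" for x
  have f0: "0 \<le> f x" for x using W by (simp add: f_def)
  have fm [measurable]: "f \<in> borel_measurable borel" unfolding f_def by measurable
  have fi': "integrable lborel f" using fi by (simp add: f_def[abs_def])
  have fin: "(\<integral>\<^sup>+x. ennreal (f x) \<partial>lborel) < \<infinity>"
    using fi' f0 by (simp add: integrable_iff_bounded)
  have fm': "(\<lambda>x. ennreal (f x)) \<in> borel_measurable borel" by measurable
  define P where "P x = enn2real (newton_pot (\<lambda>y. ennreal (f y)) x)" for x
  have Pm [measurable]: "P \<in> borel_measurable borel" unfolding P_def by measurable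
  have Pi: "integrable lborel (\<lambda>x. P x * indicator (cball a R) x)" for a R
    unfolding P_def by (rule newton_pot_integrable_ball[OF N fm' fin])
  have Ni: "integrable lborel (\<lambda>x :: real^'n. newton x * indicator (cball a R) x)" for a R
    using newton_integrable_ball[OF N, of 0 a R] by (simp add: newton_minus)
  have vP: "AE x in lborel. v x = k * newton x + P x"
    using rep
  proof eventually_elim
    case (elim x)
    have kn: "0 \<le> k * newton x" using k newton_nonneg[OF N, of x] by simp
    have "v x = enn2real (ennreal (k * newton x) + newton_pot (\<lambda>y. ennreal (f y)) x)"
      using elim v[of x] by (simp add: f_def)
    also have "\<dots> = k * newton x + P x"
    proof -
      have "newton_pot (\<lambda>y. ennreal (f y)) x < \<infinity>"
      proof -
        have "newton_pot (\<lambda>y. ennreal (f y)) x \<le> ennreal (k * newton x) + newton_pot (\<lambda>y. ennreal (f y)) x"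
          by (rule add_increasing) auto
        also have "\<dots> = ennreal (v x)" using elim by (simp add: f_def)
        finally show ?thesis by (rule le_less_trans) simp
      qed
      then show ?thesis using kn by (subst enn2real_plus) (auto simp: P_def)
    qed
    finally show ?case .
  qed
  have vi: "integrable lborel (\<lambda>x. v x * indicator (cball a R) x)" for a R
  proof (rule integrable_cong_AE_imp)
    show "integrable lborel (\<lambda>x. k * (newton x * indicator (cball a R) x) + P x * indicator (cball a R) x)"
      using Ni Pi by simp
    show "AE x in lborel. k * (newton x * indicator (cball a R) x) + P x * indicator (cball a R) x = v x * indicator (cball a R) x"
      using vP by eventually_elim (simp add: distrib_right)
  qed (auto intro!: borel_measurable_times borel_measurable_indicator)
  have vm: "v \<in> borel_measurable lebesgue" by (intro measurable_completion) simp
  have v0: "AE x in lebesgue. 0 \<le> v x" by (simp add: v)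
  have "v \<in> L1_loc"
  proof (unfold L1_loc_def, intro CollectI allI impI)
    fix K :: "(real^'n) set" assume K: "compact K"
    then obtain R where R: "K \<subseteq> cball 0 R"
      using bounded_subset_ballD[OF compact_imp_bounded, of K 0] ball_subset_cball by blast
    have "integrable lebesgue (\<lambda>x. v x * indicator (cball 0 R) x)"
      using vi[of 0 R] by (subst integrable_completion) (auto intro!: borel_measurable_times borel_measurable_indicator)
    then have "set_integrable lebesgue (cball 0 R) v"
      by (simp add: set_integrable_def mult.commute)
    then show "set_integrable lebesgue K v"
      by (rule set_integrable_subset) (use K R in \<open>simp_all add: borel_compact\<close>)
  qed
  moreover have "integrable lebesgue (\<lambda>x. W x * v x powr p)"
    using fi by (subst integrable_completion) auto
  moreover have "((\<lambda>r. esssup (restrict_space lebesgue (- ball 0 r)) (\<lambda>x. ereal (v x))) \<longlongrightarrow> 0) at_top"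
    unfolding esssup_decay_iff[OF vm v0] using dec by (simp add: AE_completion_iff)
  moreover have "(LINT x|lebesgue. v x * (- laplacian \<xi> x)) = (LINT x|lebesgue. W x * v x powr p * \<xi> x) + k * \<xi> 0"
    if \<xi>: "\<xi> \<in> C11_c" for \<xi>
  proof -
    obtain l M R where lm [measurable]: "l \<in> borel_measurable borel" and lM: "\<And>x. \<bar>l x\<bar> \<le> M"
      and lR: "\<And>x. R < norm x \<Longrightarrow> l x = 0"
      and ll: "AE x in lborel. laplacian \<xi> x = l x" and c\<xi>: "continuous_on UNIV \<xi>"
      and rp: "\<And>x. (LINT y|lborel. newton (x - y) * l y) = - \<xi> x"
      using newton_representation[OF N \<xi>] by (elim exE conjE, intro that) blast+
    have \<xi>m [measurable]: "\<xi> \<in> borel_measurable borel" using c\<xi> by (rule borel_measurable_continuous_onI)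
    have d3: "integrable lborel (\<lambda>x. newton x * l x)"
      by (rule integrable_mult_bounded_support[OF Ni _ _ lM lR]) auto
    have d4: "(LINT x|lborel. P x * l x) = - (LINT x|lborel. f x * \<xi> x)" "integrable lborel (\<lambda>x. P x * l x)"
      unfolding P_def by (rule newton_pot_duality[OF N fi' f0 lm lM lR rp]; simp)+
    have n0: "(LINT x|lborel. newton x * l x) = - \<xi> 0"
      using rp[of 0] by (simp add: newton_minus)
    have lm': "l \<in> borel_measurable lebesgue" by (intro measurable_completion) simp
    have "(LINT x|lebesgue. v x * (- laplacian \<xi> x)) = (LINT x|lebesgue. v x * (- l x))"
      by (intro integral_cong_AE borel_measurable_times borel_measurable_uminus vm lm' laplacian_measurable[OF \<xi>])
        (use AE_completion[OF ll] in \<open>auto elim: eventually_mono\<close>)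
    also have "\<dots> = (LINT x|lborel. v x * (- l x))" by (rule integral_completion) simp
    also have "\<dots> = (LINT x|lborel. - (k * (newton x * l x) + P x * l x))"
    proof (rule integral_cong_AE)
      show "AE x in lborel. v x * (- l x) = - (k * (newton x * l x) + P x * l x)"
        using vP by eventually_elim (simp add: algebra_simps)
    qed measurable
    also have "\<dots> = - (k * (LINT x|lborel. newton x * l x) + (LINT x|lborel. P x * l x))"
      using d3 d4(2) by simp
    also have "\<dots> = (LINT x|lborel. f x * \<xi> x) + k * \<xi> 0" using n0 d4(1) by simp
    also have "(LINT x|lborel. f x * \<xi> x) = (LINT x|lebesgue. f x * \<xi> x)"
      by (rule integral_completion[symmetric]) simp
    finally show ?thesis by (simp add: f_def)
  qed
  ultimately show ?thesis unfolding is_solution_def using v0 by blast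
qed

section \<open>Monotone iteration in [0,\<infinity>]\<close>

text \<open>Sending \<infinity> to \<infinity> keeps the power increasing and invertible for p > 0,
  so the iteration can run before finiteness is known.\<close>

definition epowr :: "real \<Rightarrow> ennreal \<Rightarrow> ennreal" where
  "epowr p y = (if y = \<infinity> then \<infinity> else ennreal (enn2real y powr p))"

lemma epowr_ennreal: "0 \<le> y \<Longrightarrow> epowr p (ennreal y) = ennreal (y powr p)"
  by (simp add: epowr_def)

lemma epowr_borel [measurable]: "epowr p \<in> borel_measurable borel"
  unfolding epowr_def[abs_def] by measurable

lemma epowr_mono:
  assumes "0 < p" "y \<le> z"
  shows "epowr p y \<le> epowr p z"
  using assms by (cases y; cases z) (auto simp: epowr_def top_unique intro!: ennreal_leI powr_mono2)

lemma epowr_inverse: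
  assumes "0 < p"
  shows "epowr p (epowr (1 / p) y) = y"
  using assms by (cases y) (auto simp: epowr_def powr_powr)

text \<open>An increasing map with an increasing inverse commutes with suprema; the inverse is the
  power 1/p.\<close>

lemma epowr_SUP:
  fixes y :: "nat \<Rightarrow> ennreal"
  assumes p: "0 < p"
  shows "epowr p (SUP n. y n) = (SUP n. epowr p (y n))"
proof (rule antisym)
  let ?s = "SUP n. epowr p (y n)"
  have "y n \<le> epowr (1 / p) ?s" for n
  proof -
    have "epowr (1 / p) (epowr p (y n)) \<le> epowr (1 / p) ?s"
      using p by (intro epowr_mono SUP_upper) auto
    then show ?thesis using epowr_inverse[of "1 / p" "y n"] p by simp
  qed
  then have "(SUP n. y n) \<le> epowr (1 / p) ?s" by (intro SUP_least)
  then have "epowr p (SUP n. y n) \<le> epowr p (epowr (1 / p) ?s)" by (rule epowr_mono[OF p])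
  then show "epowr p (SUP n. y n) \<le> ?s" by (simp add: epowr_inverse[OF p])
  show "?s \<le> epowr p (SUP n. y n)"
    by (intro SUP_least epowr_mono[OF p] SUP_upper) auto
qed

lemma newton_pot_mono_AE:
  assumes "AE y in lborel. f y \<le> g y"
  shows "newton_pot f x \<le> newton_pot g x"
  unfolding newton_pot_def
  by (intro nn_integral_mono_AE) (use assms in \<open>auto elim!: eventually_mono intro: mult_left_mono\<close>)

text \<open>The right-hand side of the integral equation; its fixed points are the candidates for
  solutions and its supersolutions the barriers.\<close>

definition emden_op :: "real \<Rightarrow> (real^'n \<Rightarrow> real) \<Rightarrow> real \<Rightarrow> (real^'n \<Rightarrow> ennreal) \<Rightarrow> real^'n \<Rightarrow> ennreal" where
  "emden_op p W k u x = ennreal (k * newton x) + newton_pot (\<lambda>y. ennreal (W y) * epowr p (u y)) x"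

lemma emden_op_mono_AE:
  assumes p: "0 < p" and "AE y in lborel. u y \<le> w y"
  shows "emden_op p W k u x \<le> emden_op p W k w x"
  unfolding emden_op_def
  by (intro add_left_mono newton_pot_mono_AE)
    (use assms in \<open>auto elim!: eventually_mono intro!: mult_left_mono epowr_mono\<close>)

lemma emden_op_ennreal:
  assumes "\<And>x. 0 \<le> w x" "\<And>x. 0 \<le> W x"
  shows "emden_op p W k (\<lambda>x. ennreal (w x)) x = ennreal (k * newton x) + newton_pot (\<lambda>y. ennreal (W y * w y powr p)) x"
  unfolding emden_op_def using assms by (simp add: epowr_ennreal ennreal_mult')

primrec emden_iter :: "real \<Rightarrow> (real^'n \<Rightarrow> real) \<Rightarrow> real \<Rightarrow> nat \<Rightarrow> real^'n \<Rightarrow> ennreal" where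
  "emden_iter p W k 0 = (\<lambda>x. 0)"
| "emden_iter p W k (Suc m) = emden_op p W k (emden_iter p W k m)"

definition emden_lim :: "real \<Rightarrow> (real^'n \<Rightarrow> real) \<Rightarrow> real \<Rightarrow> real^'n \<Rightarrow> ennreal" where
  "emden_lim p W k x = (SUP m. emden_iter p W k m x)"

lemma emden_op_borel:
  assumes [measurable]: "W \<in> borel_measurable borel" "u \<in> borel_measurable borel"
  shows "emden_op p W k u \<in> borel_measurable borel"
proof -
  have "(\<lambda>y. ennreal (W y) * epowr p (u y)) \<in> borel_measurable borel" by measurable
  from newton_pot_borel[OF this] show ?thesis
    unfolding emden_op_def[abs_def] by measurable
qed

lemma emden_iter_borel:
  assumes "W \<in> borel_measurable borel"
  shows "emden_iter p W k m \<in> borel_measurable borel"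
  by (induction m) (auto intro: emden_op_borel assms)

lemma emden_iter_incseq:
  assumes p: "0 < p"
  shows "incseq (emden_iter p W k)"
proof (rule incseq_SucI)
  fix m
  show "emden_iter p W k m \<le> emden_iter p W k (Suc m)"
  proof (induction m)
    case 0
    then show ?case by (simp add: le_fun_def)
  next
    case (Suc m)
    then show ?case
      by (auto simp: le_fun_def intro!: emden_op_mono_AE[OF p])
  qed
qed

text \<open>Monotone convergence under the kernel integral. The identity holds at every point,
  including those where both sides are infinite.\<close>

lemma emden_lim_fixpoint:
  assumes p: "0 < p" and Wm [measurable]: "W \<in> borel_measurable borel"
  shows "emden_op p W k (emden_lim p W k) x = emden_lim p W k x"
proof -
  let ?U = "emden_iter p W k"
  have [measurable]: "?U m \<in> borel_measurable borel" for m by (rule emden_iter_borel[OF Wm])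
  have inc: "incseq ?U" by (rule emden_iter_incseq[OF p])
  let ?g = "\<lambda>m y. ennreal (newton (x - y)) * (ennreal (W y) * epowr p (?U m y))"
  have gi: "incseq ?g"
    using inc p by (auto simp: incseq_def le_fun_def intro!: mult_left_mono epowr_mono)
  have "newton_pot (\<lambda>y. ennreal (W y) * epowr p (emden_lim p W k y)) x = (\<integral>\<^sup>+y. (SUP m. ?g m y) \<partial>lborel)"
    unfolding newton_pot_def emden_lim_def epowr_SUP[OF p]
    by (simp add: SUP_mult_left_ennreal)
  also have "\<dots> = (SUP m. \<integral>\<^sup>+y. ?g m y \<partial>lborel)"
    by (rule nn_integral_monotone_convergence_SUP[OF gi]) measurable
  finally have "emden_op p W k (emden_lim p W k) x = (SUP m. ?U (Suc m) x)"
    unfolding emden_op_def emden_iter.simps newton_pot_def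
    by (simp add: ennreal_SUP_add_right)
  also have "\<dots> = (SUP m. ?U m x)"
  proof (rule antisym)
    show "(SUP m. ?U (Suc m) x) \<le> (SUP m. ?U m x)" by (intro SUP_least SUP_upper) simp
    show "(SUP m. ?U m x) \<le> (SUP m. ?U (Suc m) x)"
    proof (rule SUP_least)
      fix m
      have "?U m x \<le> ?U (Suc m) x" using inc by (meson incseq_SucD le_funD)
      also have "\<dots> \<le> (SUP m. ?U (Suc m) x)" by (rule SUP_upper) simp
      finally show "?U m x \<le> (SUP m. ?U (Suc m) x)" .
    qed
  qed
  finally show ?thesis by (simp add: emden_lim_def)
qed

text \<open>The operator sees its argument only up to null sets, so an inequality valid almost
  everywhere passes through every iteration step.\<close>

lemma emden_lim_le_supersolution:
  assumes p: "0 < p" and super: "AE x in lborel. emden_op p W k w x \<le> w x"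
  shows "AE x in lborel. emden_lim p W k x \<le> w x"
proof -
  have "AE x in lborel. emden_iter p W k m x \<le> w x" for m
  proof (induction m)
    case (Suc m)
    show ?case using super
    proof eventually_elim
      case (elim x)
      have "emden_op p W k (emden_iter p W k m) x \<le> emden_op p W k w x"
        by (rule emden_op_mono_AE[OF p Suc])
      with elim show ?case by simp
    qed
  qed simp
  then have "AE x in lborel. \<forall>m. emden_iter p W k m x \<le> w x" by (simp add: AE_all_countable)
  then show ?thesis unfolding emden_lim_def by eventually_elim (auto intro: SUP_least)
qed

section \<open>Minimal solutions\<close>

text \<open>The preimage of a ball is a ball of the same radius, so the two measures agree on balls,
  and this determines them. Preservation of null sets, which that principle also asks for, follows
  because the inverse map is differentiable.\<close>

lemma lborel_distr_orthogonal:
  fixes T :: "'a::euclidean_space \<Rightarrow> 'a"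
  assumes T: "orthogonal_transformation T"
  shows "distr lborel borel T = lborel"
proof -
  have lin: "linear T" using T by (rule orthogonal_transformation_linear)
  have Tm [measurable]: "T \<in> borel_measurable borel"
    using lin by (intro borel_measurable_continuous_onI linear_continuous_on) (simp add: linear_conv_bounded_linear)
  let ?S = "inv T"
  have S: "orthogonal_transformation ?S" using T by (rule orthogonal_transformation_inv)
  have bij: "bij T" using T by (rule orthogonal_transformation_bij)
  have TS: "T (?S x) = x" and ST: "?S (T x) = x" for x
    using bij by (simp_all add: surj_f_inv_f bij_is_surj inv_f_f bij_is_inj)
  have vim: "T -` A = ?S ` A" for A using bij by (rule bij_vimage_eq_inv_image)
  have eqb: "emeasure (distr lborel borel T) (cball a r) = emeasure lborel (cball a r)" if "0 < r" for a r
  proof -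
    have "dist (T x) a = dist x (?S a)" for x
    proof -
      have "dist (T x) a = norm (T x - T (?S a))" by (simp add: dist_norm TS)
      also have "T x - T (?S a) = T (x - ?S a)" using lin by (simp add: linear_diff)
      finally show ?thesis using T by (simp add: orthogonal_transformation_norm dist_norm)
    qed
    then have "T -` cball a r = cball (?S a) r"
      by (auto simp: mem_cball dist_commute)
    then have "emeasure (distr lborel borel T) (cball a r) = emeasure lborel (cball (?S a) r)"
      by (simp add: emeasure_distr)
    then show ?thesis using that by (simp add: emeasure_cball)
  qed
  show ?thesis
  proof (rule measure_eqI_cballs)
    fix A :: "'a set" assume A: "A \<in> null_sets lborel"
    then have "negligible A" by (simp add: negligible_iff_null_sets null_sets_completionI)
    then have "negligible (?S ` A)"
    proof (rule negligible_differentiable_image_negligible[OF order_refl])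
      show "?S differentiable_on A"
        using S by (intro linear_imp_differentiable_on orthogonal_transformation_linear)
    qed
    then have n: "T -` A \<in> null_sets lebesgue" by (simp add: vim negligible_iff_null_sets)
    have m: "T -` A \<in> sets lborel" using A measurable_sets[OF Tm, of A] by auto
    have "emeasure lborel (T -` A) = 0"
    proof -
      have "emeasure lborel (T -` A) = emeasure lebesgue (T -` A)" using m by simp
      also have "\<dots> = 0" using n by (rule null_setsD1)
      finally show ?thesis .
    qed
    then show "A \<in> null_sets (distr lborel borel T) \<and> A \<in> null_sets lborel"
      using A by (auto simp: null_sets_def emeasure_distr)
  next
    show "emeasure (distr lborel borel T) (cball a r) < \<infinity>" for a r
    proof -
      have "emeasure (distr lborel borel T) (cball a r) \<le> emeasure (distr lborel borel T) (cball a (\<bar>r\<bar> + 1))"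
        by (intro emeasure_mono) auto
      also have "\<dots> < \<infinity>" by (subst eqb) (auto simp: emeasure_lborel_cball_finite[unfolded infinity_ennreal_def])
      finally show ?thesis .
    qed
  qed (auto simp: eqb)
qed

lemma newton_pot_orthogonal:
  fixes T :: "real^'n \<Rightarrow> real^'n"
  assumes T: "orthogonal_transformation T" and [measurable]: "f \<in> borel_measurable borel"
  shows "newton_pot f (T x) = newton_pot (\<lambda>y. f (T y)) x"
proof -
  have lin: "linear T" using T by (rule orthogonal_transformation_linear)
  have Tm: "T \<in> borel_measurable lborel"
    using lin by (simp add: borel_measurable_continuous_onI linear_continuous_on linear_conv_bounded_linear)
  have nT: "newton (T z) = newton z" for z
    using T by (simp add: newton_def orthogonal_transformation_norm)
  have "newton_pot f (T x) = (\<integral>\<^sup>+y. ennreal (newton (T x - y)) * f y \<partial>distr lborel borel T)"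
    unfolding newton_pot_def lborel_distr_orthogonal[OF T] ..
  also have "\<dots> = (\<integral>\<^sup>+y. ennreal (newton (T x - T y)) * f (T y) \<partial>lborel)"
    by (subst nn_integral_distr[OF Tm]) auto
  also have "\<dots> = (\<integral>\<^sup>+y. ennreal (newton (x - y)) * f (T y) \<partial>lborel)"
    using lin by (simp add: linear_diff[symmetric] nT)
  finally show ?thesis by (simp add: newton_pot_def)
qed

lemma emden_iter_orthogonal:
  fixes W :: "real^'n \<Rightarrow> real"
  assumes T: "orthogonal_transformation T" and Wm [measurable]: "W \<in> borel_measurable borel"
    and W: "\<And>x. W (T x) = W x"
  shows "emden_iter p W k m (T x) = emden_iter p W k m x"
proof (induction m arbitrary: x)
  case (Suc m)
  let ?u = "emden_iter p W k m"
  have [measurable]: "?u \<in> borel_measurable borel" by (rule emden_iter_borel[OF Wm])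
  have fm: "(\<lambda>y. ennreal (W y) * epowr p (?u y)) \<in> borel_measurable borel" by measurable
  have "newton (T x) = newton x" using T by (simp add: newton_def orthogonal_transformation_norm)
  then show ?case
    unfolding emden_iter.simps emden_op_def newton_pot_orthogonal[OF T fm] by (simp add: W Suc)
qed simp

section \<open>Existence and comparison of minimal solutions\<close>

text \<open>The barrier \<open>w\<close> passes finiteness, decay and integrability of the source
  down to the limit of the iteration, so no compactness is involved. Every competitor satisfies the
  integral equation and is thus itself a supersolution, which gives minimality.\<close>

lemma minimal_solution_exists:
  fixes W w :: "real^'n \<Rightarrow> real"
  assumes N: "2 < CARD('n)" and p: "0 < p" and k: "0 < k"
    and Wm [measurable]: "W \<in> borel_measurable borel" and wm [measurable]: "w \<in> borel_measurable borel"
    and W: "\<And>x. 0 \<le> W x" and w: "\<And>x. 0 \<le> w x"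
    and super: "AE x in lborel. ennreal (k * newton x) + newton_pot (\<lambda>y. ennreal (W y * w y powr p)) x \<le> ennreal (w x)"
    and wi: "integrable lborel (\<lambda>x. W x * w x powr p)"
    and dec: "\<And>e. 0 < e \<Longrightarrow> \<exists>r. AE x in lborel. r \<le> norm x \<longrightarrow> w x \<le> e"
  shows "\<exists>v. is_minimal_solution p W k v \<and> (AE x in lebesgue. v x \<le> w x) \<and>
    (radially_symmetric W \<longrightarrow> radially_symmetric v)"
proof -
  let ?U = "emden_lim p W k"
  define v where "v x = enn2real (?U x)" for x
  have Um [measurable]: "?U \<in> borel_measurable borel"
    unfolding emden_lim_def using emden_iter_borel[OF Wm] by measurable
  have vm [measurable]: "v \<in> borel_measurable borel" unfolding v_def by measurable
  have v0: "0 \<le> v x" for x by (simp add: v_def)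
  have Uw: "AE x in lborel. ?U x \<le> ennreal (w x)"
    using super by (intro emden_lim_le_supersolution p) (simp add: emden_op_ennreal w W)
  have Uv: "AE x in lborel. ennreal (v x) = ?U x"
    using Uw
  proof eventually_elim
    case (elim x)
    then have "?U x < \<infinity>" by (rule le_less_trans) simp
    then show ?case by (simp add: v_def)
  qed
  have vw: "AE x in lborel. v x \<le> w x"
    using Uw Uv
  proof eventually_elim
    case (elim x)
    then have "ennreal (v x) \<le> ennreal (w x)" by simp
    then show ?case using w by simp
  qed
  have rep: "AE x in lborel. ennreal (k * newton x) + newton_pot (\<lambda>y. ennreal (W y * v y powr p)) x = ennreal (v x)"
    using Uv
  proof eventually_elim
    case (elim x)
    have "ennreal (k * newton x) + newton_pot (\<lambda>y. ennreal (W y * v y powr p)) x = emden_op p W k (\<lambda>x. ennreal (v x)) x"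
      by (rule emden_op_ennreal[symmetric]) (rule v0 W)+
    \<comment> \<open>\<open>v\<close> and the limit agree only almost everywhere, which the
      integral operator does not distinguish.\<close>
    also have "\<dots> = emden_op p W k ?U x"
      by (intro antisym emden_op_mono_AE[OF p]) (use Uv in \<open>auto elim: eventually_mono\<close>)
    also have "\<dots> = ?U x" by (rule emden_lim_fixpoint[OF p Wm])
    finally show ?case using elim by simp
  qed
  have fi: "integrable lborel (\<lambda>x. W x * v x powr p)"
  proof (rule Bochner_Integration.integrable_bound[OF wi])
    show "AE x in lborel. norm (W x * v x powr p) \<le> norm (W x * w x powr p)"
      using vw
    proof eventually_elim
      case (elim x)
      then have "W x * v x powr p \<le> W x * w x powr p"
        using W v0 p by (intro mult_left_mono powr_mono2) auto
      then show ?case using W by simp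
    qed
  qed measurable
  have vdec: "\<exists>r. AE x in lborel. r \<le> norm x \<longrightarrow> v x \<le> e" if "0 < e" for e
  proof -
    obtain r where "AE x in lborel. r \<le> norm x \<longrightarrow> w x \<le> e" using dec[OF \<open>0 < e\<close>] by blast
    then have "AE x in lborel. r \<le> norm x \<longrightarrow> v x \<le> e" using vw by eventually_elim auto
    then show ?thesis by blast
  qed
  have sol: "is_solution p W k v"
    by (rule solution_of_representation[OF N _ Wm vm W v0 fi vdec rep]) (use k in auto)
  have "AE x in lborel. 0 < v x"
    using rep AE_lborel_singleton[of "0 :: real^'n"]
  proof eventually_elim
    case (elim x)
    have "0 < k * newton x" using k newton_pos[OF N elim(2)] by simp
    then have "0 < ennreal (k * newton x)" by simp
    also have "\<dots> \<le> ennreal (v x)" unfolding elim(1)[symmetric] by (rule add_increasing2) auto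
    finally show ?case by simp
  qed
  then have pos: "is_positive_solution p W k v"
    unfolding is_positive_solution_def using sol by (simp add: AE_completion_iff)
  have "AE x in lebesgue. v x \<le> z x" if z: "is_positive_solution p W k z" for z
  proof -
    have zs: "is_solution p W k z" using z by (simp add: is_positive_solution_def)
    then have "z \<in> borel_measurable lebesgue" "AE x in lebesgue. 0 \<le> z x"
      using L1_loc_measurable unfolding is_solution_def by blast+
    then obtain y where y: "y \<in> borel_measurable borel" "\<And>x. 0 \<le> y x" "AE x in lebesgue. z x = y x"
      using borel_nonneg_representative by blast
    have "is_solution p W k y" by (rule is_solution_cong[OF zs _ y(3)]) simp
    from solution_representation[OF N k Wm y(1) W y(2) this]
    have "AE x in lborel. emden_op p W k (\<lambda>x. ennreal (y x)) x \<le> ennreal (y x)"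
      by (simp add: emden_op_ennreal y W) (auto elim: eventually_mono)
    from emden_lim_le_supersolution[OF p this] have "AE x in lborel. ?U x \<le> ennreal (y x)" .
    then have "AE x in lborel. v x \<le> y x" using Uv
    proof eventually_elim
      case (elim x)
      then have "ennreal (v x) \<le> ennreal (y x)" by simp
      then show ?case using y(2) by simp
    qed
    then have "AE x in lebesgue. v x \<le> y x" by (rule AE_completion)
    then show ?thesis using y(3) by eventually_elim simp
  qed
  then have min: "is_minimal_solution p W k v" unfolding is_minimal_solution_def using pos by blast
  have "radially_symmetric v" if rad: "radially_symmetric W"
    unfolding radially_symmetric_def
  proof (intro allI impI)
    fix x y :: "real^'n" assume "norm x = norm y"
    \<comment> \<open>Points of equal norm are joined by an orthogonal map. The iterates are
      invariant at every point, so \<open>v\<close> itself is radial and not merely its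
      class.\<close>
    then obtain T where T: "orthogonal_transformation T" "T x = y" by (rule orthogonal_transformation_exists)
    have "W (T z) = W z" for z
      using rad T(1) unfolding radially_symmetric_def by (metis orthogonal_transformation_norm)
    then have "?U y = ?U x"
      unfolding emden_lim_def T(2)[symmetric] by (simp add: emden_iter_orthogonal[OF T(1) Wm])
    then show "v x = v y" by (simp add: v_def)
  qed
  then show ?thesis using min AE_completion[OF vw] by blast
qed

text \<open>Lowering \<open>k\<close> alone gives the threshold, lowering the potential alone gives
  monotonicity, and lowering neither produces a radial minimal solution below a given one.\<close>

lemma minimal_solution_below:
  fixes W1 W2 u :: "real^'n \<Rightarrow> real"
  assumes N: "2 < CARD('n)" and p: "0 < p" and k: "0 < k2" "k2 \<le> k1"
    and m: "W1 \<in> borel_measurable borel" "W2 \<in> borel_measurable borel"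
    and W: "\<And>x. 0 \<le> W2 x" "\<And>x. W2 x \<le> W1 x"
    and u: "is_solution p W1 k1 u"
  shows "\<exists>v. is_minimal_solution p W2 k2 v \<and> (AE x in lebesgue. v x \<le> u x) \<and>
    (radially_symmetric W2 \<longrightarrow> radially_symmetric v)"
proof -
  note [measurable] = m
  have um: "u \<in> borel_measurable lebesgue" "AE x in lebesgue. 0 \<le> u x"
    using u L1_loc_measurable unfolding is_solution_def by blast+
  then obtain w where w: "w \<in> borel_measurable borel" "\<And>x. 0 \<le> w x" "AE x in lebesgue. u x = w x"
    using borel_nonneg_representative by blast
  note [measurable] = w(1)
  have W1: "0 \<le> W1 x" for x using W order_trans by blast
  have sol: "is_solution p W1 k1 w" by (rule is_solution_cong[OF u _ w(3)]) simp
  have k1: "0 < k1" using k by simp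
  have "AE x in lborel. ennreal (k2 * newton x) + newton_pot (\<lambda>y. ennreal (W2 y * w y powr p)) x \<le> ennreal (w x)"
    using solution_representation[OF N k1 m(1) w(1) W1 w(2) sol]
  proof eventually_elim
    case (elim x)
    have "ennreal (k2 * newton x) \<le> ennreal (k1 * newton x)"
      using k newton_nonneg[OF N, of x] by (intro ennreal_leI mult_right_mono) auto
    moreover have "newton_pot (\<lambda>y. ennreal (W2 y * w y powr p)) x \<le> newton_pot (\<lambda>y. ennreal (W1 y * w y powr p)) x"
      by (intro newton_pot_mono_AE AE_I2 ennreal_leI mult_right_mono W) simp
    ultimately show ?case unfolding elim[symmetric] by (rule add_mono)
  qed
  moreover have "integrable lborel (\<lambda>x. W2 x * w x powr p)"
  proof (rule Bochner_Integration.integrable_bound)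
    show "integrable lborel (\<lambda>x. W1 x * w x powr p)"
      using sol unfolding is_solution_def by (subst (asm) integrable_completion) auto
    show "AE x in lborel. norm (W2 x * w x powr p) \<le> norm (W1 x * w x powr p)"
      using W W1 by (intro AE_I2) (simp add: abs_mult mult_right_mono)
  qed measurable
  moreover have "\<exists>r. AE x in lborel. r \<le> norm x \<longrightarrow> w x \<le> e" if "0 < e" for e
  proof -
    have "w \<in> borel_measurable lebesgue" by (intro measurable_completion) simp
    moreover have "AE x in lebesgue. 0 \<le> w x" by (simp add: w)
    ultimately have "\<forall>e>0. \<exists>r. AE x in lebesgue. r \<le> norm x \<longrightarrow> w x \<le> e"
      using sol esssup_decay_iff[of w] unfolding is_solution_def by blast
    with that show ?thesis by (simp add: AE_completion_iff)
  qed
  ultimately obtain v where v: "is_minimal_solution p W2 k2 v" "AE x in lebesgue. v x \<le> w x"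
    "radially_symmetric W2 \<longrightarrow> radially_symmetric v"
    using minimal_solution_exists[OF N p k(1) m(2) w(1) W(1) w(2)] by blast
  have "AE x in lebesgue. v x \<le> u x" using v(2) w(3) by eventually_elim simp
  with v show ?thesis by blast
qed

section \<open>The threshold\<close>

text \<open>The value of a potential at the origin is arbitrary; setting it to 0 yields a function
  that is Borel and nonnegative everywhere and has the same solutions.\<close>

definition puncture :: "(real^'n \<Rightarrow> real) \<Rightarrow> real^'n \<Rightarrow> real" where
  "puncture V x = (if x = 0 then 0 else V x)"

lemma puncture_AE: "AE x in lebesgue. V x = puncture V x" "AE x in lebesgue. puncture V x = V x"
proof -
  have "AE x in lebesgue. x \<noteq> (0 :: real^'n)" by (intro AE_completion AE_lborel_singleton)
  then show "AE x in lebesgue. V x = puncture V x" "AE x in lebesgue. puncture V x = V x"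
    by (eventually_elim; simp add: puncture_def)+
qed

lemma is_minimal_solution_puncture: "is_minimal_solution p (puncture V) k u \<longleftrightarrow> is_minimal_solution p V k u"
  using is_minimal_solution_cong puncture_AE by metis

lemma admissible_puncture:
  assumes "admissible_potential a0 a_inf c1 (V :: real^'n \<Rightarrow> real)"
  shows "puncture V \<in> borel_measurable borel" and "\<And>x. 0 \<le> puncture V x"
    and "\<And>x. x \<noteq> 0 \<Longrightarrow> puncture V x \<le> V0_bound a0 a_inf c1 x" and "continuous_on (- {0}) V"
proof -
  have "local_lipschitz (UNIV :: real set) (- {0}) (\<lambda>_. V)"
    using assms by (simp add: admissible_potential_def)
  from local_lipschitz_continuous_on[OF this, of 0] show c: "continuous_on (- {0}) V" by simp
  have "(\<lambda>x. indicator (- {0}) x *\<^sub>R V x) \<in> borel_measurable borel"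
    by (rule borel_measurable_continuous_on_indicator[OF _ c]) auto
  moreover have "(\<lambda>x. indicator (- {0}) x *\<^sub>R V x) = puncture V"
    by (rule ext) (simp add: puncture_def indicator_def)
  ultimately show "puncture V \<in> borel_measurable borel" by simp
qed (use assms in \<open>auto simp: admissible_potential_def puncture_def\<close>)

lemma newton_decay:
  assumes N: "2 < CARD('n::finite)" and e: "0 < e"
  shows "\<exists>r. \<forall>x :: real^'n. r \<le> norm x \<longrightarrow> newton x \<le> e"
proof -
  define \<kappa> where "\<kappa> = (LINT z|(lborel :: (real^'n) measure). bubble 1 z)"
  have \<kappa>: "0 < \<kappa>" using bubble_mass_pos[OF N] by (simp add: \<kappa>_def)
  have "((\<lambda>r. r powr (2 - real CARD('n))) \<longlongrightarrow> 0) at_top"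
    using N by (intro tendsto_neg_powr filterlim_ident) auto
  then have "eventually (\<lambda>r. r powr (2 - real CARD('n)) < e * \<kappa>) at_top"
    using e \<kappa> by (intro order_tendstoD) auto
  then obtain r0 where r0: "\<And>r. r0 \<le> r \<Longrightarrow> r powr (2 - real CARD('n)) < e * \<kappa>"
    unfolding eventually_at_top_linorder by blast
  have "newton x \<le> e" if "r0 \<le> norm x" for x :: "real^'n"
    using r0[OF that] \<kappa> by (simp add: newton_def \<kappa>_def[symmetric] pos_divide_le_eq less_imp_le)
  then show ?thesis by blast
qed

text \<open>The denominator equals |y|^a0 + |y|^a_inf and so exceeds each summand. The exponent
  \<open>q\<close> will be (N-2) p, the decay rate of \<Gamma>^p.\<close>

lemma V0_bound_power_pair:
  fixes y :: "'a::euclidean_space"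
  assumes y: "y \<noteq> 0" and c: "0 < c1"
  shows "c1 / (norm y powr a0 * (1 + norm y powr (a_inf - a0))) * norm y powr - q
    \<le> c1 * min (norm y powr - (a0 + q)) (norm y powr - (a_inf + q))"
proof -
  let ?s = "norm y"
  have s: "0 < ?s" using y by simp
  have D: "?s powr a0 * (1 + ?s powr (a_inf - a0)) = ?s powr a0 + ?s powr a_inf"
    using s by (simp add: distrib_left powr_add[symmetric])
  have "c1 / (?s powr a0 + ?s powr a_inf) * ?s powr - q \<le> c1 / ?s powr a * ?s powr - q"
    if "a = a0 \<or> a = a_inf" for a
    using s c that by (intro mult_right_mono divide_left_mono mult_pos_pos add_pos_pos) auto
  moreover have "c1 / ?s powr a * ?s powr - q = c1 * ?s powr - (a + q)" for a
  proof -
    have "?s powr - (a + q) = ?s powr (- a) * ?s powr (- q)" by (simp flip: powr_add)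
    then show ?thesis by (simp add: powr_minus[of ?s a] divide_inverse)
  qed
  ultimately have "c1 / (?s powr a0 + ?s powr a_inf) * ?s powr - q \<le> c1 * ?s powr - (a0 + q)"
     "c1 / (?s powr a0 + ?s powr a_inf) * ?s powr - q \<le> c1 * ?s powr - (a_inf + q)" by metis+
  then show ?thesis unfolding D using c by (simp add: min_def)
qed

text \<open>The supersolution is the multiple \<open>t * newton\<close> of the fundamental solution.\<close>

lemma minimal_solution_small:
  assumes N: "2 < CARD('n::finite)" and p: "0 < p"
    and lo: "(real CARD('n) - a_inf) / (real CARD('n) - 2) < p"
    and hi: "p < (real CARD('n) - a0) / (real CARD('n) - 2)"
  shows "\<exists>C>0. \<forall>c1>0. \<forall>V :: real^'n \<Rightarrow> real. admissible_potential a0 a_inf c1 V \<longrightarrow>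
    (\<forall>t>0. \<forall>k>0. k + c1 * C * t powr p \<le> t \<longrightarrow> (\<exists>u. is_minimal_solution p V k u))"
proof -
  define n where "n = real CARD('n)"
  define q where "q = (n - 2) * p"
  define \<kappa> where "\<kappa> = (LINT z|(lborel :: (real^'n) measure). bubble 1 z)"
  have \<kappa>: "0 < \<kappa>" using bubble_mass_pos[OF N] by (simp add: \<kappa>_def)
  have n: "2 < n" using N by (simp add: n_def)
  \<comment> \<open>The two strict bounds on \<open>p\<close>, multiplied by n - 2, are the
    integrability conditions at the origin and at infinity.\<close>
  have b: "a0 + q < n" and d: "n < a_inf + q"
    using lo hi n unfolding n_def[symmetric] q_def by (simp_all add: field_simps)
  let ?m = "\<lambda>y :: real^'n. min (norm y powr - (a0 + q)) (norm y powr - (a_inf + q))"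
  obtain B where B: "0 < B" "\<And>x :: real^'n. x \<noteq> 0 \<Longrightarrow> newton_pot (\<lambda>y. ennreal (?m y)) x \<le> ennreal (B * newton x)"
    using newton_pot_power_pair[OF N b[unfolded n_def] d[unfolded n_def]] by blast
  \<comment> \<open>\<open>B\<close> bounds the potential of the weight by the kernel; the power of
    \<open>\<kappa>\<close> comes from the normalisation of \<open>newton\<close> inside
    \<open>w powr p\<close>.\<close>
  define C where "C = B * \<kappa> powr - p"
  have C: "0 < C" using B \<kappa> by (simp add: C_def)
  have "\<exists>u. is_minimal_solution p V k u"
    if c1: "0 < c1" and V: "admissible_potential a0 a_inf c1 V" and t: "0 < t" and k: "0 < k"
      and le: "k + c1 * C * t powr p \<le> t" for c1 t k and V :: "real^'n \<Rightarrow> real"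
  proof -
    define W where "W = puncture V"
    note adm = admissible_puncture[OF V, folded W_def]
    note Wm [measurable] = adm(1)
    define w where "w x = t * newton x" for x :: "real^'n"
    have wm [measurable]: "w \<in> borel_measurable borel" unfolding w_def by measurable
    have w0: "0 \<le> w x" for x using t newton_nonneg[OF N, of x] by (simp add: w_def)
    define D where "D = c1 * t powr p * \<kappa> powr - p"
    have D: "0 \<le> D" using c1 by (simp add: D_def)
    have Ww: "W y * w y powr p \<le> D * ?m y" if y: "y \<noteq> 0" for y
    proof -
      have "w y powr p = t powr p * \<kappa> powr - p * norm y powr - q"
      proof -
        have "w y powr p = t powr p * ((norm y powr (2 - n)) powr p / \<kappa> powr p)"
          using t \<kappa> by (simp add: w_def newton_def n_def \<kappa>_def[symmetric] powr_mult powr_divide)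
        also have "(norm y powr (2 - n)) powr p = norm y powr - q"
          by (simp add: powr_powr q_def algebra_simps)
        finally show ?thesis by (simp add: powr_minus field_simps)
      qed
      moreover have "W y * norm y powr - q \<le> c1 * ?m y"
      proof -
        have "W y * norm y powr - q \<le> c1 / (norm y powr a0 * (1 + norm y powr (a_inf - a0))) * norm y powr - q"
          using adm(3)[OF y] by (intro mult_right_mono) (auto simp: V0_bound_def)
        also have "\<dots> \<le> c1 * ?m y" by (rule V0_bound_power_pair[OF y c1])
        finally show ?thesis .
      qed
      then have "(t powr p * \<kappa> powr - p) * (W y * norm y powr - q) \<le> (t powr p * \<kappa> powr - p) * (c1 * ?m y)"
        by (intro mult_left_mono) auto
      ultimately show ?thesis by (simp add: D_def mult_ac)
    qed
    have AEW: "AE y in lborel. W y * w y powr p \<le> D * ?m y"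
      using AE_lborel_singleton[of "0 :: real^'n"] by eventually_elim (rule Ww)
    have f0: "0 \<le> W y * w y powr p" for y using adm(2) by simp
    have mm: "(\<lambda>y. ennreal (?m y)) \<in> borel_measurable borel" by measurable
    have wi: "integrable lborel (\<lambda>x. W x * w x powr p)"
    proof (rule integrableI_bounded)
      have "(\<integral>\<^sup>+x. ennreal (norm (W x * w x powr p)) \<partial>lborel) \<le> (\<integral>\<^sup>+x. ennreal D * ennreal (?m x) \<partial>lborel)"
      proof (rule nn_integral_mono_AE)
        show "AE x in lborel. ennreal (norm (W x * w x powr p)) \<le> ennreal D * ennreal (?m x)"
          using AEW
        proof eventually_elim
          case (elim x)
          then show ?case using f0[of x] D by (simp add: ennreal_mult'[symmetric] ennreal_leI del: min_mult_distrib_left)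
        qed
      qed
      also have "\<dots> = ennreal D * (\<integral>\<^sup>+x. ennreal (?m x) \<partial>lborel)" by (rule nn_integral_cmult) measurable
      also have "\<dots> < \<infinity>"
        using nn_integral_power_pair[where 'a = "real^'n", of "a0 + q" "a_inf + q"] b d
        by (auto simp: n_def ennreal_mult_less_top)
      finally show "(\<integral>\<^sup>+x. ennreal (norm (W x * w x powr p)) \<partial>lborel) < \<infinity>" .
    qed measurable
    have super: "AE x in lborel. ennreal (k * newton x) + newton_pot (\<lambda>y. ennreal (W y * w y powr p)) x \<le> ennreal (w x)"
      using AE_lborel_singleton[of "0 :: real^'n"]
    proof eventually_elim
      case (elim x)
      have nx: "0 \<le> newton x" by (rule newton_nonneg[OF N])
      have "newton_pot (\<lambda>y. ennreal (W y * w y powr p)) x \<le> newton_pot (\<lambda>y. ennreal D * ennreal (?m y)) x"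
      proof (rule newton_pot_mono_AE)
        show "AE y in lborel. ennreal (W y * w y powr p) \<le> ennreal D * ennreal (?m y)"
          using AEW by eventually_elim (use D in \<open>simp only: ennreal_mult'[symmetric] ennreal_leI\<close>)
      qed
      also have "\<dots> = ennreal D * newton_pot (\<lambda>y. ennreal (?m y)) x"
        unfolding newton_pot_def
        by (subst nn_integral_cmult[symmetric]) (measurable, simp only: mult.left_commute)
      also have "\<dots> \<le> ennreal D * ennreal (B * newton x)"
        by (intro mult_left_mono B elim) simp
      also have "\<dots> = ennreal (D * (B * newton x))" using D by (simp add: ennreal_mult')
      finally have "ennreal (k * newton x) + newton_pot (\<lambda>y. ennreal (W y * w y powr p)) x \<le>
         ennreal (k * newton x) + ennreal (D * (B * newton x))" by (rule add_left_mono)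
      also have "\<dots> = ennreal (k * newton x + D * (B * newton x))"
        using k D B(1) nx by (intro ennreal_plus[symmetric] mult_nonneg_nonneg) auto
      also have "k * newton x + D * (B * newton x) = (k + c1 * C * t powr p) * newton x"
        by (simp add: D_def C_def algebra_simps)
      also have "\<dots> \<le> ennreal (w x)"
        unfolding w_def using le nx by (intro ennreal_leI mult_right_mono)
      finally show ?case .
    qed
    have dec: "\<exists>r. AE x in lborel. r \<le> norm x \<longrightarrow> w x \<le> e" if "0 < e" for e
    proof -
      have "0 < e / t" using that t by simp
      then obtain r where r: "\<And>x :: real^'n. r \<le> norm x \<Longrightarrow> newton x \<le> e / t" using newton_decay[OF N] by metis
      have "w x \<le> e" if "r \<le> norm x" for x using r[OF that] t by (simp add: w_def field_simps)
      then show ?thesis by (intro exI[of _ r] AE_I2) blast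
    qed
    obtain v where "is_minimal_solution p W k v"
      using minimal_solution_exists[OF N p k Wm wm adm(2) w0 super wi dec] by blast
    then show ?thesis unfolding W_def is_minimal_solution_puncture by blast
  qed
  then show ?thesis using C by blast
qed

section \<open>A priori bound on k in the superlinear case\<close>

text \<open>Let A be the integral of v^p over a ball where \<open>W\<close> is at least \<delta>.
  The potential term gives v \<ge> c \<delta> A there; raising to the power p and integrating yields
  A \<ge> (c \<delta> A)^p \<beta>, which bounds A because p > 1. The Dirac term gives v \<ge> k
  \<gamma>, so A controls k.\<close>

lemma solution_bound:
  fixes W :: "real^'n \<Rightarrow> real"
  assumes N: "2 < CARD('n)" and p: "1 < p" and Wm [measurable]: "W \<in> borel_measurable borel"
    and W: "\<And>x. 0 \<le> W x" and r: "0 < r" and \<delta>: "0 < \<delta>" and Wd: "\<And>x. x \<in> cball a r \<Longrightarrow> \<delta> \<le> W x"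
  shows "\<exists>K. \<forall>k>0. \<forall>u. is_solution p W k u \<longrightarrow> k \<le> K"
proof -
  define n where "n = real CARD('n)"
  define \<kappa> where "\<kappa> = (LINT z|(lborel :: (real^'n) measure). bubble 1 z)"
  have \<kappa>: "0 < \<kappa>" using bubble_mass_pos[OF N] by (simp add: \<kappa>_def)
  have n: "2 < n" using N by (simp add: n_def)
  have lower: "s powr (2 - n) / \<kappa> \<le> newton z" if "z \<noteq> 0" "norm z \<le> s" for z :: "real^'n" and s
    unfolding newton_def n_def[symmetric] \<kappa>_def[symmetric]
    using that n \<kappa> by (intro divide_right_mono powr_mono2') auto
  \<comment> \<open>\<open>c\<close> bounds the kernel below between two distinct points of the
    ball, at distance at most 2r; \<open>\<gamma>\<close> bounds it below between the origin and the
    ball.\<close>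
  define c where "c = (2 * r) powr (2 - n) / \<kappa>"
  define \<gamma> where "\<gamma> = (norm a + r) powr (2 - n) / \<kappa>"
  have c: "0 < c" using r \<kappa> by (simp add: c_def)
  have "0 < norm a + r" using r by (simp add: add_nonneg_pos)
  then have \<gamma>: "0 < \<gamma>" using \<kappa> by (simp add: \<gamma>_def)
  define \<beta> where "\<beta> = measure lborel (cball a r)"
  have \<beta>: "0 < \<beta>"
    using r by (simp add: \<beta>_def measure_def emeasure_cball)
  \<comment> \<open>The largest positive A compatible with (c \<delta> A)^p \<beta> \<le> A.\<close>
  define M where "M = (1 / ((c * \<delta>) powr p * \<beta>)) powr (1 / (p - 1))"
  have "k \<le> (M / \<beta>) powr (1 / p) / \<gamma>" if k: "0 < k" and u: "is_solution p W k u" for k u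
  proof -
    have "u \<in> borel_measurable lebesgue" "AE x in lebesgue. 0 \<le> u x"
      using u L1_loc_measurable unfolding is_solution_def by blast+
    then obtain v where vm [measurable]: "v \<in> borel_measurable borel" and v0: "\<And>x. 0 \<le> v x"
      and uv: "AE x in lebesgue. u x = v x"
      using borel_nonneg_representative by blast
    have sol: "is_solution p W k v" by (rule is_solution_cong[OF u _ uv]) simp
    have rep: "AE x in lborel. ennreal (k * newton x) + newton_pot (\<lambda>y. ennreal (W y * v y powr p)) x = ennreal (v x)"
      by (rule solution_representation[OF N k Wm vm W v0 sol])
    let ?g = "\<lambda>x. v x powr p * indicator (cball a r) x"
    have gm [measurable]: "?g \<in> borel_measurable borel"
      by (intro borel_measurable_times borel_measurable_indicator) measurable
    have "integrable lborel (\<lambda>x. W x * v x powr p)"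
      using sol unfolding is_solution_def by (subst (asm) integrable_completion) auto
    \<comment> \<open>Dividing by the lower bound of \<open>W\<close> turns integrability of the
      source into that of v^p on the ball.\<close>
    then have "integrable lborel (\<lambda>x. 1 / \<delta> * (W x * v x powr p))" by (rule integrable_mult_right)
    then have gi: "integrable lborel ?g"
    proof (rule Bochner_Integration.integrable_bound)
      show "AE x in lborel. norm (?g x) \<le> norm (1 / \<delta> * (W x * v x powr p))"
      proof (rule AE_I2)
        fix x
        show "norm (?g x) \<le> norm (1 / \<delta> * (W x * v x powr p))"
        proof (cases "x \<in> cball a r")
          case True
          then have "\<delta> * v x powr p \<le> W x * v x powr p" using Wd by (intro mult_right_mono) auto
          then show ?thesis using True W \<delta> by (simp add: field_simps)
        qed simp
      qed
    qed measurable
    define A where "A = (LINT x|lborel. ?g x)"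
    have ii: "integrable lborel (\<lambda>x. s * indicator (cball a r) x :: real)" for s
      by (intro integrable_mult_right integrable_real_indicator)
        (auto simp: emeasure_lborel_cball_finite[unfolded infinity_ennreal_def])
    have lowA: "s powr p * \<beta> \<le> A" if s: "0 \<le> s" and low: "AE x in lborel. x \<in> cball a r \<longrightarrow> s \<le> v x" for s
    proof -
      have "s powr p * \<beta> = (LINT x|lborel. s powr p * indicator (cball a r) x)"
        by (simp add: \<beta>_def)
      also have "\<dots> \<le> A"
        unfolding A_def
      proof (rule integral_mono_AE[OF ii gi])
        show "AE x in lborel. s powr p * indicator (cball a r) x \<le> ?g x"
          using low
        proof eventually_elim
          case (elim x)
          then show ?case using s p by (cases "x \<in> cball a r") (auto intro: powr_mono2)
        qed
      qed
      finally show ?thesis .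
    qed
    have "AE x in lborel. x \<in> cball a r \<longrightarrow> k * \<gamma> \<le> v x"
      using rep AE_lborel_singleton[of "0 :: real^'n"]
    proof eventually_elim
      case (elim x)
      show ?case
      proof
        assume "x \<in> cball a r"
        then have "norm x \<le> norm a + r"
          using norm_triangle_ineq[of a "x - a"] by (simp add: dist_norm norm_minus_commute)
        then have "\<gamma> \<le> newton x" unfolding \<gamma>_def by (rule lower[OF elim(2)])
        then have "k * \<gamma> \<le> k * newton x" using k by (intro mult_left_mono) auto
        then have "ennreal (k * \<gamma>) \<le> ennreal (k * newton x)" by (rule ennreal_leI)
        also have "\<dots> \<le> ennreal (v x)" unfolding elim(1)[symmetric] by (rule add_increasing2) auto
        finally show "k * \<gamma> \<le> v x" using v0 by simp
      qed
    qed
    from lowA[OF _ this] have A1: "(k * \<gamma>) powr p * \<beta> \<le> A" using k \<gamma> by simp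
    moreover have "0 < (k * \<gamma>) powr p * \<beta>" using k \<gamma> \<beta> by simp
    ultimately have A0: "0 < A" by linarith
    have "AE x in lborel. x \<in> cball a r \<longrightarrow> c * \<delta> * A \<le> v x"
      using rep
    proof eventually_elim
      case (elim x)
      show ?case
      proof
        assume x: "x \<in> cball a r"
        have "ennreal (c * \<delta> * A) = ennreal (c * \<delta>) * (\<integral>\<^sup>+y. ennreal (?g y) \<partial>lborel)"
          using gi c \<delta> by (subst nn_integral_eq_integral) (auto simp: A_def ennreal_mult')
        also have "\<dots> = (\<integral>\<^sup>+y. ennreal (c * \<delta>) * ennreal (?g y) \<partial>lborel)"
          by (rule nn_integral_cmult[symmetric]) measurable
        also have "\<dots> \<le> newton_pot (\<lambda>y. ennreal (W y * v y powr p)) x"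
          unfolding newton_pot_def
        proof (rule nn_integral_mono_AE)
          show "AE y in lborel. ennreal (c * \<delta>) * ennreal (?g y) \<le> ennreal (newton (x - y)) * ennreal (W y * v y powr p)"
            using AE_lborel_singleton[of x]
          proof eventually_elim
            case (elim y)
            show ?case
            proof (cases "y \<in> cball a r")
              case True
              have "norm (x - y) \<le> 2 * r"
                using x True dist_triangle[of x y a] by (simp add: dist_norm norm_minus_commute)
              then have "c \<le> newton (x - y)" unfolding c_def using elim by (intro lower) auto
              then have "c * (\<delta> * v y powr p) \<le> newton (x - y) * (W y * v y powr p)"
                using c \<delta> W Wd[OF True] newton_nonneg[OF N, of "x - y"]
                by (intro mult_mono mult_nonneg_nonneg) auto
              then have "ennreal (c * (\<delta> * v y powr p)) \<le> ennreal (newton (x - y) * (W y * v y powr p))" by (rule ennreal_leI)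
              then show ?thesis using True c \<delta> newton_nonneg[OF N, of "x - y"]
                by (simp add: ennreal_mult'[symmetric] mult.assoc)
            qed simp
          qed
        qed
        also have "\<dots> \<le> ennreal (v x)" unfolding elim[symmetric] by (rule add_increasing) auto
        finally show "c * \<delta> * A \<le> v x" using v0 by simp
      qed
    qed
    from lowA[OF _ this] have "(c * \<delta> * A) powr p * \<beta> \<le> A" using c \<delta> A0 by simp
    then have "(c * \<delta>) powr p * \<beta> * A powr p \<le> A" using c \<delta> A0 by (simp add: powr_mult mult_ac)
    moreover have "A powr p = A powr (p - 1) * A" using A0 by (simp add: powr_diff)
    ultimately have "(c * \<delta>) powr p * \<beta> * A powr (p - 1) * A \<le> 1 * A" by (simp add: mult.assoc)
    then have "(c * \<delta>) powr p * \<beta> * A powr (p - 1) \<le> 1" using A0 by (simp only: mult_le_cancel_right_pos)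
    then have "A powr (p - 1) \<le> 1 / ((c * \<delta>) powr p * \<beta>)"
      using c \<delta> \<beta> by (simp add: field_simps)
    then have "(A powr (p - 1)) powr (1 / (p - 1)) \<le> M"
      unfolding M_def using p by (intro powr_mono2) auto
    then have "A \<le> M" using A0 p by (simp add: powr_powr)
    with A1 have "(k * \<gamma>) powr p \<le> M / \<beta>" using \<beta> by (simp add: field_simps)
    then have "((k * \<gamma>) powr p) powr (1 / p) \<le> (M / \<beta>) powr (1 / p)"
      using p by (intro powr_mono2) auto
    then have "k * \<gamma> \<le> (M / \<beta>) powr (1 / p)" using k \<gamma> p by (simp add: powr_powr)
    then show ?thesis using \<gamma> by (simp add: field_simps)
  qed
  then show ?thesis by blast
qed

section \<open>The supremum k*\<close>

lemma k_star_upper: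
  assumes "is_minimal_solution p V k u" and "0 < k"
  shows "ennreal k \<le> k_star p V"
  unfolding k_star_def using assms by (intro Sup_upper) auto

lemma less_k_starD:
  assumes "ennreal k < k_star p V" and "0 < k"
  obtains k' u where "k < k'" "is_minimal_solution p V k' u"
proof -
  obtain k' u where "0 < k'" "is_minimal_solution p V k' u" "ennreal k < ennreal k'"
    using assms(1) unfolding k_star_def less_Sup_iff by auto
  with assms(2) show thesis by (intro that) (auto simp: ennreal_less_iff)
qed

lemma minimal_solution_transfer:
  fixes V1 V2 :: "real^'n \<Rightarrow> real"
  assumes N: "2 < CARD('n)" and p: "0 < p" and k: "0 < k2" "k2 \<le> k1"
    and V1: "admissible_potential a0 a_inf c1 V1" and V2: "admissible_potential a0 a_inf c1 V2"
    and le: "\<And>x. x \<noteq> 0 \<Longrightarrow> V2 x \<le> V1 x" and u: "is_solution p V1 k1 u"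
  shows "\<exists>v. is_minimal_solution p V2 k2 v \<and> (AE x in lebesgue. v x \<le> u x) \<and>
    (radially_symmetric V2 \<longrightarrow> radially_symmetric v)"
proof -
  have "puncture V2 x \<le> puncture V1 x" for x using le by (simp add: puncture_def)
  moreover have "is_solution p (puncture V1) k1 u" by (rule is_solution_cong[OF u puncture_AE(1)]) simp
  ultimately obtain v where v: "is_minimal_solution p (puncture V2) k2 v" "AE x in lebesgue. v x \<le> u x"
    "radially_symmetric (puncture V2) \<longrightarrow> radially_symmetric v"
    using minimal_solution_below[OF N p k admissible_puncture(1)[OF V1] admissible_puncture(1)[OF V2]
        admissible_puncture(2)[OF V2]] by blast
  have "radially_symmetric (puncture V2)" if "radially_symmetric V2"
    using that unfolding radially_symmetric_def puncture_def by (metis norm_eq_zero)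
  with v show ?thesis unfolding is_minimal_solution_puncture by blast
qed

text \<open>By continuity and nonnegativity, one nonzero value of \<open>V\<close> makes it exceed
  half that value on a small ball avoiding the origin; the a priori bound applies there.\<close>

lemma k_star_finite:
  fixes V :: "real^'n \<Rightarrow> real"
  assumes N: "2 < CARD('n)" and p: "1 < p" and V: "admissible_potential a0 a_inf c1 V"
    and x: "x \<noteq> 0" "V x \<noteq> 0"
  shows "k_star p V < \<infinity>"
proof -
  have Vx: "0 < V x" using V x unfolding admissible_potential_def by (metis less_eq_real_def)
  have "isCont V x"
    using admissible_puncture(4)[OF V] x(1) continuous_on_eq_continuous_at[of "- {0}" V] by (simp add: open_Compl)
  then have "eventually (\<lambda>y. V x / 2 < V y) (nhds x)"
    unfolding isCont_def tendsto_nhds_iff[symmetric]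
    using Vx order_tendstoD(1)[of V "V x" "nhds x" "V x / 2"] by (simp add: tendsto_nhds_iff)
  moreover have "eventually (\<lambda>y. y \<noteq> 0) (nhds x)"
    using x by (intro t1_space_nhds)
  ultimately have "eventually (\<lambda>y. V x / 2 < V y \<and> y \<noteq> 0) (nhds x)" by (rule eventually_conj)
  then obtain e where e: "0 < e" "\<And>y. dist y x < e \<Longrightarrow> V x / 2 < V y \<and> y \<noteq> 0"
    unfolding eventually_nhds_metric by blast
  have "V x / 2 \<le> puncture V y" if "y \<in> cball x (e / 2)" for y
  proof -
    have "dist y x < e" using that e(1) by (simp add: dist_commute)
    then show ?thesis using e(2)[of y] by (simp add: puncture_def)
  qed
  then obtain K where K: "\<And>k u. 0 < k \<Longrightarrow> is_solution p (puncture V) k u \<Longrightarrow> k \<le> K"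
    using solution_bound[OF N p admissible_puncture(1,2)[OF V], of "e / 2" "V x / 2" x] e(1) Vx by auto
  have "k_star p V \<le> ennreal K"
    unfolding k_star_def
  proof (rule Sup_least, clarify)
    fix k u assume k: "0 < k" and u: "is_minimal_solution p V k u"
    then have "is_solution p V k u" unfolding is_minimal_solution_def is_positive_solution_def by blast
    then have "is_solution p (puncture V) k u" by (rule is_solution_cong[OF _ puncture_AE(1)]) simp
    then show "ennreal k \<le> ennreal K" using K[OF k] by (intro ennreal_leI)
  qed
  also have "\<dots> < \<infinity>" by simp
  finally show ?thesis .
qed

lemma k_star_eq_top:
  assumes "\<And>k. 0 < k \<Longrightarrow> \<exists>u. is_minimal_solution p V k u"
  shows "k_star p V = \<infinity>"
proof (rule ccontr)
  assume "k_star p V \<noteq> \<infinity>"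
  then obtain s where s: "k_star p V = ennreal s" "0 \<le> s" by (cases "k_star p V") auto
  then have "ennreal (s + 1) \<le> ennreal s" using k_star_upper assms[of "s + 1"] by (metis add_nonneg_pos zero_less_one)
  then show False using s by (simp add: ennreal_le_iff)
qed

text \<open>For p = 1 the equation is linear and solutions scale with k, so the threshold is 0 or
  infinite, and small \<open>c1\<close> guarantees the latter. Finiteness for p > 1 asks for a
  nonzero potential, as V = 0 admits k \<Gamma> for every k.\<close>

theorem theorem1p1:
  fixes a0 a_inf p :: real
  assumes "CARD('n::finite) > 2"
    and "a0 < real CARD('n)"
    and "a_inf > a0"
    and "p > 0"
    and "(real CARD('n) - a_inf) / (real CARD('n) - 2) < p"
    and "p < (real CARD('n) - a0) / (real CARD('n) - 2)"
  shows
    "(\<exists>\<epsilon>::real. \<epsilon> > 0 \<and>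
        (\<forall>c1>0. \<forall>V::real^'n \<Rightarrow> real. admissible_potential a0 a_inf c1 V \<longrightarrow>
           ((p \<noteq> 1 \<or> c1 < \<epsilon>) \<longrightarrow> 0 < k_star p V) \<and>
           (\<forall>k>0. ennreal k < k_star p V \<longrightarrow> (\<exists>u. is_minimal_solution p V k u)) \<and>
           (p > 1 \<longrightarrow> (\<forall>k>0. k_star p V < ennreal k \<longrightarrow> \<not> (\<exists>u. is_solution p V k u))) \<and>
           (p > 1 \<and> (\<exists>x. x \<noteq> 0 \<and> V x \<noteq> 0) \<longrightarrow> k_star p V < \<infinity>) \<and>
           (p < 1 \<or> p = 1 \<and> c1 < \<epsilon> \<longrightarrow> k_star p V = \<infinity>)))
     \<and>
     (\<forall>c1>0. \<forall>V1 V2::real^'n \<Rightarrow> real.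
        admissible_potential a0 a_inf c1 V1 \<and> admissible_potential a0 a_inf c1 V2 \<and>
        (\<forall>x. x \<noteq> 0 \<longrightarrow> V2 x \<le> V1 x) \<longrightarrow>
          k_star p V1 \<le> k_star p V2 \<and>
          (\<forall>k>0. ennreal k < k_star p V1 \<longrightarrow>
             (\<forall>u1 u2. is_minimal_solution p V1 k u1 \<and> is_minimal_solution p V2 k u2 \<longrightarrow>
                (AE x in lebesgue. u2 x \<le> u1 x))))
     \<and>
     (\<forall>c1>0. \<forall>V::real^'n \<Rightarrow> real.
        admissible_potential a0 a_inf c1 V \<and> radially_symmetric V \<longrightarrow>
          (\<forall>k>0. ennreal k < k_star p V \<longrightarrow>
             (\<forall>u. is_minimal_solution p V k u \<longrightarrow> radially_symmetric_AE u)))"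
proof -
  note N = assms(1) and p = assms(4)
  obtain C where C: "0 < C" and small: "\<And>c1 V t k. 0 < c1 \<Longrightarrow> admissible_potential a0 a_inf c1 (V :: real^'n \<Rightarrow> real) \<Longrightarrow>
      0 < t \<Longrightarrow> 0 < k \<Longrightarrow> k + c1 * C * t powr p \<le> t \<Longrightarrow> \<exists>u. is_minimal_solution p V k u"
    using minimal_solution_small[OF N p assms(5,6)] by metis
  have minsol: "is_solution p V k u" if "is_minimal_solution p V k u" for V k and u :: "real^'n \<Rightarrow> real"
    using that unfolding is_minimal_solution_def is_positive_solution_def by blast
  have exist: "\<exists>u. is_minimal_solution p V k u"
    if c1: "0 < c1" and V: "admissible_potential a0 a_inf c1 V" and k: "0 < k" and h: "p < 1 \<or> p = 1 \<and> c1 < 1 / C"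
    for c1 k and V :: "real^'n \<Rightarrow> real"
  proof -
    have "\<exists>t>0. k + c1 * C * t powr p \<le> t"
    proof (cases "p < 1")
      case True
      \<comment> \<open>The maximum makes each of the two terms at most t/2: the first entry handles
        \<open>k\<close>, the second the power, which is sublinear.\<close>
      define t where "t = max (2 * k) ((2 * (c1 * C)) powr (1 / (1 - p)))"
      have t: "0 < t" using k by (simp add: t_def)
      have "2 * (c1 * C) = ((2 * (c1 * C)) powr (1 / (1 - p))) powr (1 - p)"
        using True c1 C by (simp add: powr_powr)
      also have "\<dots> \<le> t powr (1 - p)" using True by (intro powr_mono2) (auto simp: t_def)
      finally have "2 * (c1 * C) * t powr p \<le> t powr (1 - p) * t powr p" by (intro mult_right_mono) auto
      also have "\<dots> = t" using t by (simp add: powr_add[symmetric])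
      finally have "c1 * C * t powr p \<le> t / 2" by simp
      moreover have "k \<le> t / 2" by (simp add: t_def)
      ultimately show ?thesis using t by (intro exI[of _ t]) linarith
    next
      case False
      then have p1: "p = 1" and c: "c1 * C < 1" using h C by (auto simp: field_simps)
      \<comment> \<open>For p = 1 this \<open>t\<close> solves k + c1 C t = t.\<close>
      define t where "t = k / (1 - c1 * C)"
      have t: "0 < t" using k c by (simp add: t_def)
      have "k + c1 * C * t = t" using c by (simp add: t_def field_simps)
      then show ?thesis using t p1 by (intro exI[of _ t]) auto
    qed
    then show ?thesis using small[OF c1 V _ k] by blast
  qed
  have exist_super: "\<exists>k>0. \<exists>u. is_minimal_solution p V k u"
    if c1: "0 < c1" and V: "admissible_potential a0 a_inf c1 V" and h: "1 < p" for c1 and V :: "real^'n \<Rightarrow> real"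
  proof -
    \<comment> \<open>Chosen so that c1 C t^p = t/2, which leaves room for k = t/2.\<close>
    define t where "t = (1 / (2 * (c1 * C))) powr (1 / (p - 1))"
    have t: "0 < t" using c1 C by (simp add: t_def)
    have "t powr (p - 1) = 1 / (2 * (c1 * C))" using h c1 C by (simp add: t_def powr_powr)
    moreover have "t powr p = t powr (p - 1) * t" using t by (simp add: powr_diff)
    ultimately have "c1 * C * t powr p = t / 2" using c1 C by simp
    then have "t / 2 + c1 * C * t powr p \<le> t" by simp
    from small[OF c1 V t _ this] t show ?thesis by (intro exI[of _ "t / 2"]) simp
  qed
  have below: "\<exists>v. is_minimal_solution p V2 k v \<and> (AE x in lebesgue. v x \<le> u x) \<and>
      (radially_symmetric V2 \<longrightarrow> radially_symmetric v)"
    if "0 < k" "k \<le> k'" "admissible_potential a0 a_inf c1 V1" "admissible_potential a0 a_inf c1 V2"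
      "\<forall>x. x \<noteq> 0 \<longrightarrow> V2 x \<le> V1 x" "is_solution p V1 k' u"
    for k k' c1 and V1 V2 u :: "real^'n \<Rightarrow> real"
    using minimal_solution_transfer[OF N p that(1-4) _ that(6)] that(5) by blast
  \<comment> \<open>Below the supremum some larger \<open>k'\<close> is attained, and its solution
    is a barrier for \<open>k\<close>; the admissible values form an interval.\<close>
  have ex: "\<exists>u. is_minimal_solution p V k u"
    if V: "admissible_potential a0 a_inf c1 V" and k: "0 < k" "ennreal k < k_star p V" for c1 k and V :: "real^'n \<Rightarrow> real"
  proof -
    obtain k' u where k': "k < k'" "is_minimal_solution p V k' u" using less_k_starD[OF k(2,1)] by blast
    then show ?thesis using below[OF k(1) less_imp_le[OF k'(1)] V V _ minsol[OF k'(2)]] by blast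
  qed
  show ?thesis
  proof (intro conjI)
    show "\<exists>\<epsilon>::real. \<epsilon> > 0 \<and>
        (\<forall>c1>0. \<forall>V::real^'n \<Rightarrow> real. admissible_potential a0 a_inf c1 V \<longrightarrow>
           ((p \<noteq> 1 \<or> c1 < \<epsilon>) \<longrightarrow> 0 < k_star p V) \<and>
           (\<forall>k>0. ennreal k < k_star p V \<longrightarrow> (\<exists>u. is_minimal_solution p V k u)) \<and>
           (p > 1 \<longrightarrow> (\<forall>k>0. k_star p V < ennreal k \<longrightarrow> \<not> (\<exists>u. is_solution p V k u))) \<and>
           (p > 1 \<and> (\<exists>x. x \<noteq> 0 \<and> V x \<noteq> 0) \<longrightarrow> k_star p V < \<infinity>) \<and>
           (p < 1 \<or> p = 1 \<and> c1 < \<epsilon> \<longrightarrow> k_star p V = \<infinity>))"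
    \<comment> \<open>At p = 1 the barrier condition k + c1 C t \<le> t is solvable in
      \<open>t\<close> for every k as soon as c1 C < 1.\<close>
    proof (intro exI[of _ "1 / C"] conjI allI impI)
      show "0 < 1 / C" using C by simp
    next
      fix c1 :: real and V :: "real^'n \<Rightarrow> real"
      assume c1: "0 < c1" and V: "admissible_potential a0 a_inf c1 V"
      show top: "k_star p V = \<infinity>" if "p < 1 \<or> p = 1 \<and> c1 < 1 / C"
        using exist[OF c1 V _ that] by (rule k_star_eq_top)
      show "0 < k_star p V" if h: "p \<noteq> 1 \<or> c1 < 1 / C"
      proof (cases "1 < p")
        case True
        obtain k u where k: "0 < k" "is_minimal_solution p V k u" using exist_super[OF c1 V True] by blast
        then have "0 < ennreal k" by simp
        also have "\<dots> \<le> k_star p V" using k_star_upper k by blast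
        finally show ?thesis .
      next
        case False
        then have "k_star p V = \<infinity>" using h by (intro top) auto
        then show ?thesis by simp
      qed
      show "\<exists>u. is_minimal_solution p V k u" if "0 < k" "ennreal k < k_star p V" for k
        using ex[OF V that] .
      show "\<not> (\<exists>u. is_solution p V k u)" if "p > 1" and k: "0 < k" "k_star p V < ennreal k" for k
      proof
        assume "\<exists>u. is_solution p V k u"
        then obtain u where "is_solution p V k u" by blast
        then obtain v where "is_minimal_solution p V k v" using below[OF k(1) order_refl V V] by blast
        then have "ennreal k \<le> k_star p V" using k_star_upper k(1) by blast
        then show False using k(2) by simp
      qed
      show "k_star p V < \<infinity>" if "p > 1 \<and> (\<exists>x. x \<noteq> 0 \<and> V x \<noteq> 0)"
        using that k_star_finite[OF N _ V] by blast
    qed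
    show "\<forall>c1>0. \<forall>V1 V2::real^'n \<Rightarrow> real.
        admissible_potential a0 a_inf c1 V1 \<and> admissible_potential a0 a_inf c1 V2 \<and>
        (\<forall>x. x \<noteq> 0 \<longrightarrow> V2 x \<le> V1 x) \<longrightarrow>
          k_star p V1 \<le> k_star p V2 \<and>
          (\<forall>k>0. ennreal k < k_star p V1 \<longrightarrow>
             (\<forall>u1 u2. is_minimal_solution p V1 k u1 \<and> is_minimal_solution p V2 k u2 \<longrightarrow>
                (AE x in lebesgue. u2 x \<le> u1 x)))"
    proof (intro allI impI, elim conjE, intro conjI allI impI)
      fix c1 :: real and V1 V2 :: "real^'n \<Rightarrow> real"
      assume V: "admissible_potential a0 a_inf c1 V1" "admissible_potential a0 a_inf c1 V2"
        and le: "\<forall>x. x \<noteq> 0 \<longrightarrow> V2 x \<le> V1 x"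
      show "k_star p V1 \<le> k_star p V2"
        unfolding k_star_def[of p V1]
      proof (rule Sup_least, clarify)
        fix k u assume k: "0 < k" and u: "is_minimal_solution p V1 k u"
        obtain v where "is_minimal_solution p V2 k v" using below[OF k order_refl V le minsol[OF u]] by blast
        then show "ennreal k \<le> k_star p V2" using k by (rule k_star_upper)
      qed
      fix k :: real and u1 u2 :: "real^'n \<Rightarrow> real"
      assume k: "0 < k" and u: "is_minimal_solution p V1 k u1 \<and> is_minimal_solution p V2 k u2"
      obtain v where v: "is_minimal_solution p V2 k v" "AE x in lebesgue. v x \<le> u1 x"
        using below[OF k order_refl V le minsol] u by blast
      \<comment> \<open>\<open>u1\<close> need not solve the problem for \<open>V2\<close>, so
        minimality of \<open>u2\<close> is applied to the intermediate solution \<open>v\<close>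
        lying below \<open>u1\<close>.\<close>
      have "AE x in lebesgue. u2 x \<le> v x" using u v(1) unfolding is_minimal_solution_def by blast
      then show "AE x in lebesgue. u2 x \<le> u1 x" using v(2) by eventually_elim simp
    qed
    show "\<forall>c1>0. \<forall>V::real^'n \<Rightarrow> real.
        admissible_potential a0 a_inf c1 V \<and> radially_symmetric V \<longrightarrow>
          (\<forall>k>0. ennreal k < k_star p V \<longrightarrow>
             (\<forall>u. is_minimal_solution p V k u \<longrightarrow> radially_symmetric_AE u))"
    proof (intro allI impI, elim conjE)
      fix c1 k :: real and V u :: "real^'n \<Rightarrow> real"
      assume V: "admissible_potential a0 a_inf c1 V" and rad: "radially_symmetric V"
        and k: "0 < k" and u: "is_minimal_solution p V k u"
      \<comment> \<open>The given minimal solution is only a class; it is identified with the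
        pointwise radial one through inequalities in both directions.\<close>
      obtain v where v: "is_minimal_solution p V k v" "AE x in lebesgue. v x \<le> u x" "radially_symmetric v"
        using below[OF k order_refl V V _ minsol[OF u]] rad by blast
      have "AE x in lebesgue. u x \<le> v x" using u v(1) unfolding is_minimal_solution_def by blast
      then have uv: "AE x in lebesgue. u x = v x" using v(2) by eventually_elim simp
      \<comment> \<open>The profile reads \<open>v\<close> at an arbitrary vector of the prescribed
        norm; for negative arguments the choice is a default value.\<close>
      define \<phi> where "\<phi> s = v (SOME x. norm x = s)" for s
      have "v x = \<phi> (norm x)" for x
      proof -
        have "norm (SOME y :: real^'n. norm y = norm x) = norm x" by (rule someI[where x = x]) simp
        then show ?thesis using v(3) unfolding \<phi>_def radially_symmetric_def by metis
      qed
      then have "AE x in lebesgue. u x = \<phi> (norm x)" using uv by simp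
      then show "radially_symmetric_AE u" unfolding radially_symmetric_AE_def by blast
    qed
  qed
qed

end
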